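(* Let $T\subset\mathbb{N}$ be a divisor stable subset. Assume that for $A_\bullet=(A_S)_{S\preccurlyeq T}$ in $\mathcal{RFV}_T$ the ring $A=A_{\{1\}}$ has no $T$-torsion. Let $\alpha:A_\bullet\to W_\bullet(A)$ be the unique morphism in $\mathcal{RF}_T$ with $\alpha_{\{1\}}=\mathrm{id}_A$, which is characterized by $(\log_S\circ\alpha_S)(a)=(\pi F_n(a))_{n\in S}$ for $a\in A_S$, $S\preccurlyeq T$ (with $\pi:A_{S/n}\to A_{\{1\}}=A$). Then $\alpha$ defines an isomorphism in $\mathcal{RFV}_T$. In particular it is an isomorphism in $\mathcal{RF}_T$.
   Context: Conventions. Rings are commutative and associative, not necessarily unital; the categories below exist in a unital version (all rings and ring homomorphisms unital) and a non-unital version, and the result holds in both. $\mathbb{N}=\{1,2,\dots\}$. A non-empty $S\subset\mathbb{N}$ is divisor stable if $n\in S$, $d\mid n$ imply $d\in S$. For $n\in S$ put $S/n=\{\nu\in S\mid \nu n\in S\}$ and, for a prime $p\in S$, $S(p)=\{d\in S\mid p\nmid d\}$. $S\preccurlyeq T$ means $S$ is a divisor stable subset of $T$. $A$ has no $T$-torsion if multiplication by each $n\in T$ is injective on $A$. The category $\mathcal{RF}_T$. An object is a projective system of rings $A_\bullet=(A_S)_{S\preccurlyeq T}$ (a contravariant functor on the ordered set of $S\preccurlyeq T$; transition maps $\pi$) together with, for all primes $p\in S\preccurlyeq T$, ring homomorphisms $F_p:A_S\to A_{S/p}$ such that: (1) $F_p(a)\equiv\pi(a)^p \bmod pA_{S/p}$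 for $a\in A_S$; (2) for $p\in S_1\preccurlyeq S_2\preccurlyeq T$ one has $\pi F_p=F_p\pi:A_{S_2}\to A_{S_1/p}$; (3) $F_lF_p=F_pF_l:A_S\to A_{S/pl}$ for primes $p,l$ with $pl\in S$. For $n=p_1^{\nu_1}\cdots p_r^{\nu_r}\in S$ one sets $F_n=F_{p_1}^{\nu_1}\circ\cdots\circ F_{p_r}^{\nu_r}:A_S\to A_{S/n}$. Morphisms are families of ring homomorphisms compatible with $\pi$ and the $F_p$. The category $\mathcal{RFV}_T$. An object is an object of $\mathcal{RF}_T$ which is continuous, i.e. $A_S=\varprojlim A_{S_0}$ over the finite divisor stable $S_0\subset S$ for all $S\preccurlyeq T$, together with additive maps $V_p:A_{S/p}\to A_S$ for primes $p\in S\preccurlyeq T$ such that: (4) $\pi V_p=V_p\pi:A_{S_2/p}\to A_{S_1}$ for $p\in S_1\preccurlyeq S_2\preccurlyeq T$; (5) $V_pV_l=V_lV_p:A_{S/pl}\to A_S$ for primes with $pl\in S$; (6) $F_pV_p=p$ on $A_{S/p}$, and $F_lV_p=V_pF_l:A_{S/p}\to A_{S/l}$ for primes $l\neq p$ with $pl\in S$; (7) the sequences of additive groups $0\to A_{S/p}\xrightarrow{V_p}A_S\xrightarrow{\pi}A_{S(p)}\to0$ are exact. Morphisms are families of ring homomorphisms compatible with $\pi,F_p,V_p$. Witt vectors. For a ring $A$, $W_S(A)=A^S$ as a set, with the unique ring structure functorial in $A$ for which the ghost map $\log_S:W_S(A)\to A^S$, $(a_d)_{d\in S}\mapsto(\sum_{d\mid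 n}d\,a_d^{n/d})_{n\in S}$ is a ring homomorphism ($A^S$ the product ring). There are the projections $\pi:W_{S}(A)\to W_{S'}(A)$ for $S'\preccurlyeq S$, functorial ring homomorphisms $F_n:W_S(A)\to W_{S/n}(A)$, given on ghost components by $(a_\nu)_{\nu\in S}\mapsto(a_{n\nu})_{\nu\in S/n}$, and additive maps $V_n:W_{S/n}(A)\to W_S(A)$ whose value on $(a_\nu)_{\nu\in S/n}$ has $\mu$-th component $a_{\mu/n}$ if $n\mid\mu$ and $0$ otherwise. With these, $W_\bullet(A):=(W_S(A))_{S\preccurlyeq T}$ is an object of $\mathcal{RF}_T$ and of $\mathcal{RFV}_T$. *)

theory Defs
  imports
    "HOL-Algebra.AbelCoset"
    "HOL-Computational_Algebra.Primes"
    "HOL-Library.Poly_Mapping"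
begin

section \<open>Divisor stable sets\<close>

definition divisor_stable :: "nat set \<Rightarrow> bool" where
  "divisor_stable S \<longleftrightarrow>
     S \<noteq> {} \<and> 0 \<notin> S \<and> (\<forall>n\<in>S. \<forall>d. d dvd n \<longrightarrow> d \<in> S)"

definition dstable_subset :: "nat set \<Rightarrow> nat set \<Rightarrow> bool" (infix "\<preceq>" 50) where
  "S \<preceq> T \<longleftrightarrow> divisor_stable S \<and> S \<subseteq> T"

definition quot :: "nat set \<Rightarrow> nat \<Rightarrow> nat set" where
  "quot S n = {\<nu>\<in>S. \<nu> * n \<in> S}"

definition prime_to :: "nat set \<Rightarrow> nat \<Rightarrow> nat set" where
  "prime_to S p = {d\<in>S. \<not> p dvd d}"


section \<open>Commutative rings with or without unit\<close>

text \<open>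
  A non-unital ring is a record of type \<^typ>\<open>'a ring\<close> whose field \<^const>\<open>one\<close> is ignored.
  The Boolean argument below selects the unital or the non-unital version of a notion.
\<close>

locale comm_rng = abelian_group R for R (structure) +
  assumes m_closed: "\<lbrakk>x \<in> carrier R; y \<in> carrier R\<rbrakk> \<Longrightarrow> x \<otimes> y \<in> carrier R"
    and m_assoc: "\<lbrakk>x \<in> carrier R; y \<in> carrier R; z \<in> carrier R\<rbrakk>
      \<Longrightarrow> (x \<otimes> y) \<otimes> z = x \<otimes> (y \<otimes> z)"
    and m_comm: "\<lbrakk>x \<in> carrier R; y \<in> carrier R\<rbrakk> \<Longrightarrow> x \<otimes> y = y \<otimes> x"
    and l_distr: "\<lbrakk>x \<in> carrier R; y \<in> carrier R; z \<in> carrier R\<rbrakk>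
      \<Longrightarrow> (x \<oplus> y) \<otimes> z = x \<otimes> z \<oplus> y \<otimes> z"

definition rng_hom :: "('a, 'm) ring_scheme \<Rightarrow> ('b, 'n) ring_scheme \<Rightarrow> ('a \<Rightarrow> 'b) set" where
  "rng_hom R R' = {h. h \<in> carrier R \<rightarrow> carrier R' \<and>
     (\<forall>x\<in>carrier R. \<forall>y\<in>carrier R.
        h (x \<otimes>\<^bsub>R\<^esub> y) = h x \<otimes>\<^bsub>R'\<^esub> h y \<and> h (x \<oplus>\<^bsub>R\<^esub> y) = h x \<oplus>\<^bsub>R'\<^esub> h y)}"

definition is_rng :: "bool \<Rightarrow> ('a, 'm) ring_scheme \<Rightarrow> bool" where
  "is_rng unital R \<longleftrightarrow> (if unital then cring R else comm_rng R)"

definition rng_homs ::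
    "bool \<Rightarrow> ('a, 'm) ring_scheme \<Rightarrow> ('b, 'n) ring_scheme \<Rightarrow> ('a \<Rightarrow> 'b) set" where
  "rng_homs unital R R' = (if unital then ring_hom R R' else rng_hom R R')"

text \<open>
  Powers that do not involve the unit for positive exponents, unlike the monoid power
  of the library, which starts from \<^const>\<open>one\<close>.
\<close>

fun rpow :: "('a, 'm) ring_scheme \<Rightarrow> 'a \<Rightarrow> nat \<Rightarrow> 'a" where
  "rpow R x 0 = \<one>\<^bsub>R\<^esub>"
| "rpow R x (Suc 0) = x"
| "rpow R x (Suc (Suc n)) = rpow R x (Suc n) \<otimes>\<^bsub>R\<^esub> x"

definition no_torsion :: "nat set \<Rightarrow> ('a, 'm) ring_scheme \<Rightarrow> bool" where
  "no_torsion T R \<longleftrightarrow> (\<forall>n\<in>T. inj_on (\<lambda>x. [n] \<cdot>\<^bsub>R\<^esub> x) (carrier R))"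


section \<open>The categories $\mathcal{RF}_T$ and $\mathcal{RFV}_T$\<close>

text \<open>
  In the structures below, \<open>res A S\<^sub>2 S\<^sub>1\<close> is the transition map $A_{S_2} \to A_{S_1}$,
  \<open>frob A p S\<close> is $F_p : A_S \to A_{S/p}$, and \<open>ver A p S\<close> is $V_p : A_{S/p} \to A_S$.
\<close>

record 'a rf =
  rg :: "nat set \<Rightarrow> 'a ring"
  res :: "nat set \<Rightarrow> nat set \<Rightarrow> 'a \<Rightarrow> 'a"
  frob :: "nat \<Rightarrow> nat set \<Rightarrow> 'a \<Rightarrow> 'a"

record 'a rfv = "'a rf" +
  ver :: "nat \<Rightarrow> nat set \<Rightarrow> 'a \<Rightarrow> 'a"

locale rf_object =
  fixes unital :: bool and T :: "nat set" and A :: "('a, 'm) rf_scheme"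
  assumes rng: "S \<preceq> T \<Longrightarrow> is_rng unital (rg A S)"
    and res_hom: "\<lbrakk>S\<^sub>1 \<preceq> S\<^sub>2; S\<^sub>2 \<preceq> T\<rbrakk>
      \<Longrightarrow> res A S\<^sub>2 S\<^sub>1 \<in> rng_homs unital (rg A S\<^sub>2) (rg A S\<^sub>1)"
    and res_id: "\<lbrakk>S \<preceq> T; a \<in> carrier (rg A S)\<rbrakk> \<Longrightarrow> res A S S a = a"
    and res_res: "\<lbrakk>S\<^sub>1 \<preceq> S\<^sub>2; S\<^sub>2 \<preceq> S\<^sub>3; S\<^sub>3 \<preceq> T; a \<in> carrier (rg A S\<^sub>3)\<rbrakk>
      \<Longrightarrow> res A S\<^sub>2 S\<^sub>1 (res A S\<^sub>3 S\<^sub>2 a) = res A S\<^sub>3 S\<^sub>1 a"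
    and frob_hom: "\<lbrakk>S \<preceq> T; prime p; p \<in> S\<rbrakk>
      \<Longrightarrow> frob A p S \<in> rng_homs unital (rg A S) (rg A (quot S p))"
    and frob_cong: "\<lbrakk>S \<preceq> T; prime p; p \<in> S; a \<in> carrier (rg A S)\<rbrakk>
      \<Longrightarrow> \<exists>c\<in>carrier (rg A (quot S p)).
            frob A p S a = rpow (rg A (quot S p)) (res A S (quot S p) a) p
              \<oplus>\<^bsub>rg A (quot S p)\<^esub> [p] \<cdot>\<^bsub>rg A (quot S p)\<^esub> c"
    and res_frob: "\<lbrakk>S\<^sub>1 \<preceq> S\<^sub>2; S\<^sub>2 \<preceq> T; prime p; p \<in> S\<^sub>1; a \<in> carrier (rg A S\<^sub>2)\<rbrakk>
      \<Longrightarrow> res A (quot S\<^sub>2 p) (quot S\<^sub>1 p) (frob A p S\<^sub>2 a) = frob A p S\<^sub>1 (res A S\<^sub>2 S\<^sub>1 a)"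
    and frob_frob: "\<lbrakk>S \<preceq> T; prime p; prime l; p * l \<in> S; a \<in> carrier (rg A S)\<rbrakk>
      \<Longrightarrow> frob A l (quot S p) (frob A p S a) = frob A p (quot S l) (frob A l S a)"

locale rfv_object = rf_object unital T A
  for unital :: bool and T :: "nat set" and A :: "('a, 'm) rfv_scheme" +
  assumes continuous: "\<lbrakk>S \<preceq> T;
        \<And>S\<^sub>0. \<lbrakk>S\<^sub>0 \<preceq> S; finite S\<^sub>0\<rbrakk> \<Longrightarrow> x S\<^sub>0 \<in> carrier (rg A S\<^sub>0);
        \<And>S\<^sub>0 S\<^sub>1. \<lbrakk>S\<^sub>0 \<preceq> S\<^sub>1; S\<^sub>1 \<preceq> S; finite S\<^sub>1\<rbrakk> \<Longrightarrow> res A S\<^sub>1 S\<^sub>0 (x S\<^sub>1) = x S\<^sub>0\<rbrakk>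
      \<Longrightarrow> \<exists>!a. a \<in> carrier (rg A S) \<and> (\<forall>S\<^sub>0. S\<^sub>0 \<preceq> S \<and> finite S\<^sub>0 \<longrightarrow> res A S S\<^sub>0 a = x S\<^sub>0)"
    and ver_hom: "\<lbrakk>S \<preceq> T; prime p; p \<in> S\<rbrakk>
      \<Longrightarrow> ver A p S \<in> hom (add_monoid (rg A (quot S p))) (add_monoid (rg A S))"
    and res_ver: "\<lbrakk>S\<^sub>1 \<preceq> S\<^sub>2; S\<^sub>2 \<preceq> T; prime p; p \<in> S\<^sub>1; a \<in> carrier (rg A (quot S\<^sub>2 p))\<rbrakk>
      \<Longrightarrow> res A S\<^sub>2 S\<^sub>1 (ver A p S\<^sub>2 a) = ver A p S\<^sub>1 (res A (quot S\<^sub>2 p) (quot S\<^sub>1 p) a)"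
    and ver_ver: "\<lbrakk>S \<preceq> T; prime p; prime l; p * l \<in> S; a \<in> carrier (rg A (quot S (p * l)))\<rbrakk>
      \<Longrightarrow> ver A p S (ver A l (quot S p) a) = ver A l S (ver A p (quot S l) a)"
    and frob_ver_same: "\<lbrakk>S \<preceq> T; prime p; p \<in> S; a \<in> carrier (rg A (quot S p))\<rbrakk>
      \<Longrightarrow> frob A p S (ver A p S a) = [p] \<cdot>\<^bsub>rg A (quot S p)\<^esub> a"
    and frob_ver_diff: "\<lbrakk>S \<preceq> T; prime p; prime l; l \<noteq> p; p * l \<in> S;
        a \<in> carrier (rg A (quot S p))\<rbrakk>
      \<Longrightarrow> frob A l S (ver A p S a) = ver A p (quot S l) (frob A l (quot S p) a)"
    and ver_inj: "\<lbrakk>S \<preceq> T; prime p; p \<in> S\<rbrakk>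
      \<Longrightarrow> inj_on (ver A p S) (carrier (rg A (quot S p)))"
    and ver_exact: "\<lbrakk>S \<preceq> T; prime p; p \<in> S\<rbrakk>
      \<Longrightarrow> ver A p S ` carrier (rg A (quot S p))
          = a_kernel (rg A S) (rg A (prime_to S p)) (res A S (prime_to S p))"
    and res_surj: "\<lbrakk>S \<preceq> T; prime p; p \<in> S\<rbrakk>
      \<Longrightarrow> res A S (prime_to S p) ` carrier (rg A S) = carrier (rg A (prime_to S p))"

text \<open>A morphism is a family of maps \<open>\<alpha> S\<close>; only its values on the carriers matter.\<close>

definition rf_mor ::
    "bool \<Rightarrow> nat set \<Rightarrow> ('a, 'm) rf_scheme \<Rightarrow> ('b, 'n) rf_scheme \<Rightarrow> (nat set \<Rightarrow> 'a \<Rightarrow> 'b) \<Rightarrow> bool" where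
  "rf_mor unital T A B \<alpha> \<longleftrightarrow>
     rf_object unital T A \<and> rf_object unital T B \<and>
     (\<forall>S. S \<preceq> T \<longrightarrow> \<alpha> S \<in> rng_homs unital (rg A S) (rg B S)) \<and>
     (\<forall>S\<^sub>1 S\<^sub>2. \<forall>a\<in>carrier (rg A S\<^sub>2). S\<^sub>1 \<preceq> S\<^sub>2 \<and> S\<^sub>2 \<preceq> T \<longrightarrow>
        \<alpha> S\<^sub>1 (res A S\<^sub>2 S\<^sub>1 a) = res B S\<^sub>2 S\<^sub>1 (\<alpha> S\<^sub>2 a)) \<and>
     (\<forall>S p. \<forall>a\<in>carrier (rg A S). S \<preceq> T \<and> prime p \<and> p \<in> S \<longrightarrow>
        \<alpha> (quot S p) (frob A p S a) = frob B p S (\<alpha> S a))"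

definition rfv_mor ::
    "bool \<Rightarrow> nat set \<Rightarrow> ('a, 'm) rfv_scheme \<Rightarrow> ('b, 'n) rfv_scheme \<Rightarrow> (nat set \<Rightarrow> 'a \<Rightarrow> 'b) \<Rightarrow> bool" where
  "rfv_mor unital T A B \<alpha> \<longleftrightarrow>
     rfv_object unital T A \<and> rfv_object unital T B \<and> rf_mor unital T A B \<alpha> \<and>
     (\<forall>S p. \<forall>a\<in>carrier (rg A (quot S p)). S \<preceq> T \<and> prime p \<and> p \<in> S \<longrightarrow>
        \<alpha> S (ver A p S a) = ver B p S (\<alpha> (quot S p) a))"

definition mutually_inverse ::
    "nat set \<Rightarrow> ('a, 'm) rf_scheme \<Rightarrow> ('b, 'n) rf_scheme
      \<Rightarrow> (nat set \<Rightarrow> 'a \<Rightarrow> 'b) \<Rightarrow> (nat set \<Rightarrow> 'b \<Rightarrow> 'a) \<Rightarrow> bool" where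
  "mutually_inverse T A B \<alpha> \<beta> \<longleftrightarrow>
     (\<forall>S. S \<preceq> T \<longrightarrow> (\<forall>a\<in>carrier (rg A S). \<beta> S (\<alpha> S a) = a) \<and>
                    (\<forall>b\<in>carrier (rg B S). \<alpha> S (\<beta> S b) = b))"

definition rf_iso ::
    "bool \<Rightarrow> nat set \<Rightarrow> ('a, 'm) rf_scheme \<Rightarrow> ('b, 'n) rf_scheme \<Rightarrow> (nat set \<Rightarrow> 'a \<Rightarrow> 'b) \<Rightarrow> bool" where
  "rf_iso unital T A B \<alpha> \<longleftrightarrow>
     rf_mor unital T A B \<alpha> \<and> (\<exists>\<beta>. rf_mor unital T B A \<beta> \<and> mutually_inverse T A B \<alpha> \<beta>)"

definition rfv_iso ::
    "bool \<Rightarrow> nat set \<Rightarrow> ('a, 'm) rfv_scheme \<Rightarrow> ('b, 'n) rfv_scheme \<Rightarrow> (nat set \<Rightarrow> 'a \<Rightarrow> 'b) \<Rightarrow> bool" where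
  "rfv_iso unital T A B \<alpha> \<longleftrightarrow>
     rfv_mor unital T A B \<alpha> \<and> (\<exists>\<beta>. rfv_mor unital T B A \<beta> \<and> mutually_inverse T A B \<alpha> \<beta>)"

primrec frob_list :: "('a, 'm) rf_scheme \<Rightarrow> nat list \<Rightarrow> nat set \<Rightarrow> 'a \<Rightarrow> 'a" where
  "frob_list A [] S a = a"
| "frob_list A (p # ps) S a = frob_list A ps (quot S p) (frob A p S a)"

text \<open>
  $F_n : A_S \to A_{S/n}$ for $n \in S$; the prime factors are taken with multiplicity, and
  their order is irrelevant because the $F_p$ commute.
\<close>

definition frob_n :: "('a, 'm) rf_scheme \<Rightarrow> nat \<Rightarrow> nat set \<Rightarrow> 'a \<Rightarrow> 'a" where
  "frob_n A n = frob_list A (sorted_list_of_multiset (prime_factorization n))"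


section \<open>Witt vectors\<close>

definition ghost_map :: "('a, 'm) ring_scheme \<Rightarrow> nat set \<Rightarrow> (nat \<Rightarrow> 'a) \<Rightarrow> nat \<Rightarrow> 'a" where
  "ghost_map R S a =
     (\<lambda>n\<in>S. \<Oplus>\<^bsub>R\<^esub> d \<in> {d. d dvd n}. [d] \<cdot>\<^bsub>R\<^esub> rpow R (a d) (n div d))"

text \<open>
  A ring structure on the sets $A^S$ that is functorial in $A$ is given by polynomials with
  integer coefficients; the condition on the ghost map determines them. We use
  $\mathbb{Z}[x_1, x_2, \dots; y_1, y_2, \dots]$, with \<open>Inl d\<close> standing for $x_d$ and
  \<open>Inr d\<close> for $y_d$.
\<close>

type_synonym witt_poly = "((nat + nat) \<Rightarrow>\<^sub>0 nat) \<Rightarrow>\<^sub>0 int"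

definition var :: "nat + nat \<Rightarrow> witt_poly" where
  "var v = Poly_Mapping.single (Poly_Mapping.single v 1) 1"

definition ghost_poly :: "(nat \<Rightarrow> witt_poly) \<Rightarrow> nat \<Rightarrow> witt_poly" where
  "ghost_poly s n = (\<Sum>d | d dvd n. of_nat d * s d ^ (n div d))"

text \<open>
  The Witt vector over the polynomial ring with prescribed ghost components \<open>g n\<close>, for
  positive \<open>n\<close>. The value at \<open>0\<close> is a convention that makes it unique.
\<close>

definition with_ghost :: "(nat \<Rightarrow> witt_poly) \<Rightarrow> nat \<Rightarrow> witt_poly" where
  "with_ghost g = (THE s. s 0 = 0 \<and> (\<forall>n>0. ghost_poly s n = g n))"

definition add_poly :: "nat \<Rightarrow> witt_poly" where
  "add_poly = with_ghost (\<lambda>n. ghost_poly (var \<circ> Inl) n + ghost_poly (var \<circ> Inr) n)"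

definition mult_poly :: "nat \<Rightarrow> witt_poly" where
  "mult_poly = with_ghost (\<lambda>n. ghost_poly (var \<circ> Inl) n * ghost_poly (var \<circ> Inr) n)"

definition frob_poly :: "nat \<Rightarrow> nat \<Rightarrow> witt_poly" where
  "frob_poly m = with_ghost (\<lambda>n. ghost_poly (var \<circ> Inl) (m * n))"

text \<open>
  The ring $\mathbb{Z} \oplus R$ obtained by adjoining a unit. It contains \<open>R\<close> as the ideal
  $0 \oplus R$, and a polynomial without constant term (such as all of the above) takes values
  in this ideal when its variables do.
\<close>

definition unitization :: "('a, 'm) ring_scheme \<Rightarrow> (int \<times> 'a) ring" where
  "unitization R =
     \<lparr>carrier = UNIV \<times> carrier R,
      monoid.mult = (\<lambda>(m, x) (n, y). (m * n, ([m] \<cdot>\<^bsub>R\<^esub> y \<oplus>\<^bsub>R\<^esub> [n] \<cdot>\<^bsub>R\<^esub> x) \<oplus>\<^bsub>R\<^esub> (x \<otimes>\<^bsub>R\<^esub> y))),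
      one = (1, \<zero>\<^bsub>R\<^esub>),
      zero = (0, \<zero>\<^bsub>R\<^esub>),
      add = (\<lambda>(m, x) (n, y). (m + n, x \<oplus>\<^bsub>R\<^esub> y))\<rparr>"

definition eval_poly :: "('a, 'm) ring_scheme \<Rightarrow> (nat + nat \<Rightarrow> 'a) \<Rightarrow> witt_poly \<Rightarrow> 'a" where
  "eval_poly R f P =
     snd (\<Oplus>\<^bsub>unitization R\<^esub> m \<in> Poly_Mapping.keys P.
       [Poly_Mapping.lookup P m] \<cdot>\<^bsub>unitization R\<^esub>
         (\<Otimes>\<^bsub>unitization R\<^esub> v \<in> Poly_Mapping.keys m.
           (0, f v) [^]\<^bsub>unitization R\<^esub> Poly_Mapping.lookup m v))"

definition witt_ring :: "('a, 'm) ring_scheme \<Rightarrow> nat set \<Rightarrow> (nat \<Rightarrow> 'a) ring" where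
  "witt_ring R S =
     \<lparr>carrier = (S \<rightarrow>\<^sub>E carrier R),
      monoid.mult = (\<lambda>a b. \<lambda>n\<in>S. eval_poly R (case_sum a b) (mult_poly n)),
      one = (\<lambda>n\<in>S. if n = 1 then \<one>\<^bsub>R\<^esub> else \<zero>\<^bsub>R\<^esub>),
      zero = (\<lambda>n\<in>S. \<zero>\<^bsub>R\<^esub>),
      add = (\<lambda>a b. \<lambda>n\<in>S. eval_poly R (case_sum a b) (add_poly n))\<rparr>"

definition witt_frob ::
    "('a, 'm) ring_scheme \<Rightarrow> nat \<Rightarrow> nat set \<Rightarrow> (nat \<Rightarrow> 'a) \<Rightarrow> nat \<Rightarrow> 'a" where
  "witt_frob R m S a = (\<lambda>n\<in>quot S m. eval_poly R (case_sum a a) (frob_poly m n))"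

definition witt_ver ::
    "('a, 'm) ring_scheme \<Rightarrow> nat \<Rightarrow> nat set \<Rightarrow> (nat \<Rightarrow> 'a) \<Rightarrow> nat \<Rightarrow> 'a" where
  "witt_ver R m S a = (\<lambda>n\<in>S. if m dvd n then a (n div m) else \<zero>\<^bsub>R\<^esub>)"

definition witt :: "('a, 'm) ring_scheme \<Rightarrow> (nat \<Rightarrow> 'a) rfv" where
  "witt R =
     \<lparr>rg = witt_ring R,
      res = (\<lambda>S\<^sub>2 S\<^sub>1 a. restrict a S\<^sub>1),
      frob = witt_frob R,
      ver = witt_ver R\<rparr>"


section \<open>Families of maps to Witt vectors\<close>

text \<open>$\alpha_{\{1\}} = \mathrm{id}$, under the identification $W_{\{1\}}(A) = A^{\{1\}} = A$.\<close>

definition identity_at_1 ::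
    "('a, 'm) rf_scheme \<Rightarrow> (nat set \<Rightarrow> 'a \<Rightarrow> nat \<Rightarrow> 'a) \<Rightarrow> bool" where
  "identity_at_1 A \<alpha> \<longleftrightarrow> (\<forall>a\<in>carrier (rg A {1}). \<alpha> {1} a = (\<lambda>n\<in>{1}. a))"

definition ghost_condition ::
    "nat set \<Rightarrow> ('a, 'm) rf_scheme \<Rightarrow> (nat set \<Rightarrow> 'a \<Rightarrow> nat \<Rightarrow> 'a) \<Rightarrow> bool" where
  "ghost_condition T A \<alpha> \<longleftrightarrow>
     (\<forall>S. S \<preceq> T \<longrightarrow> (\<forall>a\<in>carrier (rg A S).
        ghost_map (rg A {1}) S (\<alpha> S a) = (\<lambda>n\<in>S. res A (quot S n) {1} (frob_n A n S a))))"

definition agree ::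
    "nat set \<Rightarrow> ('a, 'm) rf_scheme \<Rightarrow> (nat set \<Rightarrow> 'a \<Rightarrow> 'b) \<Rightarrow> (nat set \<Rightarrow> 'a \<Rightarrow> 'b) \<Rightarrow> bool" where
  "agree T A \<alpha> \<beta> \<longleftrightarrow> (\<forall>S. S \<preceq> T \<longrightarrow> (\<forall>a\<in>carrier (rg A S). \<alpha> S a = \<beta> S a))"

end

theory Submission
  imports Defs
begin

text \<open>
  An element \<open>a\<close> of $A_S$ has the ghost components $\pi F_n(a) \in A = A_{\{1\}}$, and a Witt
  vector over a ring without \<open>T\<close>-torsion is determined by its ghost components
  (\<open>ghost_comp_inj\<close>). So everything is decided by comparing two sets of sequences in \<open>A\<close>: the ghost
  components of elements of $A_S$ and those of Witt vectors.

  That every sequence of the first kind is of the second kind is Dwork's lemma, in a form where the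
  ring varies with the index (\<open>dwork\<close>): the components $s_d$ are sought in $A_{S/d}$, with
  $\sum_{d \mid n} d\, \pi(s_d)^{n/d} = F_n(a)$ in $A_{S/n}$, because $F_p$ maps
  $A_{S/n}$ to $A_{S/pn}$ and is a lift of the \<open>p\<close>-th power map there. This gives \<open>\<alpha>\<close>. The same
  lemma for the constant system $\mathbb{Z}[x, y]$, with the Frobenius lifts $x \mapsto x^p$, shows
  that the polynomials that define the Witt vector operations exist with integer coefficients
  (\<open>ghost_poly_with_ghost\<close>). Evaluating them in the unitization yields the ghost components of sums,
  products and Frobenius images of Witt vectors over rings that may lack a unit.

  \<open>\<alpha>\<close> is bijective for finite \<open>S\<close> by induction along the exact sequences
  $0 \to A_{S/p} \to A_S \to A_{S(p)} \to 0$. On ghost components $V_p$ is multiplication by \<open>p\<close>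
  followed by a shift, so the absence of torsion makes the ghost map injective
  (\<open>ghost_kernel_finite\<close>), and a preimage of a Witt vector is a lift of one over $S(p)$, corrected by
  an element of the image of $V_p$ (\<open>ghost_surj_finite\<close>). Continuity extends both statements to
  infinite \<open>S\<close>.

  Compatibility of \<open>\<alpha>\<close> with all operations is read off from ghost components. As \<open>\<alpha>\<close> is
  bijective, it transports the axioms from $A_\bullet$ to the Witt vectors
  (\<open>to_witt_transport\<close>), which therefore form an object of $\mathcal{RFV}_T$ isomorphic to
  $A_\bullet$.
\<close>


section \<open>Commutative rings without unit\<close>

lemma rpow_Suc: "n > 0 \<Longrightarrow> rpow R x (Suc n) = rpow R x n \<otimes>\<^bsub>R\<^esub> x"
  by (cases n) auto

context comm_rng
begin

lemma r_distr:
  "\<lbrakk>x \<in> carrier R; y \<in> carrier R; z \<in> carrier R\<rbrakk> \<Longrightarrow> z \<otimes> (x \<oplus> y) = z \<otimes> x \<oplus> z \<otimes> y"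
  by (simp add: m_comm[of z] l_distr)

lemma m_lcomm:
  "\<lbrakk>x \<in> carrier R; y \<in> carrier R; z \<in> carrier R\<rbrakk> \<Longrightarrow> x \<otimes> (y \<otimes> z) = y \<otimes> (x \<otimes> z)"
  by (metis m_assoc m_comm)

lemmas m_ac = m_assoc m_comm m_lcomm

lemma l_null: "x \<in> carrier R \<Longrightarrow> \<zero> \<otimes> x = \<zero>"
  by (metis m_closed add.r_cancel_one' l_distr l_zero zero_closed)

lemma r_null: "x \<in> carrier R \<Longrightarrow> x \<otimes> \<zero> = \<zero>"
  by (subst m_comm) (simp_all add: l_null)

lemma rpow_closed: "\<lbrakk>x \<in> carrier R; n > 0\<rbrakk> \<Longrightarrow> rpow R x n \<in> carrier R"
  proof (induction n)
  case (Suc n)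
  then show ?case by (cases "n = 0") (auto simp: rpow_Suc m_closed)
qed simp

lemma add_pow_ldistr:
  "\<lbrakk>x \<in> carrier R; y \<in> carrier R\<rbrakk> \<Longrightarrow> ([(n::nat)] \<cdot> x) \<otimes> y = [n] \<cdot> (x \<otimes> y)"
  by (induction n) (auto simp: l_null l_distr m_closed)

lemma add_pow_rdistr:
  "\<lbrakk>x \<in> carrier R; y \<in> carrier R\<rbrakk> \<Longrightarrow> x \<otimes> ([(n::nat)] \<cdot> y) = [n] \<cdot> (x \<otimes> y)"
  by (simp add: m_comm[of x] add_pow_ldistr)

lemma rpow_zero: "n > 0 \<Longrightarrow> rpow R \<zero> n = \<zero>"
  proof (induction n)
  case (Suc n)
  then show ?case by (cases "n = 0") (auto simp: rpow_Suc r_null)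
qed simp

lemma rpow_add:
  "\<lbrakk>x \<in> carrier R; m > 0; n > 0\<rbrakk> \<Longrightarrow> rpow R x (m + n) = rpow R x m \<otimes> rpow R x n"
proof (induction n)
  case (Suc n)
  show ?case
  proof (cases "n = 0")
    case True
    then show ?thesis using Suc by (simp add: rpow_Suc)
  next
    case False
    then show ?thesis using Suc by (simp add: rpow_Suc m_assoc rpow_closed)
  qed
qed simp

lemma rpow_rpow:
  "\<lbrakk>x \<in> carrier R; m > 0; n > 0\<rbrakk> \<Longrightarrow> rpow R (rpow R x m) n = rpow R x (m * n)"
proof (induction n)
  case (Suc n)
  show ?case
  proof (cases "n = 0")
    case False
    then have "rpow R x (m * Suc n) = rpow R x (m * n) \<otimes> rpow R x m"
      using Suc.prems rpow_add[of x "m * n" m] by (simp add: add.commute)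
    then show ?thesis using Suc False by (simp add: rpow_Suc)
  qed simp
qed simp

lemma finsum_add_pow:
  "\<lbrakk>finite I; f \<in> I \<rightarrow> carrier R\<rbrakk> \<Longrightarrow> [(n::nat)] \<cdot> (\<Oplus>i\<in>I. f i) = (\<Oplus>i\<in>I. [n] \<cdot> f i)"
proof (induction rule: finite_induct)
  case (insert i I)
  then have "f i \<in> carrier R" "f \<in> I \<rightarrow> carrier R" by auto
  moreover have "(\<lambda>i. [n] \<cdot> f i) \<in> I \<rightarrow> carrier R" using insert by auto
  ultimately show ?case using insert
    by (simp add: finsum_insert add.nat_pow_distrib finsum_closed)
qed simp

end

lemma cring_comm_rng: "cring R \<Longrightarrow> comm_rng R"
proof -
  assume "cring R"
  then interpret cring R .
  show ?thesis
    by unfold_locales (auto simp: m_assoc l_distr intro: m_comm)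
qed

lemma is_rng_comm_rng: "is_rng unital R \<Longrightarrow> comm_rng R"
  by (auto simp: is_rng_def cring_comm_rng split: if_splits)

lemma rng_homs_rng_hom: "h \<in> rng_homs unital R R' \<Longrightarrow> h \<in> rng_hom R R'"
  by (auto simp: rng_homs_def rng_hom_def ring_hom_def Pi_def split: if_splits)

locale rng_homo = dom: comm_rng R + cod: comm_rng R'
  for R (structure) and R' (structure) and h +
  assumes hom: "h \<in> rng_hom R R'"
begin

lemma hom_closed [simp]: "x \<in> carrier R \<Longrightarrow> h x \<in> carrier R'"
  using hom by (auto simp: rng_hom_def)

lemma hom_mult: "\<lbrakk>x \<in> carrier R; y \<in> carrier R\<rbrakk> \<Longrightarrow> h (x \<otimes> y) = h x \<otimes>\<^bsub>R'\<^esub> h y"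
  using hom by (auto simp: rng_hom_def)

lemma hom_add: "\<lbrakk>x \<in> carrier R; y \<in> carrier R\<rbrakk> \<Longrightarrow> h (x \<oplus> y) = h x \<oplus>\<^bsub>R'\<^esub> h y"
  using hom by (auto simp: rng_hom_def)

lemma hom_zero: "h \<zero> = \<zero>\<^bsub>R'\<^esub>"
  by (metis cod.add.r_cancel_one' dom.l_zero dom.zero_closed hom_add hom_closed)

lemma hom_neg: "x \<in> carrier R \<Longrightarrow> h (\<ominus> x) = \<ominus>\<^bsub>R'\<^esub> h x"
  by (metis cod.minus_equality dom.a_inv_closed dom.l_neg hom_add hom_closed hom_zero)

lemma hom_add_pow: "x \<in> carrier R \<Longrightarrow> h ([(n::nat)] \<cdot> x) = [n] \<cdot>\<^bsub>R'\<^esub> h x"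
  by (induction n) (auto simp: hom_zero hom_add)

lemma hom_rpow: "\<lbrakk>x \<in> carrier R; n > 0\<rbrakk> \<Longrightarrow> h (rpow R x n) = rpow R' (h x) n"
proof (induction n)
  case (Suc n)
  then show ?case
    by (cases "n = 0") (auto simp: rpow_Suc hom_mult dom.rpow_closed)
qed simp

lemma hom_finsum:
  "\<lbrakk>finite I; f \<in> I \<rightarrow> carrier R\<rbrakk> \<Longrightarrow> h (\<Oplus>i\<in>I. f i) = (\<Oplus>\<^bsub>R'\<^esub>i\<in>I. h (f i))"
proof (induction rule: finite_induct)
  case (insert i I)
  then have "f i \<in> carrier R" "f \<in> I \<rightarrow> carrier R" by auto
  moreover from this have "(\<lambda>i. h (f i)) \<in> I \<rightarrow> carrier R'" by (simp add: Pi_iff)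
  ultimately show ?case using insert
    by (simp add: dom.finsum_insert cod.finsum_insert hom_add dom.finsum_closed)
qed (simp add: hom_zero)

end


section \<open>Congruences modulo an integer\<close>

text \<open>
  \<open>m\<close> is a natural number and need not act through an element of the ring, which may have no unit.
\<close>

definition icong :: "('a, 'm) ring_scheme \<Rightarrow> nat \<Rightarrow> 'a \<Rightarrow> 'a \<Rightarrow> bool" where
  "icong R m x y \<longleftrightarrow> (\<exists>c\<in>carrier R. x = y \<oplus>\<^bsub>R\<^esub> [m] \<cdot>\<^bsub>R\<^esub> c)"

lemma icongI: "\<lbrakk>x = y \<oplus>\<^bsub>R\<^esub> [m] \<cdot>\<^bsub>R\<^esub> c; c \<in> carrier R\<rbrakk> \<Longrightarrow> icong R m x y"
  by (auto simp: icong_def)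

context comm_rng
begin

lemma icong_refl: "x \<in> carrier R \<Longrightarrow> icong R m x x"
  by (rule icongI[of _ _ _ _ \<zero>]) auto

lemma icong_sym:
  assumes "icong R m x y" "y \<in> carrier R"
  shows "icong R m y x"
proof -
  obtain c where c: "c \<in> carrier R" "x = y \<oplus> [m] \<cdot> c"
    using assms by (auto simp: icong_def)
  have "y = x \<oplus> [m] \<cdot> (\<ominus> c)"
    using c assms(2) by (simp add: add.nat_pow_inv a_assoc r_neg)
  from icongI[OF this] show ?thesis using c(1) by auto
qed

lemma icong_trans:
  assumes "icong R m x y" "icong R m y z" "z \<in> carrier R"
  shows "icong R m x z"
proof -
  obtain c where c: "c \<in> carrier R" "x = y \<oplus> [m] \<cdot> c"
    using assms by (auto simp: icong_def)
  obtain d where d: "d \<in> carrier R" "y = z \<oplus> [m] \<cdot> d"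
    using assms by (auto simp: icong_def)
  have "x = z \<oplus> [m] \<cdot> (d \<oplus> c)"
    using c d assms(3) by (simp add: a_assoc add.nat_pow_distrib)
  from icongI[OF this] show ?thesis using c d by auto
qed

lemma icong_add:
  assumes "icong R m x y" "icong R m x' y'" "y \<in> carrier R" "y' \<in> carrier R"
  shows "icong R m (x \<oplus> x') (y \<oplus> y')"
proof -
  obtain c where c: "c \<in> carrier R" "x = y \<oplus> [m] \<cdot> c"
    using assms by (auto simp: icong_def)
  obtain d where d: "d \<in> carrier R" "x' = y' \<oplus> [m] \<cdot> d"
    using assms by (auto simp: icong_def)
  have "x \<oplus> x' = (y \<oplus> y') \<oplus> [m] \<cdot> (c \<oplus> d)"
    using c d assms(3,4) by (simp add: a_ac add.nat_pow_distrib)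
  from icongI[OF this] show ?thesis using c d by auto
qed

lemma icong_mult_right:
  assumes "icong R m x y" "y \<in> carrier R" "z \<in> carrier R"
  shows "icong R m (x \<otimes> z) (y \<otimes> z)"
proof -
  obtain c where c: "c \<in> carrier R" "x = y \<oplus> [m] \<cdot> c"
    using assms by (auto simp: icong_def)
  have "x \<otimes> z = y \<otimes> z \<oplus> [m] \<cdot> (c \<otimes> z)"
    using c assms by (simp add: l_distr add_pow_ldistr)
  from icongI[OF this] show ?thesis using c assms by (auto simp: m_closed)
qed

lemma icong_carrier: "\<lbrakk>icong R m x y; y \<in> carrier R\<rbrakk> \<Longrightarrow> x \<in> carrier R"
  by (auto simp: icong_def)

lemma icong_mult:
  assumes "icong R m x y" "icong R m x' y'" "y \<in> carrier R" "y' \<in> carrier R"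
  shows "icong R m (x \<otimes> x') (y \<otimes> y')"
proof (rule icong_trans)
  show "icong R m (x \<otimes> x') (y \<otimes> x')"
    using assms icong_carrier by (blast intro: icong_mult_right)
  show "icong R m (y \<otimes> x') (y \<otimes> y')"
    using assms icong_carrier[OF assms(2)] icong_mult_right[of m x' y' y] by (simp add: m_comm)
qed (use assms in \<open>auto simp: m_closed\<close>)

lemma icong_rpow:
  assumes "icong R m x y" "y \<in> carrier R" "n > 0"
  shows "icong R m (rpow R x n) (rpow R y n)"
  using assms(3)
proof (induction n)
  case (Suc n)
  then show ?case
    using assms by (cases "n = 0") (auto simp: rpow_Suc rpow_closed intro!: icong_mult)
qed simp

lemma icong_add_pow:
  assumes "icong R m x y" "y \<in> carrier R"
  shows "icong R (n * m) ([n] \<cdot> x) ([n] \<cdot> y)"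
proof -
  obtain c where c: "c \<in> carrier R" "x = y \<oplus> [m] \<cdot> c"
    using assms by (auto simp: icong_def)
  have "[n] \<cdot> x = [n] \<cdot> y \<oplus> [(n * m)] \<cdot> c"
    using c assms(2) by (simp add: add.nat_pow_distrib add.nat_pow_pow mult.commute)
  from icongI[OF this] show ?thesis using c by auto
qed

lemma icong_dvd:
  assumes "icong R m x y" "n dvd m"
  shows "icong R n x y"
proof -
  obtain c where c: "c \<in> carrier R" "x = y \<oplus> [m] \<cdot> c"
    using assms by (auto simp: icong_def)
  obtain k where "m = n * k" using assms(2) by blast
  with c have "x = y \<oplus> [n] \<cdot> ([k] \<cdot> c)"
    by (simp add: add.nat_pow_pow mult.commute)
  from icongI[OF this] show ?thesis using c by auto
qed

lemma icong_finsum: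
  assumes "finite I" "\<And>i. i \<in> I \<Longrightarrow> icong R m (f i) (g i)" "g \<in> I \<rightarrow> carrier R"
  shows "icong R m (\<Oplus>i\<in>I. f i) (\<Oplus>i\<in>I. g i)"
  using assms
proof (induction rule: finite_induct)
  case (insert i I)
  then have "g i \<in> carrier R" "g \<in> I \<rightarrow> carrier R" "f i \<in> carrier R" "f \<in> I \<rightarrow> carrier R"
    using icong_carrier by (auto simp: Pi_iff; blast)+
  then show ?case using insert
    by (simp add: finsum_insert) (intro icong_add, auto simp: finsum_closed)
qed (simp add: icong_refl)

lemma icong_multiple_zero: "c \<in> carrier R \<Longrightarrow> m dvd n \<Longrightarrow> icong R m ([n] \<cdot> c) \<zero>"
  by (rule icong_dvd[of n]) (auto intro: icongI[of _ _ _ _ c])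

text \<open>
  Expanding $(y + qc)^n$ to first order in \<open>q\<close>. The coefficient \<open>e\<close> is
  $y^{n-1} c$; the condition $ey = y^n c$ expresses this without mentioning $y^0$.
\<close>

lemma rpow_add_multiple:
  assumes "y \<in> carrier R" "c \<in> carrier R" "n > 0"
  shows "\<exists>e\<in>carrier R. \<exists>e'\<in>carrier R. e \<otimes> y = rpow R y n \<otimes> c \<and>
    rpow R (y \<oplus> [q] \<cdot> c) n = rpow R y n \<oplus> [(n * q)] \<cdot> e \<oplus> [(q * q)] \<cdot> e'"
  using assms(3)
proof (induction n)
  case (Suc n)
  show ?case
  proof (cases "n = 0")
    case True
    then show ?thesis
      using assms by (intro bexI[of _ c] bexI[of _ \<zero>]) (auto simp: m_comm)
  next
    case False
    then obtain e e' where IH: "e \<in> carrier R" "e' \<in> carrier R"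
        "e \<otimes> y = rpow R y n \<otimes> c"
        "rpow R (y \<oplus> [q] \<cdot> c) n = rpow R y n \<oplus> [(n * q)] \<cdot> e \<oplus> [(q * q)] \<cdot> e'"
      using Suc by blast
    let ?p = "rpow R y n"
    have p: "?p \<in> carrier R" using assms False by (simp add: rpow_closed)
    let ?f = "?p \<otimes> c" and ?f' = "e' \<otimes> y \<oplus> ([n] \<cdot> (e \<otimes> c) \<oplus> [q] \<cdot> (e' \<otimes> c))"
    have cl: "?f \<in> carrier R" "?f' \<in> carrier R"
      using IH p assms by (auto simp: m_closed)
    have "rpow R (y \<oplus> [q] \<cdot> c) (Suc n)
        = (?p \<oplus> [(n * q)] \<cdot> e \<oplus> [(q * q)] \<cdot> e') \<otimes> (y \<oplus> [q] \<cdot> c)"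
      using False IH by (simp add: rpow_Suc)
    also have "\<dots> = ?p \<otimes> y \<oplus> [(n * q)] \<cdot> ?f \<oplus> [(q * q)] \<cdot> (e' \<otimes> y)
        \<oplus> ([q] \<cdot> ?f \<oplus> [(n * q * q)] \<cdot> (e \<otimes> c) \<oplus> [(q * q * q)] \<cdot> (e' \<otimes> c))"
      using IH p assms
      by (simp add: l_distr r_distr m_closed add_pow_ldistr add_pow_rdistr
            add.nat_pow_pow add.nat_pow_distrib a_assoc mult_ac)
    also have "\<dots> = ?p \<otimes> y \<oplus> ([(n * q)] \<cdot> ?f \<oplus> [q] \<cdot> ?f) \<oplus> [(q * q)] \<cdot> ?f'"
      using IH p assms
      by (simp add: m_closed add.nat_pow_pow add.nat_pow_distrib a_ac mult_ac)
    also have "[(n * q)] \<cdot> ?f \<oplus> [q] \<cdot> ?f = [(Suc n * q)] \<cdot> ?f"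
      using cl(1) by (simp add: add.nat_pow_mult add.commute)
    finally have "rpow R (y \<oplus> [q] \<cdot> c) (Suc n)
        = rpow R y (Suc n) \<oplus> [(Suc n * q)] \<cdot> ?f \<oplus> [(q * q)] \<cdot> ?f'"
      using False by (simp add: rpow_Suc)
    moreover have "?f \<otimes> y = rpow R y (Suc n) \<otimes> c"
      using p assms False by (simp add: rpow_Suc m_ac)
    ultimately show ?thesis using cl by blast
  qed
qed simp

text \<open>
  Raising a congruence to the power \<open>p\<close> gains a factor \<open>p\<close> in the modulus: in
  $(y + qc)^p - y^p$ the linear term has the factor $pq$ and the others $q^2$.
\<close>

lemma icong_rpow_gain:
  assumes "icong R q x y" "y \<in> carrier R" "p dvd q" "p > 0"
  shows "icong R (p * q) (rpow R x p) (rpow R y p)"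
proof -
  obtain c where c: "c \<in> carrier R" "x = y \<oplus> [q] \<cdot> c"
    using assms by (auto simp: icong_def)
  obtain k where k: "q = p * k" using assms(3) by blast
  obtain e e' where e: "e \<in> carrier R" "e' \<in> carrier R"
      "rpow R x p = rpow R y p \<oplus> [(p * q)] \<cdot> e \<oplus> [(q * q)] \<cdot> e'"
    using rpow_add_multiple[OF assms(2) c(1) assms(4)] c(2) by blast
  have "rpow R x p = rpow R y p \<oplus> [(p * q)] \<cdot> (e \<oplus> [k] \<cdot> e')"
    using e k assms by (simp add: add.nat_pow_distrib add.nat_pow_pow rpow_closed a_assoc mult_ac)
  from icongI[OF this] show ?thesis using e by auto
qed

lemma icong_rpow_prime_power:
  assumes "icong R p x y" "x \<in> carrier R" "y \<in> carrier R" "p > 0"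
  shows "icong R (p ^ Suc j) (rpow R x (p ^ j)) (rpow R y (p ^ j))"
proof (induction j)
  case (Suc j)
  have "rpow R z (p ^ Suc j) = rpow R (rpow R z (p ^ j)) p" if "z \<in> carrier R" for z
    using that assms by (simp add: rpow_rpow mult.commute)
  then show ?case
    using icong_rpow_gain[OF Suc.IH] assms by (simp add: rpow_closed)
qed (use assms in simp)

text \<open>The Chinese remainder theorem for the additive group of \<open>R\<close>.\<close>

lemma icong_zero_coprime:
  assumes "icong R a x \<zero>" "icong R b x \<zero>" "coprime a b"
  shows "icong R (a * b) x \<zero>"
proof -
  obtain u where u: "u \<in> carrier R" "x = [a] \<cdot> u"
    using assms by (auto simp: icong_def)
  obtain w where w: "w \<in> carrier R" "x = [b] \<cdot> w"
    using assms by (auto simp: icong_def)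
  obtain s t where st: "s * int a + t * int b = 1"
    using bezout_int[of "int a" "int b"] assms(3) by auto
  have x: "x \<in> carrier R" using u by simp
  have iu: "x = [(int a)] \<cdot> u" and iw: "x = [(int b)] \<cdot> w"
    using u w by (simp_all add: add_pow_int_ge)
  have "x = [(s * int a + t * int b)] \<cdot> x" using st x by simp
  also have "\<dots> = [(s * int a)] \<cdot> x \<oplus> [(t * int b)] \<cdot> x"
    using x by (simp add: add.int_pow_mult)
  also have "[(s * int a)] \<cdot> x = [int (a * b)] \<cdot> ([s] \<cdot> w)"
    using w(1) by (subst iw) (simp add: add.int_pow_pow mult_ac)
  also have "[(t * int b)] \<cdot> x = [int (a * b)] \<cdot> ([t] \<cdot> u)"
    using u(1) by (subst iu) (simp add: add.int_pow_pow mult_ac)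
  also have "[int (a * b)] \<cdot> ([s] \<cdot> w) \<oplus> [int (a * b)] \<cdot> ([t] \<cdot> u)
      = [int (a * b)] \<cdot> ([s] \<cdot> w \<oplus> [t] \<cdot> u)"
    using u w by (simp add: add.int_pow_distrib)
  also have "\<dots> = \<zero> \<oplus> [(a * b)] \<cdot> ([s] \<cdot> w \<oplus> [t] \<cdot> u)"
    using u w by (subst add_pow_int_ge) (simp_all del: of_nat_mult)
  finally have "x = \<zero> \<oplus> [(a * b)] \<cdot> ([s] \<cdot> w \<oplus> [t] \<cdot> u)" .
  from icongI[OF this] show ?thesis using u w by auto
qed

lemma icong_zero_if_prime_powers:
  assumes "n > 0" "x \<in> carrier R"
    and "\<And>p. \<lbrakk>prime p; p dvd n\<rbrakk> \<Longrightarrow> icong R (p ^ multiplicity p n) x \<zero>"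
  shows "icong R n x \<zero>"
  using assms(1,3)
proof (induction n rule: less_induct)
  case (less n)
  show ?case
  proof (cases "n = 1")
    case True
    then show ?thesis using assms(2) by (auto intro: icongI[of _ _ _ _ x])
  next
    case False
    then obtain p where p: "prime p" "p dvd n" using prime_factor_nat by blast
    define P where "P = p ^ multiplicity p n"
    obtain m where m: "n = P * m" "\<not> p dvd m"
      using multiplicity_decompose'[of n p] p less.prems(1) not_prime_unit unfolding P_def by blast
    have m0: "m > 0" using m less.prems(1) by (cases m) auto
    have "multiplicity p n > 0"
      using p less.prems(1) by (simp add: prime_multiplicity_gt_zero_iff prime_imp_prime_elem)
    then have "P > 1" unfolding P_def using p prime_gt_1_nat one_less_power by blast
    then have "m < n" using m(1) m0 by simp
    moreover have "icong R (q ^ multiplicity q m) x \<zero>" if q: "prime q" "q dvd m" for q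
    proof -
      have "q \<noteq> p" using q m(2) by auto
      then have "multiplicity q P = 0"
        using q p unfolding P_def by (simp add: multiplicity_distinct_prime_power)
      moreover have "multiplicity q (P * m) = multiplicity q P + multiplicity q m"
        using q(1) m0 \<open>P > 1\<close> by (intro prime_elem_multiplicity_mult_distrib) auto
      ultimately have "multiplicity q n = multiplicity q m" using m(1) by simp
      moreover have "q dvd n" using q(2) m(1) by simp
      ultimately show ?thesis using less.prems(2)[OF q(1)] by simp
    qed
    ultimately have "icong R m x \<zero>" using less.IH[of m] m0 by simp
    moreover have "icong R P x \<zero>" unfolding P_def using less.prems p by blast
    moreover have "coprime P m"
      unfolding P_def using p(1) m(2) by (simp add: prime_imp_coprime)
    ultimately show ?thesis using icong_zero_coprime[of P x m] m(1) by simp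
  qed
qed

end


section \<open>Ghost components\<close>

text \<open>
  A ghost component involves only the components at the divisors of its index. Separating it from
  the truncation set allows one Witt vector to be compared over different truncation sets.
\<close>

definition ghost_comp :: "('a, 'm) ring_scheme \<Rightarrow> (nat \<Rightarrow> 'a) \<Rightarrow> nat \<Rightarrow> 'a" where
  "ghost_comp R a n = (\<Oplus>\<^bsub>R\<^esub> d \<in> {d. d dvd n}. [d] \<cdot>\<^bsub>R\<^esub> rpow R (a d) (n div d))"

lemma ghost_map_eq_ghost_comp: "ghost_map R S a = (\<lambda>n\<in>S. ghost_comp R a n)"
  by (simp add: ghost_map_def ghost_comp_def)

lemma finite_divisors: "n > 0 \<Longrightarrow> finite {d. d dvd (n::nat) \<and> P d}"
  by (rule finite_subset[of _ "{d. d dvd n}"]) auto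

lemma div_divisor_pos: "\<lbrakk>d dvd n; n > 0\<rbrakk> \<Longrightarrow> n div d > (0::nat)"
  by (metis div_greater_zero_iff dvd_imp_le dvd_pos_nat)

context comm_rng
begin

lemma ghost_term_closed:
  "\<lbrakk>n > 0; d dvd n; x \<in> carrier R\<rbrakk> \<Longrightarrow> [d] \<cdot> rpow R x (n div d) \<in> carrier R"
  by (simp add: rpow_closed div_divisor_pos)

lemma ghost_comp_closed:
  "\<lbrakk>n > 0; \<And>d. d dvd n \<Longrightarrow> a d \<in> carrier R\<rbrakk> \<Longrightarrow> ghost_comp R a n \<in> carrier R"
  unfolding ghost_comp_def by (rule finsum_closed) (auto intro: ghost_term_closed)

lemma ghost_comp_cong:
  "\<lbrakk>n > 0; \<And>d. d dvd n \<Longrightarrow> a d = b d; \<And>d. d dvd n \<Longrightarrow> b d \<in> carrier R\<rbrakk>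
    \<Longrightarrow> ghost_comp R a n = ghost_comp R b n"
  unfolding ghost_comp_def by (rule finsum_cong') (auto intro: ghost_term_closed)

lemma ghost_comp_split:
  assumes "n > 0" "\<And>d. d dvd n \<Longrightarrow> a d \<in> carrier R"
  shows "ghost_comp R a n = [n] \<cdot> a n
    \<oplus> (\<Oplus>d\<in>{d. d dvd n \<and> d \<noteq> n}. [d] \<cdot> rpow R (a d) (n div d))"
proof -
  have "{d. d dvd n} = insert n {d. d dvd n \<and> d \<noteq> n}" by auto
  then show ?thesis
    using assms finite_divisors[of n "\<lambda>d. d \<noteq> n"] unfolding ghost_comp_def
    by (subst \<open>{d. d dvd n} = _\<close>, subst finsum_insert)
      (auto intro: ghost_term_closed simp: Pi_iff)
qed

lemma ghost_comp_proper_closed: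
  assumes "n > 0" "\<And>d. d dvd n \<Longrightarrow> d \<noteq> n \<Longrightarrow> a d \<in> carrier R"
  shows "(\<Oplus>d\<in>{d. d dvd n \<and> d \<noteq> n}. [d] \<cdot> rpow R (a d) (n div d)) \<in> carrier R"
  using assms by (intro finsum_closed) (auto intro: ghost_term_closed)

lemma ghost_comp_1: "a 1 \<in> carrier R \<Longrightarrow> ghost_comp R a 1 = a 1"
proof -
  have "{d. d dvd (1::nat) \<and> d \<noteq> 1} = {}" by auto
  then show "a 1 \<in> carrier R \<Longrightarrow> ghost_comp R a 1 = a 1"
    using ghost_comp_split[of 1 a] by simp
qed

text \<open>
  The component $a_n$ occurs linearly in the \<open>n\<close>-th ghost component, with coefficient
  \<open>n\<close>, next to components of smaller index.
\<close>

lemma ghost_comp_inj: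
  assumes S: "divisor_stable S" "no_torsion S R"
    and "\<And>d. d \<in> S \<Longrightarrow> a d \<in> carrier R" "\<And>d. d \<in> S \<Longrightarrow> b d \<in> carrier R"
    and eq: "\<And>n. n \<in> S \<Longrightarrow> ghost_comp R a n = ghost_comp R b n"
    and "n \<in> S"
  shows "a n = b n"
  using \<open>n \<in> S\<close>
proof (induction n rule: less_induct)
  case (less n)
  have n: "n > 0" using S less.prems unfolding divisor_stable_def by (metis gr0I)
  have dS: "d \<in> S" if "d dvd n" for d
    using S less.prems that unfolding divisor_stable_def by blast
  let ?r = "\<lambda>a. \<Oplus>d\<in>{d. d dvd n \<and> d \<noteq> n}. [d] \<cdot> rpow R (a d) (n div d)"
  have r: "?r a = ?r b"
  proof (rule finsum_cong')
    fix d assume "d \<in> {d. d dvd n \<and> d \<noteq> n}"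
    then have "d dvd n" "d < n" using n dvd_imp_le le_neq_implies_less by blast+
    then show "[d] \<cdot> rpow R (a d) (n div d) = [d] \<cdot> rpow R (b d) (n div d)"
      using less.IH dS by simp
  qed (use assms n dS in \<open>auto intro: ghost_term_closed\<close>)
  have "[n] \<cdot> a n \<oplus> ?r a = [n] \<cdot> b n \<oplus> ?r b"
    using eq[OF less.prems] ghost_comp_split n dS assms(3,4) by simp
  moreover have "?r b \<in> carrier R"
    by (rule ghost_comp_proper_closed) (use n dS assms in auto)
  ultimately have "[n] \<cdot> a n = [n] \<cdot> b n"
    using r assms(3,4) less.prems by simp
  then show ?case
    using S(2) less.prems assms(3,4) unfolding no_torsion_def inj_on_def by blast
qed

text \<open>
  A Frobenius lift applied to the components changes a ghost component in the same way,
  modulo a power of \<open>p\<close>, as passing to the next index. Both sums run over the divisors of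
  \<open>n\<close> up to terms with a factor $p^{v_p(np)}$, and the terms at \<open>d\<close> are powers of
  quantities congruent modulo \<open>p\<close>, with an exponent and a factor \<open>d\<close> that together
  contain $p^{v_p(n)}$.
\<close>

lemma ghost_comp_frobenius_icong:
  assumes p: "prime p" and n: "n > 0"
    and t: "\<And>d. d dvd n * p \<Longrightarrow> t d \<in> carrier R"
    and y: "\<And>d. d dvd n \<Longrightarrow> y d \<in> carrier R"
    and yt: "\<And>d. d dvd n \<Longrightarrow> icong R p (y d) (rpow R (t d) p)"
  shows "icong R (p ^ multiplicity p (n * p)) (ghost_comp R y n) (ghost_comp R t (n * p))"
proof -
  let ?v = "multiplicity p (n * p)"
  let ?D = "{d. d dvd n}" and ?E = "{d. d dvd n * p \<and> \<not> d dvd n}"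
  let ?t = "\<lambda>d. [d] \<cdot> rpow R (t d) (n * p div d)"
  have p0: "p > 0" using p prime_gt_0_nat by blast
  have np: "n * p > 0" using n p0 by simp
  have fin: "finite ?D" "finite ?E"
    using finite_divisors[OF np, of "\<lambda>d. \<not> d dvd n"] n by auto
  have tc: "?t d \<in> carrier R" if "d dvd n * p" for d
    using ghost_term_closed[OF np that] t[OF that] by blast
  have union: "{d. d dvd n * p} = ?D \<union> ?E" by auto
  have split: "ghost_comp R t (n * p) = (\<Oplus>d\<in>?D. ?t d) \<oplus> (\<Oplus>d\<in>?E. ?t d)"
    unfolding ghost_comp_def union
    by (rule finsum_Un_disjoint) (use fin tc in auto)
  have E: "icong R (p ^ ?v) (?t d) \<zero>" if "d \<in> ?E" for d
  proof -
    from that obtain k where k: "n * p = d * k" by auto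
    have "\<not> p dvd k"
    proof
      assume "p dvd k"
      then obtain k' where "k = p * k'" by auto
      with k p0 have "n = d * k'" by simp
      with that show False by simp
    qed
    then have "multiplicity p k = 0" by (simp add: not_dvd_imp_multiplicity_0)
    moreover have "multiplicity p (d * k) = multiplicity p d + multiplicity p k"
      using p np k by (intro prime_elem_multiplicity_mult_distrib) auto
    ultimately have "?v = multiplicity p d" using k by simp
    then have "p ^ ?v dvd d" by (simp add: multiplicity_dvd)
    then show ?thesis
      by (rule icong_multiple_zero[rotated])
        (use that t np in \<open>auto intro!: rpow_closed div_divisor_pos\<close>)
  qed
  have D: "icong R (p ^ ?v) ([d] \<cdot> rpow R (y d) (n div d)) (?t d)" if "d \<in> ?D" for d
  proof -
    from that obtain k where k: "n = d * k" by auto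
    have d0: "d > 0" and k0: "k > 0" using n k by auto
    let ?j = "multiplicity p k"
    obtain m where m: "k = p ^ ?j * m"
      using multiplicity_dvd[of p k] by (elim dvdE)
    have m0: "m > 0" using m k0 by (metis gr0I mult_0_right less_numeral_extra(3))
    have td: "t d \<in> carrier R" using that t by simp
    have yd: "y d \<in> carrier R" using that y by simp
    have "icong R (p ^ Suc ?j) (rpow R (y d) (p ^ ?j)) (rpow R (rpow R (t d) p) (p ^ ?j))"
      using that p0 td yd by (intro icong_rpow_prime_power yt) (auto simp: rpow_closed)
    then have "icong R (p ^ Suc ?j) (rpow R (rpow R (y d) (p ^ ?j)) m)
        (rpow R (rpow R (rpow R (t d) p) (p ^ ?j)) m)"
      by (rule icong_rpow) (use td p0 m0 in \<open>auto simp: rpow_closed\<close>)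
    moreover have "rpow R (rpow R (y d) (p ^ ?j)) m = rpow R (y d) k"
      using yd p0 m0 m by (metis rpow_rpow zero_less_power)
    moreover have "rpow R (rpow R (rpow R (t d) p) (p ^ ?j)) m = rpow R (t d) (k * p)"
    proof -
      have "rpow R (rpow R (rpow R (t d) p) (p ^ ?j)) m = rpow R (t d) (p * (p ^ ?j * m))"
        using td p0 m0 by (simp add: rpow_rpow rpow_closed mult.assoc)
      also have "p * (p ^ ?j * m) = k * p" using m by (simp add: mult.commute)
      finally show ?thesis .
    qed
    ultimately have "icong R (p ^ Suc ?j) (rpow R (y d) k) (rpow R (t d) (k * p))" by simp
    then have *: "icong R (d * p ^ Suc ?j) ([d] \<cdot> rpow R (y d) k) ([d] \<cdot> rpow R (t d) (k * p))"
      using td k0 p0 by (intro icong_add_pow) (auto simp: rpow_closed)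
    have "?v = multiplicity p d + ?j + 1"
    proof -
      have pe: "prime_elem p" using p by auto
      have "?v = multiplicity p (d * k) + multiplicity p p"
        unfolding k using d0 k0 p0
        by (intro prime_elem_multiplicity_mult_distrib[OF pe]) auto
      moreover have "multiplicity p (d * k) = multiplicity p d + ?j"
        using d0 k0 by (intro prime_elem_multiplicity_mult_distrib[OF pe]) auto
      ultimately show ?thesis using p by (simp add: multiplicity_prime)
    qed
    then have "p ^ ?v = p ^ multiplicity p d * p ^ Suc ?j" by (simp add: power_add)
    then have "p ^ ?v dvd d * p ^ Suc ?j" by (simp add: mult_dvd_mono multiplicity_dvd)
    from icong_dvd[OF * this] show ?thesis
      using k d0 by (simp add: mult.assoc)
  qed
  have "icong R (p ^ ?v) (ghost_comp R y n) (\<Oplus>d\<in>?D. ?t d)"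
    unfolding ghost_comp_def by (rule icong_finsum) (use fin D tc in auto)
  moreover have "icong R (p ^ ?v) (\<Oplus>d\<in>?D. ?t d) (ghost_comp R t (n * p))"
  proof -
    have "icong R (p ^ ?v) (\<Oplus>d\<in>?E. ?t d) (\<Oplus>d\<in>?E. \<zero>)"
      by (rule icong_finsum) (use fin E in auto)
    then have "icong R (p ^ ?v) ((\<Oplus>d\<in>?D. ?t d) \<oplus> (\<Oplus>d\<in>?E. ?t d)) ((\<Oplus>d\<in>?D. ?t d) \<oplus> \<zero>)"
      using tc by (intro icong_add icong_refl finsum_closed) auto
    moreover have "(\<Oplus>d\<in>?D. ?t d) \<in> carrier R" using tc by (intro finsum_closed) auto
    ultimately show ?thesis unfolding split by (simp add: icong_sym)
  qed
  ultimately show ?thesis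
    by (rule icong_trans) (use np t in \<open>auto intro: ghost_comp_closed\<close>)
qed

text \<open>
  Only the divisors $d = pe$ contribute, and the factor \<open>p\<close> of their weight \<open>d\<close> comes out of the
  sum.
\<close>

lemma ghost_comp_verschiebung:
  assumes "p > 0" "n > 0" "\<And>d. d dvd n \<Longrightarrow> p dvd d \<Longrightarrow> a (d div p) \<in> carrier R"
  shows "ghost_comp R (\<lambda>d. if p dvd d then a (d div p) else \<zero>) n
    = (if p dvd n then [p] \<cdot> ghost_comp R a (n div p) else \<zero>)" (is "ghost_comp R ?b n = _")
proof -
  let ?t = "\<lambda>d. [d] \<cdot> rpow R (?b d) (n div d)"
  have bc: "?b d \<in> carrier R" if "d dvd n" for d using that assms by simp
  have tc: "?t d \<in> carrier R" if "d dvd n" for d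
    using ghost_term_closed[OF assms(2) that bc[OF that]] .
  have t0: "?t d = \<zero>" if "d dvd n" "\<not> p dvd d" for d
    using that assms by (simp add: rpow_zero div_divisor_pos)
  show ?thesis
  proof (cases "p dvd n")
    case False
    then have "ghost_comp R ?b n = (\<Oplus>d\<in>{d. d dvd n}. \<zero>)"
      unfolding ghost_comp_def using t0 dvd_trans by (intro finsum_cong') auto
    then show ?thesis using False by simp
  next
    case True
    then obtain m where m: "n = p * m" by auto
    then have m0: "m > 0" using assms by auto
    have ac: "a d \<in> carrier R" if "d dvd m" for d
      using assms(3)[of "p * d"] that assms(1) m by simp
    have "ghost_comp R ?b n = (\<Oplus>d\<in>(*) p ` {d. d dvd m}. ?t d)"
      unfolding ghost_comp_def
    proof (rule add.finprod_mono_neutral_cong_right)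
      show "(*) p ` {d. d dvd m} \<subseteq> {d. d dvd n}" using m by auto
      show "?t d = \<zero>" if "d \<in> {d. d dvd n} - (*) p ` {d. d dvd m}" for d
      proof (rule t0)
        show "d dvd n" using that by simp
        show "\<not> p dvd d"
        proof
          assume "p dvd d"
          then obtain e where "d = p * e" by auto
          with that m assms(1) show False by auto
        qed
      qed
    qed (use assms tc in auto)
    also have "\<dots> = (\<Oplus>d\<in>{d. d dvd m}. ?t (p * d))"
    proof (rule finsum_reindex)
      show "?t \<in> (*) p ` {d. d dvd m} \<rightarrow> carrier R"
      proof (rule Pi_I)
        fix d assume "d \<in> (*) p ` {d. d dvd m}"
        then have "d dvd n" using m by auto
        then show "?t d \<in> carrier R" by (rule tc)
      qed
      show "inj_on ((*) p) {d. d dvd m}" using assms(1) by (auto intro: inj_onI)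
    qed
    also have "\<dots> = (\<Oplus>d\<in>{d. d dvd m}. [p] \<cdot> ([d] \<cdot> rpow R (a d) (m div d)))"
    proof (rule finsum_cong')
      fix d assume "d \<in> {d. d dvd m}"
      then have d: "d dvd m" by simp
      have "n div (p * d) = m div d" using m assms(1) by simp
      moreover have "rpow R (a d) (m div d) \<in> carrier R"
        using ac d m0 by (simp add: rpow_closed div_divisor_pos)
      ultimately show "?t (p * d) = [p] \<cdot> ([d] \<cdot> rpow R (a d) (m div d))"
        using assms(1) by (simp add: add.nat_pow_pow mult.commute)
    qed (use ac m0 in \<open>auto intro: ghost_term_closed\<close>)
    also have "\<dots> = [p] \<cdot> ghost_comp R a m"
      unfolding ghost_comp_def using ac m0
      by (intro finsum_add_pow[symmetric]) (auto intro: ghost_term_closed)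
    finally show ?thesis using m True assms(1) by simp
  qed
qed

end

lemma (in rng_homo) hom_ghost_comp:
  assumes "n > 0" "\<And>d. d dvd n \<Longrightarrow> a d \<in> carrier R"
  shows "h (ghost_comp R a n) = ghost_comp R' (\<lambda>d. h (a d)) n"
proof -
  have "h (ghost_comp R a n) = (\<Oplus>\<^bsub>R'\<^esub>d\<in>{d. d dvd n}. h ([d] \<cdot> rpow R (a d) (n div d)))"
    unfolding ghost_comp_def using assms
    by (intro hom_finsum) (auto intro: dom.ghost_term_closed)
  also have "\<dots> = ghost_comp R' (\<lambda>d. h (a d)) n"
    unfolding ghost_comp_def using assms
    by (intro cod.finsum_cong')
      (auto simp: hom_add_pow hom_rpow dom.rpow_closed div_divisor_pos
        intro!: cod.add.nat_pow_closed cod.rpow_closed)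
  finally show ?thesis .
qed


section \<open>Dwork's lemma\<close>

text \<open>
  A direct system of rings indexed by divisibility, with lifts of the Frobenius that move the
  index. There are two instances: a constant system given by one ring with a Frobenius lift for
  each prime, and the rings $A_{S/n}$ of an object of $\mathcal{RF}_T$, where the Frobenius
  $F_p$ does not preserve the ring.
\<close>

locale frobenius_system =
  fixes S :: "nat set" and B :: "nat \<Rightarrow> ('a, 'm) ring_scheme"
    and tr :: "nat \<Rightarrow> nat \<Rightarrow> 'a \<Rightarrow> 'a" and fr :: "nat \<Rightarrow> nat \<Rightarrow> 'a \<Rightarrow> 'a"
  assumes stable: "divisor_stable S"
    and rng: "n \<in> S \<Longrightarrow> comm_rng (B n)"
    and tr_hom: "\<lbrakk>n \<in> S; d dvd n\<rbrakk> \<Longrightarrow> tr d n \<in> rng_hom (B d) (B n)"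
    and tr_id: "\<lbrakk>n \<in> S; x \<in> carrier (B n)\<rbrakk> \<Longrightarrow> tr n n x = x"
    and tr_tr: "\<lbrakk>n \<in> S; m dvd n; d dvd m; x \<in> carrier (B d)\<rbrakk> \<Longrightarrow> tr m n (tr d m x) = tr d n x"
    and fr_hom: "\<lbrakk>prime p; n * p \<in> S\<rbrakk> \<Longrightarrow> fr p n \<in> rng_hom (B n) (B (n * p))"
    and fr_icong: "\<lbrakk>prime p; n * p \<in> S; x \<in> carrier (B n)\<rbrakk>
      \<Longrightarrow> icong (B (n * p)) p (fr p n x) (rpow (B (n * p)) (tr n (n * p) x) p)"
begin

lemma stable_dvd: "\<lbrakk>n \<in> S; d dvd n\<rbrakk> \<Longrightarrow> d \<in> S"
  using stable unfolding divisor_stable_def by blast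

lemma stable_pos: "n \<in> S \<Longrightarrow> n > 0"
  using stable unfolding divisor_stable_def by (metis gr0I)

lemma tr_homo: "\<lbrakk>n \<in> S; d dvd n\<rbrakk> \<Longrightarrow> rng_homo (B d) (B n) (tr d n)"
  using rng[of n] rng[of d] stable_dvd[of n d] tr_hom
  by (auto simp: rng_homo_def rng_homo_axioms_def)

lemma fr_homo: "\<lbrakk>prime p; n * p \<in> S\<rbrakk> \<Longrightarrow> rng_homo (B n) (B (n * p)) (fr p n)"
  using rng[of n] rng[of "n * p"] stable_dvd[of "n * p" n] fr_hom
  by (auto simp: rng_homo_def rng_homo_axioms_def)

text \<open>
  The components $s_n$ are found recursively. By the congruences, the difference of $g_n$ and the
  contribution of the $s_d$ with $d < n$ is divisible by the \<open>p\<close>-part of \<open>n\<close> for each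
  prime \<open>p\<close>, hence by \<open>n\<close>.
\<close>

lemma dwork_step:
  assumes n: "n \<in> S"
    and g: "\<And>n. n \<in> S \<Longrightarrow> g n \<in> carrier (B n)"
    and fr_g: "\<And>p n. \<lbrakk>prime p; n * p \<in> S\<rbrakk>
      \<Longrightarrow> icong (B (n * p)) (p ^ multiplicity p (n * p)) (fr p n (g n)) (g (n * p))"
    and f: "\<And>d. \<lbrakk>d dvd n; d < n\<rbrakk> \<Longrightarrow> f d \<in> carrier (B d)"
    and gh: "\<And>m. \<lbrakk>m dvd n; m < n\<rbrakk> \<Longrightarrow> ghost_comp (B m) (\<lambda>d. tr d m (f d)) m = g m"
  shows "\<exists>r\<in>carrier (B n). ghost_comp (B n) (\<lambda>d. if d < n then tr d n (f d) else r) n = g n"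
proof -
  interpret Bn: comm_rng "B n" using rng n .
  have n0: "n > 0" using n stable_pos by blast
  let ?s = "\<lambda>r d. if d < n then tr d n (f d) else r"
  have sc: "?s r d \<in> carrier (B n)" if "r \<in> carrier (B n)" "d dvd n" for r d
    using f rng_homo.hom_closed[OF tr_homo[OF n that(2)]] that by simp
  \<comment> \<open>With component zero at \<open>n\<close>, the ghost component of \<open>t\<close> is the contribution of the \<open>s\<^sub>d\<close> with \<open>d < n\<close>.\<close>
  define t where "t = ?s \<zero>\<^bsub>B n\<^esub>"
  have tc: "t d \<in> carrier (B n)" if "d dvd n" for d
    unfolding t_def by (rule sc) (use that in auto)
  let ?x = "g n \<ominus>\<^bsub>B n\<^esub> ghost_comp (B n) t n"
  have ghc: "ghost_comp (B n) t n \<in> carrier (B n)" using n0 tc by (rule Bn.ghost_comp_closed)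
  have xc: "?x \<in> carrier (B n)" using g n ghc by simp
  have "icong (B n) n ?x \<zero>\<^bsub>B n\<^esub>"
  proof (rule Bn.icong_zero_if_prime_powers[OF n0 xc])
    fix p assume p: "prime p" "p dvd n"
    then obtain m where m: "n = m * p" by (auto simp: mult.commute)
    have mS: "m \<in> S" using stable_dvd n m by auto
    have m0: "m > 0" and mn: "m < n" using n0 m prime_gt_1_nat[OF p(1)] by auto
    interpret F: rng_homo "B m" "B n" "fr p m" using fr_homo[of p m] p(1) n m by simp
    let ?q = "p ^ multiplicity p n"
    have fd: "f d \<in> carrier (B d)" "tr d m (f d) \<in> carrier (B m)" if "d dvd m" for d
    proof -
      have "d dvd n" using that m by simp
      moreover have "d < n" using dvd_imp_le[OF that m0] mn by linarith
      ultimately show "f d \<in> carrier (B d)" by (rule f)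
      then show "tr d m (f d) \<in> carrier (B m)"
        using rng_homo.hom_closed[OF tr_homo[OF mS that]] by blast
    qed
    have "fr p m (g m) = fr p m (ghost_comp (B m) (\<lambda>d. tr d m (f d)) m)"
      using gh mn m by simp
    also have "\<dots> = ghost_comp (B n) (\<lambda>d. fr p m (tr d m (f d))) m"
      using m0 fd by (intro F.hom_ghost_comp)
    finally have eq: "fr p m (g m) = ghost_comp (B n) (\<lambda>d. fr p m (tr d m (f d))) m" .
    have "icong (B n) ?q (ghost_comp (B n) (\<lambda>d. fr p m (tr d m (f d))) m) (ghost_comp (B n) t n)"
      unfolding m
    proof (rule comm_rng.ghost_comp_frobenius_icong[OF _ p(1) m0])
      fix d assume d: "d dvd m"
      have "d < n" using d mn dvd_imp_le[OF d m0] by simp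
      then have "t d = tr m n (tr d m (f d))"
        unfolding t_def using tr_tr[OF n _ d] fd(1)[OF d] m by simp
      then show "icong (B (m * p)) p (fr p m (tr d m (f d))) (rpow (B (m * p)) (t d) p)"
        using fr_icong[OF p(1), of m "tr d m (f d)"] fd(2)[OF d] n m by simp
    next
      show "comm_rng (B (m * p))" using Bn.comm_rng_axioms m by simp
      show "t d \<in> carrier (B (m * p))" if "d dvd m * p" for d
        using tc that unfolding m .
      show "fr p m (tr d m (f d)) \<in> carrier (B (m * p))" if "d dvd m" for d
        using F.hom_closed[OF fd(2)[OF that]] unfolding m .
    qed
    moreover have "icong (B n) ?q (fr p m (g m)) (g n)"
      using fr_g[OF p(1), of m] n m by simp
    ultimately have "icong (B n) ?q (g n) (ghost_comp (B n) t n)"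
      using Bn.icong_trans[of ?q "g n"] Bn.icong_sym g[OF n] ghc eq by metis
    then have "icong (B n) ?q ?x (ghost_comp (B n) t n \<ominus>\<^bsub>B n\<^esub> ghost_comp (B n) t n)"
      unfolding a_minus_def using ghc by (intro Bn.icong_add Bn.icong_refl) auto
    then show "icong (B n) ?q ?x \<zero>\<^bsub>B n\<^esub>" using ghc by (simp add: a_minus_def Bn.r_neg)
  qed
  then obtain c where c: "c \<in> carrier (B n)" "?x = [n] \<cdot>\<^bsub>B n\<^esub> c"
    by (auto simp: icong_def)
  have lt: "d < n" if "d dvd n" "d \<noteq> n" for d
    using dvd_imp_le[OF that(1) n0] that(2) by simp
  have trc: "tr d n (f d) \<in> carrier (B n)" if "d dvd n" "d \<noteq> n" for d
    using sc[OF Bn.zero_closed that(1)] lt[OF that] by simp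
  let ?r = "\<Oplus>\<^bsub>B n\<^esub>d\<in>{d. d dvd n \<and> d \<noteq> n}. [d] \<cdot>\<^bsub>B n\<^esub> rpow (B n) (tr d n (f d)) (n div d)"
  have rest: "ghost_comp (B n) (?s r) n = [n] \<cdot>\<^bsub>B n\<^esub> r \<oplus>\<^bsub>B n\<^esub> ?r"
    if "r \<in> carrier (B n)" for r
  proof -
    have "(\<Oplus>\<^bsub>B n\<^esub>d\<in>{d. d dvd n \<and> d \<noteq> n}. [d] \<cdot>\<^bsub>B n\<^esub> rpow (B n) (?s r d) (n div d)) = ?r"
      by (rule Bn.finsum_cong') (use lt Bn.ghost_term_closed[OF n0] trc in auto)
    then show ?thesis using Bn.ghost_comp_split[OF n0 sc[OF that]] by simp
  qed
  have rc: "?r \<in> carrier (B n)"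
    by (rule Bn.ghost_comp_proper_closed[OF n0 trc])
  have "ghost_comp (B n) t n = ?r" unfolding t_def using rest rc by simp
  then have "ghost_comp (B n) (?s c) n = ?x \<oplus>\<^bsub>B n\<^esub> ghost_comp (B n) t n"
    using rest c by simp
  also have "\<dots> = g n"
    using g[OF n] ghc by (simp add: a_minus_def Bn.a_assoc Bn.l_neg)
  finally show ?thesis using c(1) by blast
qed

theorem dwork:
  assumes g: "\<And>n. n \<in> S \<Longrightarrow> g n \<in> carrier (B n)"
    and fr_g: "\<And>p n. \<lbrakk>prime p; n * p \<in> S\<rbrakk>
      \<Longrightarrow> icong (B (n * p)) (p ^ multiplicity p (n * p)) (fr p n (g n)) (g (n * p))"
  shows "\<exists>s. \<forall>n\<in>S. s n \<in> carrier (B n) \<and> ghost_comp (B n) (\<lambda>d. tr d n (s d)) n = g n"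
proof -
  \<comment> \<open>The cut-off at \<open>n\<close> makes the condition on \<open>r\<close> depend only on the values of \<open>f\<close> below \<open>n\<close>.\<close>
  let ?P = "\<lambda>f n r. n \<in> S \<longrightarrow> r \<in> carrier (B n) \<and>
    ghost_comp (B n) (\<lambda>d. if d < n then tr d n (f d) else r) n = g n"
  have end_eq: "ghost_comp (B n) (\<lambda>d. if d < n then tr d n (f d) else f n) n
      = ghost_comp (B n) (\<lambda>d. tr d n (f d)) n"
    if "n \<in> S" "\<And>d. d dvd n \<Longrightarrow> f d \<in> carrier (B d)" for f n
  proof (rule comm_rng.ghost_comp_cong[OF rng[OF that(1)] stable_pos[OF that(1)]])
    fix d assume d: "d dvd n"
    show "(if d < n then tr d n (f d) else f n) = tr d n (f d)"
      using dvd_imp_le[OF d stable_pos[OF that(1)]] tr_id[OF that(1)] that(2)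
      by (cases "d = n") auto
    show "tr d n (f d) \<in> carrier (B n)"
      using rng_homo.hom_closed[OF tr_homo[OF that(1) d]] that(2)[OF d] by blast
  qed
  have "\<exists>s. \<forall>n. ?P s n (s n)"
  proof (rule dependent_wellorder_choice)
    fix r and f h :: "nat \<Rightarrow> 'a" and n :: nat
    assume "\<And>y. y < n \<Longrightarrow> f y = h y"
    then have "(\<lambda>d. if d < n then tr d n (f d) else r) = (\<lambda>d. if d < n then tr d n (h d) else r)"
      by auto
    then show "?P f n r = ?P h n r" by simp
  next
    fix n f assume IH: "\<And>y. y < n \<Longrightarrow> ?P f y (f y)"
    show "\<exists>r. ?P f n r"
    proof (cases "n \<in> S")
      case True
      have fc: "f d \<in> carrier (B d)" if "d dvd n" "d < n" for d
        using IH that stable_dvd True by blast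
      have "\<exists>r\<in>carrier (B n). ghost_comp (B n) (\<lambda>d. if d < n then tr d n (f d) else r) n = g n"
      proof (rule dwork_step[OF True g fr_g fc])
        fix m assume m: "m dvd n" "m < n"
        have mS: "m \<in> S" using True m(1) stable_dvd by blast
        have "f d \<in> carrier (B d)" if "d dvd m" for d
          using that m dvd_imp_le[OF that stable_pos[OF mS]]
          by (intro fc) (auto intro: dvd_trans)
        from end_eq[OF mS this] show "ghost_comp (B m) (\<lambda>d. tr d m (f d)) m = g m"
          using IH[OF m(2)] mS by simp
      qed auto
      then show ?thesis by blast
    qed simp
  qed
  then obtain s where s: "\<And>n. ?P s n (s n)" by blast
  have "s n \<in> carrier (B n) \<and> ghost_comp (B n) (\<lambda>d. tr d n (s d)) n = g n" if "n \<in> S" for n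
    using s[of n] that end_eq[OF that, of s] s stable_dvd[OF that] by simp
  then show ?thesis by blast
qed

end


section \<open>Evaluation of integer polynomials\<close>

abbreviation "lookup \<equiv> Poly_Mapping.lookup"
abbreviation "keys \<equiv> Poly_Mapping.keys"
abbreviation "single \<equiv> Poly_Mapping.single"

lemma poly_mapping_additive_induct [case_names zero single add]:
  fixes P :: "('k \<Rightarrow>\<^sub>0 'v::comm_monoid_add) \<Rightarrow> bool"
  assumes "P 0" "\<And>k v. P (single k v)" "\<And>f g. \<lbrakk>P f; P g\<rbrakk> \<Longrightarrow> P (f + g)"
  shows "P f"
proof -
  have "f = (\<Sum>k\<in>keys f. single k (lookup f k))"
    by (rule poly_mapping_eqI)
      (auto simp: lookup_sum lookup_single when_def in_keys_iff sum.delta)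
  moreover have "P (\<Sum>k\<in>K. single k (lookup f k))" if "finite K" for K
    using that by (induction rule: finite_induct) (auto intro: assms)
  ultimately show ?thesis by (metis finite_keys)
qed

text \<open>
  With $-1$ among the generators, closure under sums and products covers all integer
  coefficients. This form suits properties such as Frobenius congruences, which are not linear.
\<close>

lemma witt_poly_induct [case_names one minus_one var add mult]:
  fixes Q :: "witt_poly \<Rightarrow> bool"
  assumes one: "Q 1" and minus_one: "Q (- 1)" and var: "\<And>v. Q (var v)"
    and add: "\<And>f g. \<lbrakk>Q f; Q g\<rbrakk> \<Longrightarrow> Q (f + g)" and mult: "\<And>f g. \<lbrakk>Q f; Q g\<rbrakk> \<Longrightarrow> Q (f * g)"
  shows "Q P"
proof (induction P rule: poly_mapping_additive_induct)
  case zero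
  show ?case using add[OF one minus_one] by simp
next
  case (single m c)
  have nat: "Q (of_nat n)" for n
    using add[OF one minus_one] add[OF one] by (induction n) auto
  have int: "Q (of_int c)"
    by (cases c rule: int_cases2) (use nat mult[OF minus_one nat] in auto)
  have monomial: "Q (single m 1)"
  proof (induction m rule: poly_mapping_additive_induct)
    case zero
    show ?case using one by simp
  next
    case (single v k)
    have "single (single v k) 1 = var v ^ k"
    proof (induction k)
      case (Suc k)
      have "single v (Suc k) = single v 1 + single v k" by (simp flip: single_add)
      then have "single (single v (Suc k)) (1::int) = single (single v 1) 1 * single (single v k) 1"
        by (simp only: mult_single mult_1)
      then show ?case using Suc by (simp add: var_def)
    qed simp
    moreover have "Q (var v ^ k)" by (induction k) (auto intro: one mult var)
    ultimately show ?case by simp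
  next
    case (add m m')
    then show ?case using mult by (metis mult_single mult_1)
  qed
  have "single m c = single 0 c * single m 1" by (simp add: mult_single)
  then show ?case using mult[OF int monomial] by (metis single_of_int of_int_eq_id id_apply)
qed (rule add)

text \<open>
  The ring homomorphism from the polynomial ring to a commutative ring with unit, of which
  \<^const>\<open>eval_poly\<close> is the second component for the unitization.
\<close>

definition poly_eval :: "('b, 'm) ring_scheme \<Rightarrow> (nat + nat \<Rightarrow> 'b) \<Rightarrow> witt_poly \<Rightarrow> 'b" where
  "poly_eval U f P = (\<Oplus>\<^bsub>U\<^esub> m \<in> keys P.
     [lookup P m] \<cdot>\<^bsub>U\<^esub> (\<Otimes>\<^bsub>U\<^esub> v \<in> keys m. f v [^]\<^bsub>U\<^esub> lookup m v))"

lemma eval_poly_eq_poly_eval: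
  "eval_poly R f P = snd (poly_eval (unitization R) (\<lambda>v. (0, f v)) P)"
  by (simp add: eval_poly_def poly_eval_def)

context cring
begin

abbreviation monomial_eval :: "(nat + nat \<Rightarrow> 'a) \<Rightarrow> (nat + nat \<Rightarrow>\<^sub>0 nat) \<Rightarrow> 'a" where
  "monomial_eval f m \<equiv> (\<Otimes>v\<in>keys m. f v [^] lookup m v)"

lemma monomial_eval_superset:
  assumes "finite K" "keys m \<subseteq> K" "\<And>v. f v \<in> carrier R"
  shows "monomial_eval f m = (\<Otimes>v\<in>K. f v [^] lookup m v)"
  using assms by (intro finprod_mono_neutral_cong_left) (auto simp: in_keys_iff)

lemma monomial_eval_closed: "(\<And>v. f v \<in> carrier R) \<Longrightarrow> monomial_eval f m \<in> carrier R"
  by (rule finprod_closed) auto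

lemma monomial_eval_add:
  assumes f: "\<And>v. f v \<in> carrier R"
  shows "monomial_eval f (m + m') = monomial_eval f m \<otimes> monomial_eval f m'"
proof -
  let ?K = "keys m \<union> keys m'"
  have "monomial_eval f (m + m') = (\<Otimes>v\<in>?K. f v [^] lookup (m + m') v)"
    by (rule monomial_eval_superset) (use f keys_add[of m m'] in auto)
  also have "\<dots> = (\<Otimes>v\<in>?K. f v [^] lookup m v \<otimes> f v [^] lookup m' v)"
    by (rule finprod_cong') (auto simp: f lookup_add nat_pow_mult)
  also have "\<dots> = (\<Otimes>v\<in>?K. f v [^] lookup m v) \<otimes> (\<Otimes>v\<in>?K. f v [^] lookup m' v)"
    by (rule finprod_multf) (auto simp: f)
  also have "(\<Otimes>v\<in>?K. f v [^] lookup m v) = monomial_eval f m"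
    by (rule monomial_eval_superset[symmetric]) (use f in auto)
  also have "(\<Otimes>v\<in>?K. f v [^] lookup m' v) = monomial_eval f m'"
    by (rule monomial_eval_superset[symmetric]) (use f in auto)
  finally show ?thesis .
qed

lemma poly_eval_superset:
  assumes "finite K" "keys P \<subseteq> K" "\<And>v. f v \<in> carrier R"
  shows "poly_eval R f P = (\<Oplus>m\<in>K. [lookup P m] \<cdot> monomial_eval f m)"
  unfolding poly_eval_def using assms
  by (intro add.finprod_mono_neutral_cong_left) (auto simp: in_keys_iff monomial_eval_closed add_pow_int_ge)

lemma poly_eval_closed: "(\<And>v. f v \<in> carrier R) \<Longrightarrow> poly_eval R f P \<in> carrier R"
  unfolding poly_eval_def by (rule finsum_closed) (auto simp: monomial_eval_closed)

lemma poly_eval_add: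
  assumes f: "\<And>v. f v \<in> carrier R"
  shows "poly_eval R f (P + Q) = poly_eval R f P \<oplus> poly_eval R f Q"
proof -
  let ?K = "keys P \<union> keys Q"
  have "poly_eval R f (P + Q) = (\<Oplus>m\<in>?K. [lookup (P + Q) m] \<cdot> monomial_eval f m)"
    by (rule poly_eval_superset) (use f keys_add[of P Q] in auto)
  also have "\<dots> = (\<Oplus>m\<in>?K. [lookup P m] \<cdot> monomial_eval f m \<oplus> [lookup Q m] \<cdot> monomial_eval f m)"
    by (rule finsum_cong') (auto simp: monomial_eval_closed f lookup_add add.int_pow_mult)
  also have "\<dots> = (\<Oplus>m\<in>?K. [lookup P m] \<cdot> monomial_eval f m)
      \<oplus> (\<Oplus>m\<in>?K. [lookup Q m] \<cdot> monomial_eval f m)"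
    by (rule finsum_addf) (auto simp: monomial_eval_closed f)
  also have "(\<Oplus>m\<in>?K. [lookup P m] \<cdot> monomial_eval f m) = poly_eval R f P"
    by (rule poly_eval_superset[symmetric]) (use f in auto)
  also have "(\<Oplus>m\<in>?K. [lookup Q m] \<cdot> monomial_eval f m) = poly_eval R f Q"
    by (rule poly_eval_superset[symmetric]) (use f in auto)
  finally show ?thesis .
qed

lemma poly_eval_single:
  assumes f: "\<And>v. f v \<in> carrier R"
  shows "poly_eval R f (single m c) = [c] \<cdot> monomial_eval f m"
proof -
  have "poly_eval R f (single m c) = (\<Oplus>k\<in>{m}. [lookup (single m c) k] \<cdot> monomial_eval f k)"
    by (rule poly_eval_superset) (use f in auto)
  also have "\<dots> = [c] \<cdot> monomial_eval f m"
    using monomial_eval_closed[of f m] f by simp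
  finally show ?thesis .
qed

lemma poly_eval_zero: "poly_eval R f 0 = \<zero>"
  by (simp add: poly_eval_def)

lemma poly_eval_var: "(\<And>v. f v \<in> carrier R) \<Longrightarrow> poly_eval R f (var v) = f v"
  by (simp add: var_def poly_eval_single)

lemma poly_eval_mult:
  assumes f: "\<And>v. f v \<in> carrier R"
  shows "poly_eval R f (P * Q) = poly_eval R f P \<otimes> poly_eval R f Q"
proof (induction P rule: poly_mapping_additive_induct)
  case zero
  show ?case by (simp add: poly_eval_zero poly_eval_closed f)
next
  case (single m c)
  show ?case
  proof (induction Q rule: poly_mapping_additive_induct)
    case zero
    show ?case by (simp add: poly_eval_zero poly_eval_closed f)
  next
    case (single m' c')
    have "poly_eval R f (single m c * single m' c')
        = [(c * c')] \<cdot> (monomial_eval f m \<otimes> monomial_eval f m')"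
      by (simp add: mult_single poly_eval_single f monomial_eval_add)
    also have "\<dots> = [c] \<cdot> monomial_eval f m \<otimes> [c'] \<cdot> monomial_eval f m'"
      by (simp add: monomial_eval_closed f add_pow_ldistr_int add_pow_rdistr_int
          add.int_pow_pow mult.commute)
    finally show ?case by (simp add: poly_eval_single f)
  next
    case (add Q Q')
    then show ?case
      by (simp add: distrib_left poly_eval_add f poly_eval_closed r_distr)
  qed
next
  case (add P P')
  then show ?case
    by (simp add: distrib_right poly_eval_add f poly_eval_closed l_distr)
qed

end


section \<open>The polynomial ring and its Frobenius lifts\<close>

text \<open>
  The integers and the polynomial ring are given by type classes. As records they become instances
  of what is proved for arbitrary rings.
\<close>

definition class_ring :: "'b::comm_ring_1 ring" where
  "class_ring = \<lparr>carrier = UNIV, monoid.mult = (*), one = 1, zero = 0, add = (+)\<rparr>"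

lemma class_ring_simps [simp]:
  "carrier class_ring = UNIV" "x \<otimes>\<^bsub>class_ring\<^esub> y = x * y" "\<one>\<^bsub>class_ring\<^esub> = 1"
  "\<zero>\<^bsub>class_ring\<^esub> = 0" "x \<oplus>\<^bsub>class_ring\<^esub> y = x + y"
  by (simp_all add: class_ring_def)

lemma cring_class_ring: "cring (class_ring :: 'b::comm_ring_1 ring)"
proof (rule cringI)
  show "abelian_group (class_ring :: 'b ring)"
  proof (rule abelian_groupI)
    fix x :: 'b
    show "\<exists>y\<in>carrier class_ring. y \<oplus>\<^bsub>class_ring\<^esub> x = \<zero>\<^bsub>class_ring\<^esub>"
      by (rule bexI[of _ "- x"]) simp_all
  qed (simp_all add: ac_simps)
  show "Group.comm_monoid (class_ring :: 'b ring)"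
    by (rule comm_monoidI) (simp_all add: ac_simps)
qed (simp add: distrib_right)

interpretation class_ring: cring "class_ring :: 'b::comm_ring_1 ring"
  by (rule cring_class_ring)

lemma comm_rng_class_ring: "comm_rng class_ring"
  by (intro cring_comm_rng cring_class_ring)

lemma class_ring_rpow [simp]: "rpow class_ring x n = x ^ n"
proof (induction n)
  case (Suc n)
  then show ?case by (cases "n = 0") (simp_all add: rpow_Suc)
qed simp

lemma class_ring_add_pow [simp]: "[(n::nat)] \<cdot>\<^bsub>class_ring\<^esub> x = of_nat n * x"
  by (induction n) (simp_all add: algebra_simps)

lemma class_ring_finsum: "finite I \<Longrightarrow> finsum class_ring f I = sum f I"
  by (induction rule: finite_induct) simp_all

lemma class_ring_icong: "icong class_ring m x y \<longleftrightarrow> of_nat m dvd x - y"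
  by (auto simp: icong_def dvd_def algebra_simps)

lemma ghost_poly_eq_ghost_comp: "n > 0 \<Longrightarrow> ghost_poly s n = ghost_comp class_ring s n"
  by (simp add: ghost_poly_def ghost_comp_def class_ring_finsum)

lemma poly_eval_rng_hom:
  "\<lbrakk>cring U; \<And>v. f v \<in> carrier U\<rbrakk> \<Longrightarrow> rng_homo class_ring U (poly_eval U f)"
  by (auto simp: rng_homo_def rng_homo_axioms_def comm_rng_class_ring cring_comm_rng
      rng_hom_def cring.poly_eval_closed cring.poly_eval_add cring.poly_eval_mult)

lemma poly_eval_one: "\<lbrakk>cring U; \<And>v. f v \<in> carrier U\<rbrakk> \<Longrightarrow> poly_eval U f 1 = \<one>\<^bsub>U\<^esub>"
proof -
  assume U: "cring U" and f: "\<And>v. f v \<in> carrier U"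
  interpret cring U by fact
  show ?thesis
    using poly_eval_single[of f 0 1] f by simp
qed

lemma binomial_prime_dvd:
  fixes a b :: "'b::comm_ring_1"
  assumes p: "prime p"
  shows "of_nat p dvd (a + b) ^ p - (a ^ p + b ^ p)"
proof -
  have p0: "p > 0" using p prime_gt_0_nat by blast
  let ?t = "\<lambda>k. of_nat (p choose k) * a ^ k * b ^ (p - k)"
  have "{..p} = insert 0 (insert p {0<..<p})" by auto
  then have "(a + b) ^ p = b ^ p + (a ^ p + sum ?t {0<..<p})"
    using p0 by (simp add: binomial_ring)
  moreover have "of_nat p dvd ?t k" if "k \<in> {0<..<p}" for k
  proof -
    have "p dvd (p choose k)"
      by (rule dvd_choose_prime) (use that p in auto)
    then show ?thesis by (metis dvd_mult2 of_nat_dvd_iff of_nat_mult dvd_def)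
  qed
  then have "of_nat p dvd sum ?t {0<..<p}" by (rule dvd_sum)
  ultimately show ?thesis by simp
qed

text \<open>
  The lift of the \<open>p\<close>-th power map that fixes the coefficients and raises each variable to the
  \<open>p\<close>-th power.
\<close>

definition poly_frob :: "nat \<Rightarrow> witt_poly \<Rightarrow> witt_poly" where
  "poly_frob p = poly_eval class_ring (\<lambda>v. var v ^ p)"

lemma poly_frob_homo: "rng_homo class_ring class_ring (poly_frob p)"
  unfolding poly_frob_def by (rule poly_eval_rng_hom[OF cring_class_ring]) simp

lemma poly_frob_1: "poly_frob p 1 = 1"
  unfolding poly_frob_def using poly_eval_one[OF cring_class_ring] by simp

lemma poly_frob_add: "poly_frob p (P + Q) = poly_frob p P + poly_frob p Q"
  using rng_homo.hom_add[OF poly_frob_homo, of P Q p] by simp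

lemma poly_frob_mult: "poly_frob p (P * Q) = poly_frob p P * poly_frob p Q"
  using rng_homo.hom_mult[OF poly_frob_homo, of P Q p] by simp

lemma poly_frob_minus: "poly_frob p (- P) = - poly_frob p P"
proof -
  have "poly_frob p P + poly_frob p (- P) = 0"
    using poly_frob_add[of p P "- P"] rng_homo.hom_zero[OF poly_frob_homo, of p] by simp
  then show ?thesis by (simp add: add_eq_0_iff)
qed

text \<open>
  Both sides are additive modulo \<open>p\<close> and multiplicative, so the congruence need only be checked on
  generators.
\<close>

lemma poly_frob_icong:
  assumes p: "prime p"
  shows "icong class_ring p (poly_frob p P) (P ^ p)"
proof (induction P rule: witt_poly_induct)
  case one
  show ?case by (simp add: class_ring_icong poly_frob_1)
next
  case minus_one
  have "p = 2 \<or> odd p" using prime_odd_nat[OF p] prime_ge_2_nat[OF p] by linarith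
  then show ?case by (auto simp: class_ring_icong poly_frob_minus poly_frob_1)
next
  case (var v)
  show ?case
    unfolding poly_frob_def by (simp add: class_ring.poly_eval_var class_ring_icong)
next
  case (add f g)
  have "poly_frob p (f + g) - (f + g) ^ p
      = (poly_frob p f - f ^ p) + (poly_frob p g - g ^ p) - ((f + g) ^ p - (f ^ p + g ^ p))"
    by (simp add: poly_frob_add)
  then show ?case
    using add binomial_prime_dvd[OF p, of f g] unfolding class_ring_icong
    by (simp only: dvd_add dvd_diff)
next
  case (mult f g)
  show ?case
    using comm_rng.icong_mult[OF comm_rng_class_ring mult.IH]
    by (simp add: power_mult_distrib poly_frob_mult)
qed

text \<open>
  Dwork's criterion for a sequence of polynomials to be the sequence of ghost components of a
  Witt vector.
\<close>

definition ghost_coherent :: "(nat \<Rightarrow> witt_poly) \<Rightarrow> bool" where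
  "ghost_coherent G \<longleftrightarrow> (\<forall>p n. prime p \<longrightarrow> n > 0 \<longrightarrow>
     icong class_ring (p ^ multiplicity p (n * p)) (poly_frob p (G n)) (G (n * p)))"

lemma divisor_stable_pos: "divisor_stable {n. n > 0}"
  unfolding divisor_stable_def by (auto intro: dvd_pos_nat)

lemma no_torsion_witt_poly: "no_torsion {n. n > 0} (class_ring :: witt_poly ring)"
proof -
  have "x = y" if "n > 0" "of_nat n * x = of_nat n * y" for n and x y :: witt_poly
  proof (rule poly_mapping_eqI)
    fix m
    have "lookup (of_nat n * z) m = int n * lookup z m" for z :: witt_poly
      by (induction n) (simp_all add: distrib_right lookup_add)
    then have "int n * lookup x m = int n * lookup y m" using that(2) by metis
    then show "lookup x m = lookup y m" using that(1) by simp
  qed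
  then show ?thesis by (auto simp: no_torsion_def inj_on_def)
qed

text \<open>
  Existence is Dwork's lemma for the constant system, uniqueness the absence of torsion in the
  polynomial ring. This makes the definite description in \<^const>\<open>with_ghost\<close> meaningful.
\<close>

lemma ghost_poly_with_ghost:
  assumes "ghost_coherent G" "n > 0"
  shows "ghost_poly (with_ghost G) n = G n"
proof -
  interpret comm_rng "class_ring :: witt_poly ring" by (rule comm_rng_class_ring)
  interpret frobenius_system "{n. n > 0}" "\<lambda>_. class_ring :: witt_poly ring"
    "\<lambda>_ _ x. x" "\<lambda>p _. poly_frob p"
  proof
    fix p n :: nat and x :: witt_poly assume "prime p"
    show "poly_frob p \<in> rng_hom class_ring class_ring"
      using poly_frob_homo by (simp add: rng_homo_def rng_homo_axioms_def)
    show "icong class_ring p (poly_frob p x) (rpow class_ring x p)"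
      using poly_frob_icong \<open>prime p\<close> by simp
  qed (auto simp: divisor_stable_pos rng_hom_def)
  obtain s where s: "\<And>n. n > 0 \<Longrightarrow> ghost_comp class_ring s n = G n"
    using dwork[of G] assms(1) by (auto simp: ghost_coherent_def)
  \<comment> \<open>Dwork's lemma leaves the value at zero open.\<close>
  have "\<exists>!s. s 0 = 0 \<and> (\<forall>n>0. ghost_poly s n = G n)"
  proof (rule ex1I)
    have "ghost_comp class_ring (s(0 := 0)) n = G n" if "n > 0" for n
      using s[OF that] that ghost_comp_cong[of n "s(0 := 0)" s] dvd_pos_nat by fastforce
    then show "(s(0 := 0)) 0 = 0 \<and> (\<forall>n>0. ghost_poly (s(0 := 0)) n = G n)"
      by (simp add: ghost_poly_eq_ghost_comp)
  next
    fix s' assume s': "s' 0 = 0 \<and> (\<forall>n>0. ghost_poly s' n = G n)"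
    show "s' = s(0 := 0)"
    proof
      fix n
      show "s' n = (s(0 := 0)) n"
      proof (cases "n > 0")
        case True
        then have "s' n = s n"
          using ghost_comp_inj[OF divisor_stable_pos no_torsion_witt_poly, of s' s n] s s'
          by (simp add: ghost_poly_eq_ghost_comp)
        then show ?thesis using True by simp
      qed (use s' in simp)
    qed
  qed
  from theI'[OF this] show ?thesis using assms(2) unfolding with_ghost_def by blast
qed

lemma ghost_coherent_ghost_poly:
  assumes "\<And>d p. poly_frob p (s d) = s d ^ p"
  shows "ghost_coherent (ghost_poly s)"
  unfolding ghost_coherent_def
proof (intro allI impI)
  fix p n :: nat assume p: "prime p" and n: "n > 0"
  interpret F: rng_homo class_ring class_ring "poly_frob p" by (rule poly_frob_homo)
  have "poly_frob p (ghost_poly s n) = ghost_comp class_ring (\<lambda>d. s d ^ p) n"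
    using n F.hom_ghost_comp[of n s] assms by (simp add: ghost_poly_eq_ghost_comp)
  moreover have "icong class_ring (p ^ multiplicity p (n * p))
      (ghost_comp class_ring (\<lambda>d. s d ^ p) n) (ghost_comp class_ring s (n * p))"
    by (rule comm_rng.ghost_comp_frobenius_icong[OF comm_rng_class_ring p n])
      (simp_all add: comm_rng.icong_refl[OF comm_rng_class_ring])
  ultimately show "icong class_ring (p ^ multiplicity p (n * p))
      (poly_frob p (ghost_poly s n)) (ghost_poly s (n * p))"
    using n prime_gt_0_nat[OF p] by (simp add: ghost_poly_eq_ghost_comp)
qed

lemma ghost_coherent_var: "ghost_coherent (ghost_poly (var \<circ> c))"
  by (rule ghost_coherent_ghost_poly) (simp add: poly_frob_def class_ring.poly_eval_var)

lemma ghost_coherent_add: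
  "\<lbrakk>ghost_coherent G; ghost_coherent H\<rbrakk> \<Longrightarrow> ghost_coherent (\<lambda>n. G n + H n)"
  unfolding ghost_coherent_def poly_frob_add
  by (simp add: comm_rng.icong_add[OF comm_rng_class_ring, simplified])

lemma ghost_coherent_mult:
  "\<lbrakk>ghost_coherent G; ghost_coherent H\<rbrakk> \<Longrightarrow> ghost_coherent (\<lambda>n. G n * H n)"
  unfolding ghost_coherent_def poly_frob_mult
  by (simp add: comm_rng.icong_mult[OF comm_rng_class_ring, simplified])

lemma ghost_coherent_minus:
  assumes "ghost_coherent G"
  shows "ghost_coherent (\<lambda>n. - G n)"
  unfolding ghost_coherent_def class_ring_icong
proof (intro allI impI)
  fix p n :: nat assume "prime p" "n > 0"
  then have "of_nat (p ^ multiplicity p (n * p)) dvd - (poly_frob p (G n) - G (n * p))"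
    using assms unfolding ghost_coherent_def class_ring_icong by (simp only: dvd_minus_iff)
  then show "of_nat (p ^ multiplicity p (n * p)) dvd poly_frob p (- G n) - - G (n * p)"
    by (simp add: poly_frob_minus)
qed

lemma ghost_coherent_shift:
  assumes "ghost_coherent G" "m > 0"
  shows "ghost_coherent (\<lambda>n. G (m * n))"
  unfolding ghost_coherent_def
proof (intro allI impI)
  fix p n :: nat assume p: "prime p" and n: "n > 0"
  have "icong class_ring (p ^ multiplicity p (m * n * p)) (poly_frob p (G (m * n))) (G (m * n * p))"
    using assms p n unfolding ghost_coherent_def by simp
  moreover have "multiplicity p (n * p) \<le> multiplicity p (m * n * p)"
    using assms n prime_gt_0_nat[OF p] by (intro dvd_imp_multiplicity_le) auto
  then have "p ^ multiplicity p (n * p) dvd p ^ multiplicity p (m * n * p)"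
    by (rule le_imp_power_dvd)
  ultimately show "icong class_ring (p ^ multiplicity p (n * p))
      (poly_frob p (G (m * n))) (G (m * (n * p)))"
    using comm_rng.icong_dvd[OF comm_rng_class_ring] by (simp add: mult.assoc)
qed


section \<open>Variables of the defining polynomials\<close>

text \<open>
  A Witt vector with truncation set \<open>S\<close> is \<^const>\<open>undefined\<close> outside \<open>S\<close>, which may lie outside
  the ring. The operations are well behaved because their \<open>n\<close>-th polynomial involves only variables with an index in \<open>S\<close>
  when $n \in S$.
\<close>

definition supported :: "(nat + nat) set \<Rightarrow> witt_poly \<Rightarrow> bool" where
  "supported D P \<longleftrightarrow> (\<forall>m\<in>keys P. keys m \<subseteq> D)"

lemma supported_var: "v \<in> D \<Longrightarrow> supported D (var v)"
  by (simp add: supported_def var_def)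

lemma supported_add: "\<lbrakk>supported D P; supported D Q\<rbrakk> \<Longrightarrow> supported D (P + Q)"
  using keys_add[of P Q] by (auto simp: supported_def)

lemma supported_minus: "supported D P \<Longrightarrow> supported D (- P)"
  by (simp add: supported_def)

lemma supported_mult:
  assumes "supported D P" "supported D Q"
  shows "supported D (P * Q)"
  unfolding supported_def
proof
  fix m assume "m \<in> keys (P * Q)"
  then obtain k l where "m = k + l" "k \<in> keys P" "l \<in> keys Q"
    using keys_mult[of P Q] by blast
  then show "keys m \<subseteq> D" using keys_add[of k l] assms unfolding supported_def by blast
qed

lemma supported_of_nat: "supported D (of_nat n)"
proof (induction n)
  case (Suc n)
  have "supported D 1" by (simp add: supported_def)
  then show ?case using Suc supported_add by simp
qed (simp add: supported_def)

lemma supported_power: "supported D P \<Longrightarrow> supported D (P ^ n)"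
  using supported_of_nat[of D 1] by (induction n) (auto intro: supported_mult)

lemma supported_sum: "(\<And>i. i \<in> I \<Longrightarrow> supported D (f i)) \<Longrightarrow> supported D (sum f I)"
  using supported_of_nat[of D 0] by (induction I rule: infinite_finite_induct) (auto intro: supported_add)

text \<open>
  Multiplication by a positive integer does not change the set of monomials that occur. This lets
  supports pass through the divisions in the recursion for \<^const>\<open>with_ghost\<close>.
\<close>

lemma supported_divide:
  assumes "supported D (of_nat n * P)" "n > 0"
  shows "supported D P"
proof -
  have "lookup (of_nat n * P) m = int n * lookup P m" for m
    by (induction n) (simp_all add: distrib_right lookup_add)
  then have "keys (of_nat n * P) = keys P" using assms(2) by (auto simp: in_keys_iff)
  then show ?thesis using assms(1) by (simp add: supported_def)
qed

lemma supported_ghost_poly: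
  "(\<And>d. d dvd n \<Longrightarrow> supported D (s d)) \<Longrightarrow> supported D (ghost_poly s n)"
  unfolding ghost_poly_def by (intro supported_sum supported_mult supported_of_nat supported_power) auto

lemma supported_with_ghost:
  assumes G: "ghost_coherent G" and D: "\<And>m. m > 0 \<Longrightarrow> m dvd n \<Longrightarrow> supported D (G m)"
    and "m > 0" "m dvd n"
  shows "supported D (with_ghost G m)"
  using assms(3,4)
proof (induction m rule: less_induct)
  case (less m)
  let ?s = "with_ghost G"
  let ?r = "\<Sum>d\<in>{d. d dvd m \<and> d \<noteq> m}. of_nat d * ?s d ^ (m div d)"
  have "{d. d dvd m} = insert m {d. d dvd m \<and> d \<noteq> m}" by auto
  then have "ghost_poly ?s m = of_nat m * ?s m + ?r"
    using less.prems finite_divisors[OF less.prems(1), of "\<lambda>d. d \<noteq> m"]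
    unfolding ghost_poly_def by simp
  then have eq: "of_nat m * ?s m = G m + - ?r"
    using ghost_poly_with_ghost[OF G less.prems(1)] by simp
  have "supported D ?r"
  proof (intro supported_sum supported_mult supported_of_nat supported_power)
    fix d assume "d \<in> {d. d dvd m \<and> d \<noteq> m}"
    then have "d dvd m" "d < m" "d > 0"
      using less.prems(1) dvd_imp_le le_neq_implies_less dvd_pos_nat by blast+
    then show "supported D (?s d)" using less.IH less.prems(2) dvd_trans by blast
  qed
  then have "supported D (of_nat m * ?s m)"
    unfolding eq using D less.prems by (intro supported_add supported_minus) auto
  then show ?case using supported_divide less.prems(1) by blast
qed

lemma (in cring) poly_eval_supported_cong:
  assumes "supported D P" "\<And>v. v \<in> D \<Longrightarrow> f v = g v" "\<And>v. v \<in> D \<Longrightarrow> g v \<in> carrier R"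
  shows "poly_eval R f P = poly_eval R g P"
  unfolding poly_eval_def
proof (rule finsum_cong')
  fix m assume "m \<in> keys P"
  then have "keys m \<subseteq> D" using assms(1) by (auto simp: supported_def)
  then show "[lookup P m] \<cdot> monomial_eval f m = [lookup P m] \<cdot> monomial_eval g m"
    using assms by (intro arg_cong[of _ _ "\<lambda>x. [lookup P m] \<cdot> x"] finprod_cong') auto
next
  show "(\<lambda>m. [lookup P m] \<cdot> monomial_eval g m) \<in> keys P \<rightarrow> carrier R"
  proof (rule Pi_I)
    fix m assume "m \<in> keys P"
    then have "keys m \<subseteq> D" using assms(1) by (auto simp: supported_def)
    then show "[lookup P m] \<cdot> monomial_eval g m \<in> carrier R"
      using assms by (intro add.int_pow_closed finprod_closed) auto
  qed
qed simp


section \<open>Ghost components of the Witt vector operations\<close>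

lemma div_dvd_self: "d dvd n \<Longrightarrow> n div d dvd (n::nat)"
  by (metis dvd_div_mult_self dvd_triv_left)

lemma unitization_simps [simp]:
  "carrier (unitization R) = UNIV \<times> carrier R"
  "(m, x) \<otimes>\<^bsub>unitization R\<^esub> (n, y)
    = (m * n, ([m] \<cdot>\<^bsub>R\<^esub> y \<oplus>\<^bsub>R\<^esub> [n] \<cdot>\<^bsub>R\<^esub> x) \<oplus>\<^bsub>R\<^esub> (x \<otimes>\<^bsub>R\<^esub> y))"
  "\<one>\<^bsub>unitization R\<^esub> = (1, \<zero>\<^bsub>R\<^esub>)"
  "\<zero>\<^bsub>unitization R\<^esub> = (0, \<zero>\<^bsub>R\<^esub>)"
  "(m, x) \<oplus>\<^bsub>unitization R\<^esub> (n, y) = (m + n, x \<oplus>\<^bsub>R\<^esub> y)"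
  by (simp_all add: unitization_def)

context comm_rng
begin

lemma l_minus: "\<lbrakk>x \<in> carrier R; y \<in> carrier R\<rbrakk> \<Longrightarrow> (\<ominus> x) \<otimes> y = \<ominus> (x \<otimes> y)"
  by (rule minus_equality[symmetric]) (simp_all add: m_closed l_null flip: l_distr add: l_neg)

lemma add_pow_int_ldistr:
  "\<lbrakk>x \<in> carrier R; y \<in> carrier R\<rbrakk> \<Longrightarrow> ([(k::int)] \<cdot> x) \<otimes> y = [k] \<cdot> (x \<otimes> y)"
  by (cases "k \<ge> 0")
    (simp_all add: add_pow_int_ge add_pow_int_lt add_pow_ldistr l_minus)

lemma add_pow_int_rdistr:
  "\<lbrakk>x \<in> carrier R; y \<in> carrier R\<rbrakk> \<Longrightarrow> x \<otimes> ([(k::int)] \<cdot> y) = [k] \<cdot> (x \<otimes> y)"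
  by (simp add: m_comm[of x] add_pow_int_ldistr)

lemma add_pow_int_0: "[(0::int)] \<cdot> x = \<zero>"
  by (simp add: add_pow_int_ge)

lemma cring_unitization: "cring (unitization R)" (is "cring ?U")
proof (rule cringI)
  show "abelian_group ?U"
  proof (rule abelian_groupI)
    fix a assume "a \<in> carrier ?U"
    then show "\<exists>b\<in>carrier ?U. b \<oplus>\<^bsub>?U\<^esub> a = \<zero>\<^bsub>?U\<^esub>"
      by (intro bexI[of _ "(- fst a, \<ominus> snd a)"]) (auto simp: l_neg)
  qed (auto simp: a_ac)
  show "Group.comm_monoid ?U"
  proof (rule comm_monoidI)
    fix a b c
    assume "a \<in> carrier ?U" "b \<in> carrier ?U" "c \<in> carrier ?U"
    then obtain m x n y k z where "a = (m, x)" "b = (n, y)" "c = (k, z)"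
      "x \<in> carrier R" "y \<in> carrier R" "z \<in> carrier R"
      by (metis SigmaE unitization_simps(1))
    then show "a \<otimes>\<^bsub>?U\<^esub> b \<otimes>\<^bsub>?U\<^esub> c
        = a \<otimes>\<^bsub>?U\<^esub> (b \<otimes>\<^bsub>?U\<^esub> c)"
      by (simp add: m_closed l_distr r_distr add_pow_int_ldistr add_pow_int_rdistr
          add.int_pow_distrib add.int_pow_pow m_assoc a_ac mult_ac)
  next
    fix a b assume "a \<in> carrier ?U" "b \<in> carrier ?U"
    then show "a \<otimes>\<^bsub>?U\<^esub> b = b \<otimes>\<^bsub>?U\<^esub> a"
      by (auto simp: m_comm a_ac)
  qed (auto simp: m_closed l_null add_pow_int_0)
next
  fix a b c
  assume "a \<in> carrier ?U" "b \<in> carrier ?U" "c \<in> carrier ?U"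
  then obtain m x n y k z where "a = (m, x)" "b = (n, y)" "c = (k, z)"
    "x \<in> carrier R" "y \<in> carrier R" "z \<in> carrier R"
    by (metis SigmaE unitization_simps(1))
  then show "(a \<oplus>\<^bsub>?U\<^esub> b) \<otimes>\<^bsub>?U\<^esub> c
      = a \<otimes>\<^bsub>?U\<^esub> c \<oplus>\<^bsub>?U\<^esub> b \<otimes>\<^bsub>?U\<^esub> c"
    by (simp add: m_closed l_distr add.int_pow_distrib add.int_pow_mult a_ac distrib_right
        flip: add.int_pow_mult)
qed

abbreviation ideal_eval :: "(nat + nat \<Rightarrow> 'a) \<Rightarrow> witt_poly \<Rightarrow> int \<times> 'a" where
  "ideal_eval f \<equiv> poly_eval (unitization R) (\<lambda>v. (0, f v))"

lemma unitization_embedding: "rng_homo R (unitization R) (\<lambda>x. (0, x))"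
  using cring_comm_rng[OF cring_unitization]
  by (auto simp: rng_homo_def rng_homo_axioms_def rng_hom_def comm_rng_axioms
      add_pow_int_0 m_closed)

lemma unitization_projection: "rng_homo (unitization R) (class_ring :: int ring) fst"
  using cring_comm_rng[OF cring_unitization]
  by (auto simp: rng_homo_def rng_homo_axioms_def rng_hom_def comm_rng_class_ring)

text \<open>
  The polynomials with prescribed ghost components \<open>G\<close> take values in the ideal
  $0 \oplus R$ of the unitization if the \<open>G\<close> do: the projection to \<open>\<int>\<close> sends the sequence
  to a Witt vector over \<open>\<int>\<close> with ghost components zero. Then the ghost components of
  the values are the values of the ghost components.
\<close>

lemma ghost_comp_poly_eval:
  assumes f: "\<And>v. f v \<in> carrier R" and G: "ghost_coherent G" and n: "n > 0"
    and r: "\<And>m. m dvd n \<Longrightarrow> r m \<in> carrier R"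
    and Gr: "\<And>m. m dvd n \<Longrightarrow> ideal_eval f (G m) = (0, r m)"
  shows "ghost_comp R (\<lambda>d. eval_poly R f (with_ghost G d)) n = r n"
proof -
  let ?U = "unitization R"
  let ?s = "with_ghost G" and ?e = "\<lambda>d. eval_poly R f (with_ghost G d)"
  interpret U: cring ?U by (rule cring_unitization)
  interpret Ur: comm_rng ?U by (rule cring_comm_rng[OF cring_unitization])
  interpret Z: comm_rng "class_ring :: int ring" by (rule comm_rng_class_ring)
  have fU: "(0, f v) \<in> carrier ?U" for v using f by simp
  interpret ev: rng_homo class_ring ?U "ideal_eval f" by (rule poly_eval_rng_hom[OF U.cring_axioms fU])
  interpret pr: rng_homo ?U "class_ring :: int ring" fst by (rule unitization_projection)
  interpret emb: rng_homo R ?U "\<lambda>x. (0, x)" by (rule unitization_embedding)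
  have m0: "m > 0" if "m dvd n" for m using that n dvd_pos_nat by blast
  have gh: "ideal_eval f (G m) = ghost_comp ?U (\<lambda>d. ideal_eval f (?s d)) m" if "m dvd n" for m
  proof -
    have "G m = ghost_comp class_ring ?s m"
      using m0[OF that] G by (simp add: ghost_poly_with_ghost flip: ghost_poly_eq_ghost_comp)
    then show ?thesis using ev.hom_ghost_comp[OF m0[OF that], of ?s] by simp
  qed
  have fst0: "fst (ideal_eval f (?s m)) = 0" if "m dvd n" for m
  proof (rule Z.ghost_comp_inj[where b = "\<lambda>_. 0" and S = "{m. m dvd n}" and a = "\<lambda>d. fst (ideal_eval f (?s d))"])
    show "divisor_stable {m. m dvd n}"
      using n unfolding divisor_stable_def by (auto intro: dvd_trans)
    show "no_torsion {m. m dvd n} (class_ring :: int ring)"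
      using m0 by (auto simp: no_torsion_def inj_on_def)
    fix m assume "m \<in> {m. m dvd n}"
    then have m: "m dvd n" by simp
    have "ghost_comp class_ring (\<lambda>d. fst (ideal_eval f (?s d))) m = fst (ideal_eval f (G m))"
      using pr.hom_ghost_comp[OF m0[OF m], of "\<lambda>d. ideal_eval f (?s d)"] gh[OF m] ev.hom_closed by simp
    also have "\<dots> = fst (\<zero>\<^bsub>?U\<^esub>)" using Gr m by simp
    also have "\<dots> = ghost_comp class_ring (\<lambda>_. 0) m"
      using m0[OF m] by (auto simp: ghost_comp_def class_ring_finsum div_divisor_pos zero_power intro!: sum.neutral)
    finally show "ghost_comp class_ring (\<lambda>d. fst (ideal_eval f (?s d))) m
        = ghost_comp class_ring (\<lambda>_. 0) m" .
  qed (use that in auto)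
  have ev_e: "ideal_eval f (?s m) = (0, ?e m)" if "m dvd n" for m
    using fst0[OF that] by (simp add: eval_poly_eq_poly_eval prod_eq_iff)
  have e: "?e m \<in> carrier R" for m
    using ev.hom_closed[of "?s m"] by (auto simp: eval_poly_eq_poly_eval)
  have "(0, r n) = ghost_comp ?U (\<lambda>d. ideal_eval f (?s d)) n" using Gr gh by simp
  also have "\<dots> = ghost_comp ?U (\<lambda>d. (0, ?e d)) n"
    by (rule Ur.ghost_comp_cong) (use n ev_e e in auto)
  also have "\<dots> = (0, ghost_comp R ?e n)"
    using emb.hom_ghost_comp[OF n, of ?e] e by simp
  finally show ?thesis by simp
qed

lemma poly_eval_ghost_poly_var:
  assumes f: "\<And>v. f v \<in> carrier R" and "n > 0"
  shows "ideal_eval f (ghost_poly (var \<circ> c) n)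
    = (0, ghost_comp R (\<lambda>d. f (c d)) n)"
proof -
  let ?U = "unitization R"
  interpret U: cring ?U by (rule cring_unitization)
  have fU: "(0, f v) \<in> carrier ?U" for v using f by simp
  interpret ev: rng_homo class_ring ?U "ideal_eval f" by (rule poly_eval_rng_hom[OF U.cring_axioms fU])
  interpret emb: rng_homo R ?U "\<lambda>x. (0, x)" by (rule unitization_embedding)
  have "ideal_eval f (ghost_poly (var \<circ> c) n) = ghost_comp ?U (\<lambda>d. ideal_eval f (var (c d))) n"
    using ev.hom_ghost_comp[OF assms(2), of "var \<circ> c"] assms(2)
    by (simp add: ghost_poly_eq_ghost_comp)
  also have "(\<lambda>d. ideal_eval f (var (c d))) = (\<lambda>d. (0, f (c d)))"
    using U.poly_eval_var[of "\<lambda>v. (0, f v)"] f by simp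
  also have "ghost_comp ?U (\<lambda>d. (0, f (c d))) n = (0, ghost_comp R (\<lambda>d. f (c d)) n)"
    using emb.hom_ghost_comp[OF assms(2), of "\<lambda>d. f (c d)"] f by simp
  finally show ?thesis .
qed

lemma eval_poly_closed:
  assumes "supported D P" "\<And>v. v \<in> D \<Longrightarrow> f v \<in> carrier R"
  shows "eval_poly R f P \<in> carrier R"
    and "eval_poly R f P = eval_poly R (\<lambda>v. if v \<in> D then f v else \<zero>) P"
proof -
  interpret U: cring "unitization R" by (rule cring_unitization)
  let ?f = "\<lambda>v. if v \<in> D then f v else \<zero>"
  show eq: "eval_poly R f P = eval_poly R ?f P"
    unfolding eval_poly_eq_poly_eval
    using U.poly_eval_supported_cong[OF assms(1), of "\<lambda>v. (0, f v)" "\<lambda>v. (0, ?f v)"] assms(2)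
    by simp
  have "ideal_eval ?f P \<in> carrier (unitization R)"
    using assms(2) by (intro U.poly_eval_closed) auto
  then show "eval_poly R f P \<in> carrier R"
    unfolding eq by (auto simp: eval_poly_eq_poly_eval)
qed

text \<open>
  The values of the variables outside \<open>D\<close> may lie outside the ring, like the values of a Witt vector
  outside its truncation set. Replacing them by zero does not change the result.
\<close>

lemma ghost_comp_eval_poly:
  assumes G: "ghost_coherent G" and n: "n > 0"
    and D: "\<And>m. m dvd n \<Longrightarrow> supported D (G m)" "\<And>v. v \<in> D \<Longrightarrow> f v \<in> carrier R"
    and r: "\<And>m. m dvd n \<Longrightarrow> r m \<in> carrier R"
    and Gr: "\<And>m. m dvd n \<Longrightarrow>
      ideal_eval (\<lambda>v. if v \<in> D then f v else \<zero>) (G m) = (0, r m)"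
  shows "ghost_comp R (\<lambda>d. eval_poly R f (with_ghost G d)) n = r n"
    and "eval_poly R f (with_ghost G n) \<in> carrier R"
proof -
  let ?f = "\<lambda>v. if v \<in> D then f v else \<zero>"
  have s: "supported D (with_ghost G m)" if "m dvd n" for m
    by (rule supported_with_ghost[OF G _ dvd_pos_nat[OF n that] that]) (rule D(1))
  have "ghost_comp R (\<lambda>d. eval_poly R f (with_ghost G d)) n
      = ghost_comp R (\<lambda>d. eval_poly R ?f (with_ghost G d)) n"
  proof (rule ghost_comp_cong[OF n])
    fix d assume d: "d dvd n"
    show eq: "eval_poly R f (with_ghost G d) = eval_poly R ?f (with_ghost G d)"
      by (rule eval_poly_closed(2)[OF s[OF d]]) (rule D(2))
    have "eval_poly R f (with_ghost G d) \<in> carrier R"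
      by (rule eval_poly_closed(1)[OF s[OF d]]) (rule D(2))
    then show "eval_poly R ?f (with_ghost G d) \<in> carrier R" unfolding eq .
  qed
  also have "\<dots> = r n"
  proof (rule ghost_comp_poly_eval[OF _ G n])
    show "?f v \<in> carrier R" for v using D(2) by simp
  qed (fact r Gr)+
  finally show "ghost_comp R (\<lambda>d. eval_poly R f (with_ghost G d)) n = r n" .
  show "eval_poly R f (with_ghost G n) \<in> carrier R"
    by (rule eval_poly_closed(1)[OF s]) (use D(2) in simp_all)
qed

text \<open>
  The operation \<open>F\<close> on the ring is what the sequence of polynomials \<open>G\<close> becomes on ghost
  components: sum, product or difference.
\<close>

lemma ghost_comp_binary_poly:
  assumes S: "divisor_stable S" and a: "a \<in> S \<rightarrow>\<^sub>E carrier R" and b: "b \<in> S \<rightarrow>\<^sub>E carrier R"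
    and G: "ghost_coherent G"
    and supp: "\<And>n D. (\<And>d. d dvd n \<Longrightarrow> Inl d \<in> D \<and> Inr d \<in> D) \<Longrightarrow> supported D (G n)"
    and F: "\<And>x y. \<lbrakk>x \<in> carrier R; y \<in> carrier R\<rbrakk> \<Longrightarrow> F x y \<in> carrier R"
    and GF: "\<And>f n. \<lbrakk>\<And>v. f v \<in> carrier R; n > 0\<rbrakk> \<Longrightarrow>
      ideal_eval f (G n)
        = (0, F (ghost_comp R (\<lambda>d. f (Inl d)) n) (ghost_comp R (\<lambda>d. f (Inr d)) n))"
    and n: "n \<in> S"
  shows "ghost_comp R (\<lambda>n\<in>S. eval_poly R (case_sum a b) (with_ghost G n)) n
      = F (ghost_comp R a n) (ghost_comp R b n)"
    and "eval_poly R (case_sum a b) (with_ghost G n) \<in> carrier R"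
proof -
  let ?D = "Inl ` {d. d dvd n} \<union> Inr ` {d. d dvd n}"
  let ?f = "\<lambda>v. if v \<in> ?D then case_sum a b v else \<zero>"
  have dS: "d \<in> S" if "d dvd n" for d using S n that by (auto simp: divisor_stable_def)
  have n0: "n > 0" using S n unfolding divisor_stable_def by (metis gr0I)
  have ac: "a d \<in> carrier R" "b d \<in> carrier R" if "d dvd n" for d
    using a b dS[OF that] by auto
  have f: "?f v \<in> carrier R" for v using ac by auto
  have gh: "ghost_comp R (\<lambda>d. ?f (Inl d)) m = ghost_comp R a m"
      "ghost_comp R (\<lambda>d. ?f (Inr d)) m = ghost_comp R b m" if "m dvd n" for m
    using that n0 ac by (auto intro!: ghost_comp_cong intro: dvd_trans dvd_pos_nat)
  have pe: "ideal_eval ?f (G m)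
      = (0, F (ghost_comp R a m) (ghost_comp R b m))" if "m dvd n" for m
    using GF[OF f, of m] gh[OF that] that n0 dvd_pos_nat by simp
  have r: "F (ghost_comp R a m) (ghost_comp R b m) \<in> carrier R" if "m dvd n" for m
    using that ac n0 by (intro F ghost_comp_closed) (auto intro: dvd_trans dvd_pos_nat)
  have sup: "supported ?D (G m)" if "m dvd n" for m
    using that by (intro supp) (auto intro: dvd_trans)
  have fc: "case_sum a b v \<in> carrier R" if "v \<in> ?D" for v using f[of v] that by simp
  note main = ghost_comp_eval_poly[OF G n0, of ?D "case_sum a b"
      "\<lambda>m. F (ghost_comp R a m) (ghost_comp R b m)", OF sup fc r pe]
  show "eval_poly R (case_sum a b) (with_ghost G n) \<in> carrier R" by (rule main(2))
  have "ghost_comp R (\<lambda>n\<in>S. eval_poly R (case_sum a b) (with_ghost G n)) n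
      = ghost_comp R (\<lambda>d. eval_poly R (case_sum a b) (with_ghost G d)) n"
  proof (rule ghost_comp_cong[OF n0])
    fix d assume d: "d dvd n"
    show "(\<lambda>n\<in>S. eval_poly R (case_sum a b) (with_ghost G n)) d
        = eval_poly R (case_sum a b) (with_ghost G d)" using dS[OF d] by simp
    show "eval_poly R (case_sum a b) (with_ghost G d) \<in> carrier R"
      by (rule eval_poly_closed(1)[OF supported_with_ghost[OF G sup dvd_pos_nat[OF n0 d] d]])
        (assumption | rule fc)+
  qed
  also have "\<dots> = F (ghost_comp R a n) (ghost_comp R b n)" by (rule main(1))
  finally show "ghost_comp R (\<lambda>n\<in>S. eval_poly R (case_sum a b) (with_ghost G n)) n
      = F (ghost_comp R a n) (ghost_comp R b n)" .
qed

end

lemma supported_ghost_poly_var: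
  "(\<And>d. d dvd n \<Longrightarrow> c d \<in> D) \<Longrightarrow> supported D (ghost_poly (var \<circ> c) n)"
  by (rule supported_ghost_poly) (simp add: supported_var)

context comm_rng
begin

lemma witt_comp_closed:
  "\<lbrakk>divisor_stable S; a \<in> S \<rightarrow>\<^sub>E carrier R; n \<in> S; d dvd n\<rbrakk> \<Longrightarrow> a d \<in> carrier R"
  by (auto simp: divisor_stable_def)

lemma ghost_comp_witt_closed:
  assumes "divisor_stable S" "a \<in> S \<rightarrow>\<^sub>E carrier R" "n \<in> S"
  shows "ghost_comp R a n \<in> carrier R"
proof (rule ghost_comp_closed)
  show "n > 0" using assms unfolding divisor_stable_def by (auto intro: gr0I)
qed (rule witt_comp_closed[OF assms])

context
  fixes S a b
  assumes S: "divisor_stable S" and a: "a \<in> S \<rightarrow>\<^sub>E carrier R" and b: "b \<in> S \<rightarrow>\<^sub>E carrier R"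
begin

private lemma eval_homo:
  assumes f: "\<And>v. f v \<in> carrier R"
  shows "rng_homo class_ring (unitization R) (ideal_eval f)"
  by (rule poly_eval_rng_hom[OF cring_unitization]) (simp add: f)

lemma witt_add:
  shows "a \<oplus>\<^bsub>witt_ring R S\<^esub> b \<in> S \<rightarrow>\<^sub>E carrier R"
    and "n \<in> S \<Longrightarrow> ghost_comp R (a \<oplus>\<^bsub>witt_ring R S\<^esub> b) n = ghost_comp R a n \<oplus> ghost_comp R b n"
proof -
  let ?G = "\<lambda>n. ghost_poly (var \<circ> Inl) n + ghost_poly (var \<circ> Inr) n"
  have G: "ghost_coherent ?G" by (intro ghost_coherent_add ghost_coherent_var)
  have pe: "ideal_eval f (?G n)
      = (0, ghost_comp R (\<lambda>d. f (Inl d)) n \<oplus> ghost_comp R (\<lambda>d. f (Inr d)) n)"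
    if f: "\<And>v. f v \<in> carrier R" and "n > 0" for f n
  proof -
    interpret E: rng_homo class_ring "unitization R" "ideal_eval f"
      by (rule eval_homo) (rule f)
    show ?thesis
      using E.hom_add[of "ghost_poly (var \<circ> Inl) n" "ghost_poly (var \<circ> Inr) n"]
      by (simp add: poly_eval_ghost_poly_var f \<open>n > 0\<close>)
  qed
  have supp: "supported D (?G n)" if "\<And>d. d dvd n \<Longrightarrow> Inl d \<in> D \<and> Inr d \<in> D" for n D
    using that by (intro supported_add supported_ghost_poly_var) auto
  have main: "ghost_comp R (\<lambda>n\<in>S. eval_poly R (case_sum a b) (with_ghost ?G n)) n
      = ghost_comp R a n \<oplus> ghost_comp R b n"
    "eval_poly R (case_sum a b) (with_ghost ?G n) \<in> carrier R" if "n \<in> S" for n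
    by (rule ghost_comp_binary_poly[where F = "\<lambda>x y. x \<oplus> y", OF S a b G];
      simp add: supp pe m_closed that)+
  show "a \<oplus>\<^bsub>witt_ring R S\<^esub> b \<in> S \<rightarrow>\<^sub>E carrier R"
    unfolding witt_ring_def add_poly_def
    using main(2) by auto
  show "ghost_comp R (a \<oplus>\<^bsub>witt_ring R S\<^esub> b) n = ghost_comp R a n \<oplus> ghost_comp R b n" if "n \<in> S"
    unfolding witt_ring_def add_poly_def
    using main(1)[OF that] by simp
qed

lemma witt_mult:
  shows "a \<otimes>\<^bsub>witt_ring R S\<^esub> b \<in> S \<rightarrow>\<^sub>E carrier R"
    and "n \<in> S \<Longrightarrow> ghost_comp R (a \<otimes>\<^bsub>witt_ring R S\<^esub> b) n = ghost_comp R a n \<otimes> ghost_comp R b n"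
proof -
  let ?G = "\<lambda>n. ghost_poly (var \<circ> Inl) n * ghost_poly (var \<circ> Inr) n"
  have G: "ghost_coherent ?G" by (intro ghost_coherent_mult ghost_coherent_var)
  have pe: "ideal_eval f (?G n)
      = (0, ghost_comp R (\<lambda>d. f (Inl d)) n \<otimes> ghost_comp R (\<lambda>d. f (Inr d)) n)"
    if f: "\<And>v. f v \<in> carrier R" and "n > 0" for f n
  proof -
    interpret E: rng_homo class_ring "unitization R" "ideal_eval f"
      by (rule eval_homo) (rule f)
    show ?thesis
      using E.hom_mult[of "ghost_poly (var \<circ> Inl) n" "ghost_poly (var \<circ> Inr) n"]
      by (simp add: poly_eval_ghost_poly_var f \<open>n > 0\<close> add_pow_int_0 m_closed ghost_comp_closed)
  qed
  have supp: "supported D (?G n)" if "\<And>d. d dvd n \<Longrightarrow> Inl d \<in> D \<and> Inr d \<in> D" for n D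
    using that by (intro supported_mult supported_ghost_poly_var) auto
  have main: "ghost_comp R (\<lambda>n\<in>S. eval_poly R (case_sum a b) (with_ghost ?G n)) n
      = ghost_comp R a n \<otimes> ghost_comp R b n"
    "eval_poly R (case_sum a b) (with_ghost ?G n) \<in> carrier R" if "n \<in> S" for n
    by (rule ghost_comp_binary_poly[where F = "\<lambda>x y. x \<otimes> y", OF S a b G];
      simp add: supp pe m_closed that)+
  show "a \<otimes>\<^bsub>witt_ring R S\<^esub> b \<in> S \<rightarrow>\<^sub>E carrier R"
    unfolding witt_ring_def mult_poly_def
    using main(2) by auto
  show "ghost_comp R (a \<otimes>\<^bsub>witt_ring R S\<^esub> b) n = ghost_comp R a n \<otimes> ghost_comp R b n" if "n \<in> S"
    unfolding witt_ring_def mult_poly_def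
    using main(1)[OF that] by simp
qed

text \<open>
  The difference of two Witt vectors, obtained before Witt vectors are known to form a group. The
  correction term in the proof of surjectivity of the ghost map is such a difference.
\<close>

lemma witt_diff_exists:
  "\<exists>c\<in>S \<rightarrow>\<^sub>E carrier R. \<forall>n\<in>S. ghost_comp R c n = ghost_comp R a n \<ominus> ghost_comp R b n"
proof -
  let ?G = "\<lambda>n. ghost_poly (var \<circ> Inl) n + - ghost_poly (var \<circ> Inr) n"
  have G: "ghost_coherent ?G"
    by (intro ghost_coherent_add ghost_coherent_minus ghost_coherent_var)
  have pe: "ideal_eval f (?G n)
      = (0, ghost_comp R (\<lambda>d. f (Inl d)) n \<ominus> ghost_comp R (\<lambda>d. f (Inr d)) n)"
    if f: "\<And>v. f v \<in> carrier R" and n: "n > 0" for f n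
  proof -
    interpret E: rng_homo class_ring "unitization R" "ideal_eval f"
      by (rule eval_homo) (rule f)
    interpret I: rng_homo R "unitization R" "\<lambda>x. (0, x)" by (rule unitization_embedding)
    have neg: "\<ominus>\<^bsub>class_ring\<^esub> x = - x" for x :: witt_poly
      by (rule class_ring.minus_equality) simp_all
    have "ideal_eval f (- ghost_poly (var \<circ> Inr) n)
        = \<ominus>\<^bsub>unitization R\<^esub> (0, ghost_comp R (\<lambda>d. f (Inr d)) n)"
      using E.hom_neg[of "ghost_poly (var \<circ> Inr) n"]
      by (simp add: poly_eval_ghost_poly_var f n neg)
    also have "\<dots> = (0, \<ominus> ghost_comp R (\<lambda>d. f (Inr d)) n)"
      using I.hom_neg[of "ghost_comp R (\<lambda>d. f (Inr d)) n"] by (simp add: ghost_comp_closed f n)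
    finally show ?thesis
      using E.hom_add[of "ghost_poly (var \<circ> Inl) n" "- ghost_poly (var \<circ> Inr) n"]
      by (simp add: poly_eval_ghost_poly_var f n a_minus_def)
  qed
  have supp: "supported D (?G n)" if "\<And>d. d dvd n \<Longrightarrow> Inl d \<in> D \<and> Inr d \<in> D" for n D
    using that by (intro supported_add supported_minus supported_ghost_poly_var) auto
  have main: "ghost_comp R (\<lambda>n\<in>S. eval_poly R (case_sum a b) (with_ghost ?G n)) n
      = ghost_comp R a n \<ominus> ghost_comp R b n"
    "eval_poly R (case_sum a b) (with_ghost ?G n) \<in> carrier R" if "n \<in> S" for n
    by (rule ghost_comp_binary_poly[where F = "\<lambda>x y. x \<ominus> y", OF S a b G];
      simp add: supp pe m_closed that del: add_uminus_conv_diff)+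
  let ?c = "\<lambda>n\<in>S. eval_poly R (case_sum a b) (with_ghost ?G n)"
  have "?c \<in> S \<rightarrow>\<^sub>E carrier R"
    using main(2) by (auto simp del: add_uminus_conv_diff)
  moreover have "ghost_comp R ?c n = ghost_comp R a n \<ominus> ghost_comp R b n" if "n \<in> S" for n
    by (rule main(1)[OF that])
  ultimately show ?thesis by blast
qed

end

lemma witt_frob_closed_ghost:
  assumes S: "divisor_stable S" and a: "a \<in> S \<rightarrow>\<^sub>E carrier R" and m: "m > 0"
  shows "witt_frob R m S a \<in> quot S m \<rightarrow>\<^sub>E carrier R"
    and "n \<in> quot S m \<Longrightarrow> ghost_comp R (witt_frob R m S a) n = ghost_comp R a (m * n)"
proof -
  let ?G = "\<lambda>n. ghost_poly (var \<circ> Inl) (m * n)"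
  have G: "ghost_coherent ?G" by (intro ghost_coherent_shift ghost_coherent_var m)
  have main: "ghost_comp R (\<lambda>d. eval_poly R (case_sum a a) (with_ghost ?G d)) n
      = ghost_comp R a (m * n) \<and> eval_poly R (case_sum a a) (with_ghost ?G n) \<in> carrier R"
    if n: "n \<in> quot S m" for n
  proof -
    have mn: "m * n \<in> S" using n by (simp add: quot_def mult.commute)
    have n0: "n > 0" using S n unfolding divisor_stable_def quot_def by (auto intro: gr0I)
    let ?D = "Inl ` {d. d dvd m * n}"
    let ?f = "\<lambda>v. if v \<in> ?D then case_sum a a v else \<zero>"
    have ac: "a d \<in> carrier R" if "d dvd m * n" for d
      by (rule witt_comp_closed[OF S a mn that])
    have f: "?f v \<in> carrier R" for v using ac by auto
    have fc: "case_sum a a v \<in> carrier R" if "v \<in> ?D" for v using f[of v] that by simp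
    have r: "ghost_comp R a (m * k) \<in> carrier R" if "k dvd n" for k
      using that m n0 ac
      by (intro ghost_comp_closed) (auto intro: dvd_pos_nat dvd_trans[OF _ mult_dvd_mono[OF dvd_refl]])
    have sup: "supported ?D (?G k)" if "k dvd n" for k
      using that by (intro supported_ghost_poly_var)
        (auto intro: dvd_trans[OF _ mult_dvd_mono[OF dvd_refl]])
    have pe: "ideal_eval ?f (?G k) = (0, ghost_comp R a (m * k))"
      if k: "k dvd n" for k
    proof -
      have mk: "m * k > 0" using m n0 k dvd_pos_nat by simp
      have dm: "d dvd m * n" if "d dvd m * k" for d
        using dvd_trans[OF that mult_dvd_mono[OF dvd_refl k]] .
      have "ghost_comp R (\<lambda>d. ?f (Inl d)) (m * k) = ghost_comp R a (m * k)"
        by (rule ghost_comp_cong[OF mk]) (use dm ac in auto)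
      then show ?thesis using poly_eval_ghost_poly_var[of ?f "m * k" Inl, OF _ mk] f by simp
    qed
    show ?thesis
      using ghost_comp_eval_poly[OF G n0, of ?D "case_sum a a" "\<lambda>k. ghost_comp R a (m * k)",
          OF sup fc r pe] by simp
  qed
  show closed: "witt_frob R m S a \<in> quot S m \<rightarrow>\<^sub>E carrier R"
    using main by (auto simp: witt_frob_def frob_poly_def)
  assume n: "n \<in> quot S m"
  have n0: "n > 0" using S n unfolding divisor_stable_def quot_def by (auto intro: gr0I)
  have dq: "d \<in> quot S m" if "d dvd n" for d
    using S n that mult_dvd_mono[OF that dvd_refl[of m]]
    unfolding divisor_stable_def quot_def by blast
  have "ghost_comp R (witt_frob R m S a) n
      = ghost_comp R (\<lambda>d. eval_poly R (case_sum a a) (with_ghost ?G d)) n"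
  proof (rule ghost_comp_cong[OF n0])
    fix d assume "d dvd n"
    then show "witt_frob R m S a d = eval_poly R (case_sum a a) (with_ghost ?G d)"
      "eval_poly R (case_sum a a) (with_ghost ?G d) \<in> carrier R"
      using dq main by (simp_all add: witt_frob_def frob_poly_def)
  qed
  then show "ghost_comp R (witt_frob R m S a) n = ghost_comp R a (m * n)" using main[OF n] by simp
qed

lemma witt_ver_closed:
  assumes "a \<in> quot S p \<rightarrow>\<^sub>E carrier R" "divisor_stable S"
  shows "witt_ver R p S a \<in> S \<rightarrow>\<^sub>E carrier R"
proof -
  have "n div p \<in> quot S p" if "n \<in> S" "p dvd n" for n
    using that assms(2) unfolding quot_def divisor_stable_def
    by (auto intro: div_dvd_self simp: dvd_div_mult_self)
  then show ?thesis
    using PiE_mem[OF assms(1)] unfolding witt_ver_def by (intro restrict_PiE_iff[THEN iffD2]) auto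
qed

lemma ghost_comp_witt_ver:
  assumes S: "divisor_stable S" and a: "a \<in> quot S p \<rightarrow>\<^sub>E carrier R"
    and p: "p > 0" and n: "n \<in> S"
  shows "ghost_comp R (witt_ver R p S a) n
    = (if p dvd n then [p] \<cdot> ghost_comp R a (n div p) else \<zero>)"
proof -
  have n0: "n > 0" using S n unfolding divisor_stable_def by (auto intro: gr0I)
  have dS: "d \<in> S" if "d dvd n" for d using S n that by (auto simp: divisor_stable_def)
  have ac: "a (d div p) \<in> carrier R" if "d dvd n" "p dvd d" for d
  proof -
    have "d div p \<in> S"
      using S dS[OF that(1)] div_dvd_self[OF that(2)] unfolding divisor_stable_def by blast
    then have "d div p \<in> quot S p"
      using dS[OF that(1)] that(2) by (simp add: quot_def)
    then show ?thesis using a by auto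
  qed
  have "ghost_comp R (witt_ver R p S a) n
      = ghost_comp R (\<lambda>d. if p dvd d then a (d div p) else \<zero>) n"
    by (rule ghost_comp_cong[OF n0]) (use dS ac in \<open>auto simp: witt_ver_def\<close>)
  then show ?thesis using ghost_comp_verschiebung[of p n a] p n0 ac by simp
qed

lemma ghost_comp_witt_zero:
  assumes "divisor_stable S" "n \<in> S"
  shows "ghost_comp R \<zero>\<^bsub>witt_ring R S\<^esub> n = \<zero>"
proof -
  have n0: "n > 0" using assms unfolding divisor_stable_def by (auto intro: gr0I)
  have "ghost_comp R \<zero>\<^bsub>witt_ring R S\<^esub> n = (\<Oplus>d\<in>{d. d dvd n}. \<zero>)"
    unfolding ghost_comp_def witt_ring_def using assms n0
    by (intro finsum_cong') (auto simp: divisor_stable_def rpow_zero div_divisor_pos)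
  then show ?thesis by simp
qed

end

lemma rpow_eq_nat_pow: "monoid R \<Longrightarrow> x \<in> carrier R \<Longrightarrow> rpow R x n = x [^]\<^bsub>R\<^esub> n"
proof (induction n)
  case (Suc n)
  then show ?case by (cases "n = 0") (simp_all add: rpow_Suc monoid.l_one)
qed simp

lemma (in cring) ghost_comp_witt_one:
  assumes "divisor_stable S" "n \<in> S"
  shows "ghost_comp R \<one>\<^bsub>witt_ring R S\<^esub> n = \<one>"
proof -
  interpret rng: comm_rng R by (rule cring_comm_rng[OF cring_axioms])
  have n0: "n > 0" using assms unfolding divisor_stable_def by (auto intro: gr0I)
  let ?one = "\<one>\<^bsub>witt_ring R S\<^esub>"
  have trm: "[i] \<cdot> rpow R (?one i) (n div i) = (if i = 1 then \<one> else \<zero>)" if "i dvd n" for i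
  proof -
    have "i \<in> S" using assms that by (auto simp: divisor_stable_def)
    then show ?thesis
      using that n0 rng.rpow_zero[OF div_divisor_pos[OF that n0]]
      by (simp add: witt_ring_def rpow_eq_nat_pow[of R \<one>] monoid_axioms)
  qed
  have "ghost_comp R ?one n = (\<Oplus>i\<in>{1::nat}. \<one>)"
    unfolding ghost_comp_def using n0 trm[of 1]
    by (intro add.finprod_mono_neutral_cong_right) (auto simp: trm simp del: One_nat_def)
  also have "\<dots> = \<one>" by simp
  finally show ?thesis .
qed


section \<open>Truncation sets\<close>

lemma dstable_pos: "\<lbrakk>S \<preceq> T; n \<in> S\<rbrakk> \<Longrightarrow> n > 0"
  unfolding dstable_subset_def divisor_stable_def by (auto intro: gr0I)

lemma dstable_dvd: "\<lbrakk>S \<preceq> T; n \<in> S; d dvd n\<rbrakk> \<Longrightarrow> d \<in> S"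
  unfolding dstable_subset_def divisor_stable_def by blast

lemma dstable_one: "S \<preceq> T \<Longrightarrow> 1 \<in> S"
  unfolding dstable_subset_def divisor_stable_def by auto

lemma dstable_trans: "\<lbrakk>R \<preceq> S; S \<preceq> T\<rbrakk> \<Longrightarrow> R \<preceq> T"
  by (auto simp: dstable_subset_def)

lemma dstable_refl: "S \<preceq> T \<Longrightarrow> S \<preceq> S"
  by (simp add: dstable_subset_def)

lemma dstable_singleton: "S \<preceq> T \<Longrightarrow> {1} \<preceq> S"
  using dstable_one[of S T] by (auto simp: dstable_subset_def divisor_stable_def)

lemma dstable_divisors: "\<lbrakk>S \<preceq> T; n \<in> S\<rbrakk> \<Longrightarrow> {d. d dvd n} \<preceq> S"
  using dstable_pos[of S T n] unfolding dstable_subset_def divisor_stable_def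
  by (auto intro: dvd_trans)

lemma dstable_quot:
  assumes "S \<preceq> T" "n \<in> S"
  shows "quot S n \<preceq> S"
proof -
  have "1 \<in> quot S n" using assms dstable_one by (simp add: quot_def)
  moreover have "0 \<notin> quot S n" using assms dstable_pos by (auto simp: quot_def)
  moreover have "d \<in> quot S n" if "m \<in> quot S n" "d dvd m" for m d
    using that assms(1) dstable_dvd mult_dvd_mono[OF that(2) dvd_refl[of n]] by (auto simp: quot_def)
  moreover have "quot S n \<subseteq> S" by (auto simp: quot_def)
  ultimately show ?thesis unfolding dstable_subset_def divisor_stable_def by blast
qed

lemma quot_stable: "\<lbrakk>S \<preceq> T; n \<in> S\<rbrakk> \<Longrightarrow> quot S n \<preceq> T"
  using dstable_quot dstable_trans by blast

lemma dstable_quot_mono: "\<lbrakk>R \<preceq> S; S \<preceq> T; n \<in> R\<rbrakk> \<Longrightarrow> quot R n \<preceq> quot S n"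
  using dstable_quot[of R S n] by (auto simp: dstable_subset_def quot_def)

lemma dstable_prime_to: "\<lbrakk>S \<preceq> T; prime p\<rbrakk> \<Longrightarrow> prime_to S p \<preceq> S"
  using dstable_one[of S T] not_prime_unit[of p]
  unfolding dstable_subset_def divisor_stable_def prime_to_def
  by (auto intro: dvd_trans)

lemma mem_quot: "S \<preceq> T \<Longrightarrow> m \<in> quot S n \<longleftrightarrow> m * n \<in> S"
  by (auto simp: quot_def intro: dstable_dvd)

lemma quot_quot: "S \<preceq> T \<Longrightarrow> quot (quot S m) n = quot S (m * n)"
  by (auto simp: quot_def mult_ac intro: dstable_dvd)

lemma quot_1: "quot S 1 = S"
  by (simp add: quot_def)


section \<open>Transport of structure\<close>

lemma rng_homs_one: "h \<in> rng_homs True R R' \<Longrightarrow> h \<one>\<^bsub>R\<^esub> = \<one>\<^bsub>R'\<^esub>"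
  by (simp add: rng_homs_def ring_hom_def)

lemma rng_homsI:
  assumes "h \<in> rng_hom R R'" "unital \<Longrightarrow> h \<one>\<^bsub>R\<^esub> = \<one>\<^bsub>R'\<^esub>"
  shows "h \<in> rng_homs unital R R'"
  using assms by (auto simp: rng_homs_def rng_hom_def ring_hom_def)

lemma rng_homs_comp:
  assumes "h \<in> rng_homs unital R1 R2" "k \<in> rng_homs unital R2 R3"
  shows "(\<lambda>x. k (h x)) \<in> rng_homs unital R1 R3"
  using assms by (cases unital) (auto simp: rng_homs_def rng_hom_def ring_hom_def Pi_iff)

lemma rng_homs_cong:
  assumes h: "h \<in> rng_homs unital R R'" and "is_rng unital R"
    and eq: "\<And>x. x \<in> carrier R \<Longrightarrow> k x = h x"
  shows "k \<in> rng_homs unital R R'"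
proof (rule rng_homsI)
  interpret comm_rng R by (rule is_rng_comm_rng) fact
  show "k \<in> rng_hom R R'"
    using rng_homs_rng_hom[OF h] eq by (auto simp: rng_hom_def Pi_iff m_closed)
  assume unital
  then interpret cring R using assms(2) by (simp add: is_rng_def)
  show "k \<one>\<^bsub>R\<^esub> = \<one>\<^bsub>R'\<^esub>" using h eq \<open>unital\<close> by (simp add: rng_homs_one)
qed

lemma rng_homs_the_inv_into:
  assumes R: "is_rng unital R" and h: "h \<in> rng_homs unital R R'"
    and bij: "bij_betw h (carrier R) (carrier R')"
  shows "the_inv_into (carrier R) h \<in> rng_homs unital R' R"
proof (rule rng_homsI)
  interpret comm_rng R by (rule is_rng_comm_rng) fact
  let ?k = "the_inv_into (carrier R) h"
  note hh = rng_homs_rng_hom[OF h, unfolded rng_hom_def]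
  have inj: "inj_on h (carrier R)" using bij by (simp add: bij_betw_def)
  have kh: "?k (h x) = x" if "x \<in> carrier R" for x
    using that inj by (simp add: the_inv_into_f_f)
  have surj: "\<exists>x\<in>carrier R. y = h x" if "y \<in> carrier R'" for y
    using that bij by (auto simp: bij_betw_def)
  show "?k \<in> rng_hom R' R"
    unfolding rng_hom_def
  proof (intro CollectI conjI Pi_I ballI)
    fix y assume "y \<in> carrier R'"
    then show "?k y \<in> carrier R" using surj kh by fastforce
  next
    fix y z assume "y \<in> carrier R'" "z \<in> carrier R'"
    then obtain x w where xw: "x \<in> carrier R" "w \<in> carrier R" "y = h x" "z = h w"
      using surj by blast
    then have "y \<otimes>\<^bsub>R'\<^esub> z = h (x \<otimes>\<^bsub>R\<^esub> w)" "y \<oplus>\<^bsub>R'\<^esub> z = h (x \<oplus>\<^bsub>R\<^esub> w)"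
      using hh by auto
    then show "?k (y \<otimes>\<^bsub>R'\<^esub> z) = ?k y \<otimes>\<^bsub>R\<^esub> ?k z" "?k (y \<oplus>\<^bsub>R'\<^esub> z) = ?k y \<oplus>\<^bsub>R\<^esub> ?k z"
      using xw by (simp_all add: kh m_closed)
  qed
  assume unital
  then interpret cring R using assms(1) by (simp add: is_rng_def)
  show "?k \<one>\<^bsub>R'\<^esub> = \<one>\<^bsub>R\<^esub>" using h \<open>unital\<close> kh[of "\<one>\<^bsub>R\<^esub>"] by (simp add: rng_homs_one)
qed

lemma is_rng_transport:
  assumes R: "is_rng unital R" and h: "h \<in> rng_homs unital R R'"
    and bij: "bij_betw h (carrier R) (carrier R')" and zero: "h \<zero>\<^bsub>R\<^esub> = \<zero>\<^bsub>R'\<^esub>"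
  shows "is_rng unital R'"
proof -
  interpret comm_rng R by (rule is_rng_comm_rng) fact
  note hh = rng_homs_rng_hom[OF h, unfolded rng_hom_def]
  have hc: "h x \<in> carrier R'" if "x \<in> carrier R" for x using hh that by auto
  have hm: "h x \<otimes>\<^bsub>R'\<^esub> h y = h (x \<otimes>\<^bsub>R\<^esub> y)" and ha: "h x \<oplus>\<^bsub>R'\<^esub> h y = h (x \<oplus>\<^bsub>R\<^esub> y)"
    if "x \<in> carrier R" "y \<in> carrier R" for x y
    using hh that by auto
  have carrier': "carrier R' = h ` carrier R" using bij by (simp add: bij_betw_def)
  note simps = carrier' hm ha m_closed zero[symmetric]
  have grp: "abelian_group R'"
  proof (rule abelian_groupI)
    fix y assume "y \<in> carrier R'"
    then obtain x where x: "x \<in> carrier R" "y = h x" unfolding carrier' by blast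
    then have "h (\<ominus>\<^bsub>R\<^esub> x) \<oplus>\<^bsub>R'\<^esub> y = \<zero>\<^bsub>R'\<^esub>" by (simp add: simps l_neg)
    then show "\<exists>z\<in>carrier R'. z \<oplus>\<^bsub>R'\<^esub> y = \<zero>\<^bsub>R'\<^esub>" using x hc by blast
  qed (auto simp: simps a_ac)
  have assoc: "x \<otimes>\<^bsub>R'\<^esub> y \<otimes>\<^bsub>R'\<^esub> z = x \<otimes>\<^bsub>R'\<^esub> (y \<otimes>\<^bsub>R'\<^esub> z)"
    if "x \<in> carrier R'" "y \<in> carrier R'" "z \<in> carrier R'" for x y z
    using that by (auto simp: simps m_assoc)
  have comm: "x \<otimes>\<^bsub>R'\<^esub> y = y \<otimes>\<^bsub>R'\<^esub> x" if "x \<in> carrier R'" "y \<in> carrier R'" for x y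
  proof -
    from that obtain u v where "u \<in> carrier R" "v \<in> carrier R" "x = h u" "y = h v"
      unfolding carrier' by blast
    then show ?thesis using m_comm[of u v] by (simp add: simps)
  qed
  have distr: "(x \<oplus>\<^bsub>R'\<^esub> y) \<otimes>\<^bsub>R'\<^esub> z = x \<otimes>\<^bsub>R'\<^esub> z \<oplus>\<^bsub>R'\<^esub> y \<otimes>\<^bsub>R'\<^esub> z"
    if "x \<in> carrier R'" "y \<in> carrier R'" "z \<in> carrier R'" for x y z
    using that by (auto simp: simps l_distr)
  have closed: "x \<otimes>\<^bsub>R'\<^esub> y \<in> carrier R'" if "x \<in> carrier R'" "y \<in> carrier R'" for x y
    using that by (auto simp: simps)
  show ?thesis
  proof (cases unital)
    case False
    have "comm_rng R'"
      using grp assoc comm distr closed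
      by (intro comm_rng.intro comm_rng_axioms.intro)
    then show ?thesis using False by (simp add: is_rng_def)
  next
    case True
    then interpret R: cring R using R by (simp add: is_rng_def)
    have one: "\<one>\<^bsub>R'\<^esub> = h \<one>\<^bsub>R\<^esub>" using h True by (simp add: rng_homs_one)
    have "cring R'"
    proof (rule cringI[OF grp])
      show "Group.comm_monoid R'"
        by (rule comm_monoidI) (use closed assoc comm in \<open>auto simp: one simps\<close>)
    qed (rule distr)
    then show ?thesis using True by (simp add: is_rng_def)
  qed
qed

context rf_object
begin

lemma comm_rng_rg: "S \<preceq> T \<Longrightarrow> comm_rng (rg A S)"
  using rng is_rng_comm_rng by blast

lemma res_closed: "\<lbrakk>R \<preceq> S; S \<preceq> T; a \<in> carrier (rg A S)\<rbrakk> \<Longrightarrow> res A S R a \<in> carrier (rg A R)"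
  using res_hom[of R S] by (auto dest!: rng_homs_rng_hom simp: rng_hom_def)

lemma frob_closed:
  "\<lbrakk>S \<preceq> T; prime p; p \<in> S; a \<in> carrier (rg A S)\<rbrakk> \<Longrightarrow> frob A p S a \<in> carrier (rg A (quot S p))"
  using frob_hom[of S p] by (auto dest!: rng_homs_rng_hom simp: rng_hom_def)

end

lemma (in rfv_object) ver_closed:
  "\<lbrakk>S \<preceq> T; prime p; p \<in> S; a \<in> carrier (rg A (quot S p))\<rbrakk> \<Longrightarrow> ver A p S a \<in> carrier (rg A S)"
  using ver_hom[of S p] by (auto simp: hom_def)

text \<open>
  A family of bijections that respects all operations carries the axioms of $\mathcal{RFV}_T$
  over. For Witt vectors this replaces a direct verification; in particular the congruence
  $F_p(a) \equiv \pi(a)^p$ for Witt vectors comes for free.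
\<close>

locale rfv_transport = A: rfv_object unital T A
  for unital T and A :: "('a, 'm) rfv_scheme" +
  fixes B :: "('b, 'n) rfv_scheme" and \<alpha> :: "nat set \<Rightarrow> 'a \<Rightarrow> 'b"
  assumes bij: "S \<preceq> T \<Longrightarrow> bij_betw (\<alpha> S) (carrier (rg A S)) (carrier (rg B S))"
    and hom: "S \<preceq> T \<Longrightarrow> \<alpha> S \<in> rng_homs unital (rg A S) (rg B S)"
    and zero: "S \<preceq> T \<Longrightarrow> \<alpha> S \<zero>\<^bsub>rg A S\<^esub> = \<zero>\<^bsub>rg B S\<^esub>"
    and res: "\<lbrakk>R \<preceq> S; S \<preceq> T; a \<in> carrier (rg A S)\<rbrakk>
      \<Longrightarrow> \<alpha> R (res A S R a) = res B S R (\<alpha> S a)"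
    and frob: "\<lbrakk>S \<preceq> T; prime p; p \<in> S; a \<in> carrier (rg A S)\<rbrakk>
      \<Longrightarrow> \<alpha> (quot S p) (frob A p S a) = frob B p S (\<alpha> S a)"
    and ver: "\<lbrakk>S \<preceq> T; prime p; p \<in> S; a \<in> carrier (rg A (quot S p))\<rbrakk>
      \<Longrightarrow> \<alpha> S (ver A p S a) = ver B p S (\<alpha> (quot S p) a)"
begin

definition "inv_map S = the_inv_into (carrier (rg A S)) (\<alpha> S)"

lemma B_rng: "S \<preceq> T \<Longrightarrow> is_rng unital (rg B S)"
  using is_rng_transport A.rng hom bij zero by blast

lemma homo: "S \<preceq> T \<Longrightarrow> rng_homo (rg A S) (rg B S) (\<alpha> S)"
  unfolding rng_homo_def rng_homo_axioms_def
  using A.comm_rng_rg B_rng hom is_rng_comm_rng rng_homs_rng_hom by blast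

lemma inv_hom: "S \<preceq> T \<Longrightarrow> inv_map S \<in> rng_homs unital (rg B S) (rg A S)"
  unfolding inv_map_def using A.rng hom bij by (rule rng_homs_the_inv_into)

lemma inv_closed: "\<lbrakk>S \<preceq> T; b \<in> carrier (rg B S)\<rbrakk> \<Longrightarrow> inv_map S b \<in> carrier (rg A S)"
  using inv_hom[of S] by (auto dest!: rng_homs_rng_hom simp: rng_hom_def)

lemma closed: "\<lbrakk>S \<preceq> T; a \<in> carrier (rg A S)\<rbrakk> \<Longrightarrow> \<alpha> S a \<in> carrier (rg B S)"
  using bij[of S] by (auto simp: bij_betw_def)

lemma inv_left: "\<lbrakk>S \<preceq> T; a \<in> carrier (rg A S)\<rbrakk> \<Longrightarrow> inv_map S (\<alpha> S a) = a"
  using bij[of S] by (simp add: inv_map_def bij_betw_def the_inv_into_f_f)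

lemma inv_right: "\<lbrakk>S \<preceq> T; b \<in> carrier (rg B S)\<rbrakk> \<Longrightarrow> \<alpha> S (inv_map S b) = b"
  using bij[of S] by (simp add: inv_map_def f_the_inv_into_f_bij_betw)

lemma obtain_preimage:
  assumes "S \<preceq> T" "b \<in> carrier (rg B S)"
  obtains a where "a \<in> carrier (rg A S)" "b = \<alpha> S a"
  using assms inv_closed inv_right by metis

lemma inj: "\<lbrakk>S \<preceq> T; a \<in> carrier (rg A S); a' \<in> carrier (rg A S)\<rbrakk> \<Longrightarrow> \<alpha> S a = \<alpha> S a' \<longleftrightarrow> a = a'"
  using inv_left by metis

lemma rf_object: "rf_object unital T B"
proof
  show "is_rng unital (rg B S)" if "S \<preceq> T" for S using that by (rule B_rng)
next
  fix R S assume RS: "R \<preceq> S" "S \<preceq> T"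
  then have R: "R \<preceq> T" by (rule dstable_trans)
  have "(\<lambda>b. \<alpha> R (res A S R (inv_map S b))) \<in> rng_homs unital (rg B S) (rg B R)"
    by (intro rng_homs_comp[OF _ hom[OF R]] rng_homs_comp[OF inv_hom A.res_hom] RS)
  then show "res B S R \<in> rng_homs unital (rg B S) (rg B R)"
    by (rule rng_homs_cong) (use B_rng RS res inv_closed inv_right in auto)
next
  fix S b assume *: "S \<preceq> T" "b \<in> carrier (rg B S)"
  obtain a where a: "a \<in> carrier (rg A S)" "b = \<alpha> S a" using * obtain_preimage by blast
  show "res B S S b = b"
    using res[OF dstable_refl *(1) a(1)] A.res_id[OF _ a(1)] * a(2) by simp
next
  fix Q R S b assume *: "Q \<preceq> R" "R \<preceq> S" "S \<preceq> T" "b \<in> carrier (rg B S)"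
  obtain a where a: "a \<in> carrier (rg A S)" "b = \<alpha> S a" using * obtain_preimage by blast
  have "R \<preceq> T" "Q \<preceq> S" using * dstable_trans by blast+
  then show "res B R Q (res B S R b) = res B S Q b"
    using * a A.res_res[of Q R S a] by (simp flip: res add: A.res_closed)
next
  fix S p assume *: "S \<preceq> T" "prime p" "p \<in> S"
  then have q: "quot S p \<preceq> T" by (simp add: quot_stable)
  have "(\<lambda>b. \<alpha> (quot S p) (frob A p S (inv_map S b))) \<in> rng_homs unital (rg B S) (rg B (quot S p))"
    by (intro rng_homs_comp[OF _ hom[OF q]] rng_homs_comp[OF inv_hom A.frob_hom] *)
  then show "frob B p S \<in> rng_homs unital (rg B S) (rg B (quot S p))"
    by (rule rng_homs_cong) (use B_rng * frob inv_closed inv_right in auto)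
next
  fix S p b assume *: "S \<preceq> T" "prime p" "p \<in> S" "b \<in> carrier (rg B S)"
  obtain a where a: "a \<in> carrier (rg A S)" "b = \<alpha> S a" using * obtain_preimage by blast
  let ?q = "quot S p"
  have q: "?q \<preceq> T" "?q \<preceq> S" using * by (auto simp: quot_stable dstable_quot)
  interpret H: rng_homo "rg A ?q" "rg B ?q" "\<alpha> ?q" by (rule homo[OF q(1)])
  obtain c where c: "c \<in> carrier (rg A ?q)"
    "frob A p S a = rpow (rg A ?q) (res A S ?q a) p \<oplus>\<^bsub>rg A ?q\<^esub> [p] \<cdot>\<^bsub>rg A ?q\<^esub> c"
    using A.frob_cong[OF *(1-3) a(1)] by blast
  have p0: "p > 0" using * dstable_pos by blast
  have "frob B p S b = \<alpha> ?q (frob A p S a)" using * a frob by simp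
  also have "\<dots> = rpow (rg B ?q) (res B S ?q b) p \<oplus>\<^bsub>rg B ?q\<^esub> [p] \<cdot>\<^bsub>rg B ?q\<^esub> \<alpha> ?q c"
    using c a * q p0
    by (simp add: H.hom_add H.hom_rpow H.hom_add_pow H.dom.rpow_closed A.res_closed flip: res)
  finally show "\<exists>c\<in>carrier (rg B ?q).
      frob B p S b = rpow (rg B ?q) (res B S ?q b) p \<oplus>\<^bsub>rg B ?q\<^esub> [p] \<cdot>\<^bsub>rg B ?q\<^esub> c"
    using c(1) H.hom_closed by blast
next
  fix R S p b assume *: "R \<preceq> S" "S \<preceq> T" "prime p" "p \<in> R" "b \<in> carrier (rg B S)"
  obtain a where a: "a \<in> carrier (rg A S)" "b = \<alpha> S a" using * obtain_preimage by blast
  have "p \<in> S" using * by (auto simp: dstable_subset_def)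
  moreover have "R \<preceq> T" using * dstable_trans by blast
  moreover have "quot R p \<preceq> quot S p" using * dstable_quot_mono by blast
  ultimately show "res B (quot S p) (quot R p) (frob B p S b) = frob B p R (res B S R b)"
    using * a A.res_frob[of R S p a]
    by (simp flip: res frob add: A.res_closed A.frob_closed quot_stable)
next
  fix S p l b assume *: "S \<preceq> T" "prime p" "prime l" "p * l \<in> S" "b \<in> carrier (rg B S)"
  obtain a where a: "a \<in> carrier (rg A S)" "b = \<alpha> S a" using * obtain_preimage by blast
  have pl: "p \<in> S" "l \<in> S" using * dstable_dvd by auto
  have lp: "l \<in> quot S p" "p \<in> quot S l" using * by (simp_all add: mem_quot mult.commute)
  have q: "quot S p \<preceq> T" "quot S l \<preceq> T" using * pl by (simp_all add: quot_stable)
  have qq: "quot (quot S p) l = quot (quot S l) p"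
    using *(1) by (simp add: quot_quot mult.commute)
  have "frob B l (quot S p) (frob B p S b)
      = \<alpha> (quot (quot S p) l) (frob A l (quot S p) (frob A p S a))"
    unfolding a(2) frob[OF *(1,2) pl(1) a(1), symmetric]
    using frob[OF q(1) *(3) lp(1)] A.frob_closed[OF *(1,2) pl(1) a(1)] by simp
  also have "\<dots> = \<alpha> (quot (quot S l) p) (frob A p (quot S l) (frob A l S a))"
    unfolding qq using A.frob_frob[OF *(1-4) a(1)] by simp
  also have "\<dots> = frob B p (quot S l) (frob B l S b)"
    unfolding a(2) frob[OF *(1,3) pl(2) a(1), symmetric]
    using frob[OF q(2) *(2) lp(2)] A.frob_closed[OF *(1,3) pl(2) a(1)] by simp
  finally show "frob B l (quot S p) (frob B p S b) = frob B p (quot S l) (frob B l S b)" .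
qed

lemma ver_B_closed:
  assumes "S \<preceq> T" "prime p" "p \<in> S" "b \<in> carrier (rg B (quot S p))"
  shows "ver B p S b \<in> carrier (rg B S)"
proof -
  obtain a where "a \<in> carrier (rg A (quot S p))" "b = \<alpha> (quot S p) a"
    using assms obtain_preimage quot_stable by blast
  then show ?thesis using assms by (simp add: closed A.ver_closed flip: ver)
qed

theorem rfv_object: "rfv_object unital T B"
proof (intro rfv_object.intro rf_object rfv_object_axioms.intro)
  fix S and x :: "nat set \<Rightarrow> 'b"
  assume S: "S \<preceq> T"
    and x: "\<And>R. \<lbrakk>R \<preceq> S; finite R\<rbrakk> \<Longrightarrow> x R \<in> carrier (rg B R)"
    and xx: "\<And>Q R. \<lbrakk>Q \<preceq> R; R \<preceq> S; finite R\<rbrakk> \<Longrightarrow> res B R Q (x R) = x Q"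
  let ?y = "\<lambda>R. inv_map R (x R)"
  have RT: "R \<preceq> T" if "R \<preceq> S" for R using that S dstable_trans by blast
  have y: "?y R \<in> carrier (rg A R)" if "R \<preceq> S" "finite R" for R
    using that x RT inv_closed by blast
  have yy: "res A R Q (?y R) = ?y Q" if "Q \<preceq> R" "R \<preceq> S" "finite R" for Q R
  proof -
    have Q: "Q \<preceq> T" "Q \<preceq> S" "finite Q"
      using that S dstable_trans finite_subset unfolding dstable_subset_def by blast+
    have "\<alpha> Q (res A R Q (?y R)) = x Q"
      using res[OF that(1) RT[OF that(2)] y[OF that(2,3)]] xx[OF that]
        inv_right[OF RT[OF that(2)] x[OF that(2,3)]] by simp
    moreover have "\<alpha> Q (?y Q) = x Q" using inv_right Q x by blast
    ultimately show ?thesis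
      using inj[OF Q(1)] A.res_closed[OF that(1) RT[OF that(2)] y[OF that(2,3)]] y[OF Q(2,3)] by metis
  qed
  have iff: "res B S R (\<alpha> S a) = x R \<longleftrightarrow> res A S R a = ?y R"
    if "a \<in> carrier (rg A S)" "R \<preceq> S" "finite R" for a R
    using res[OF that(2) S that(1)] A.res_closed[OF that(2) S that(1)] y[OF that(2,3)]
      inj[OF RT[OF that(2)]] inv_right[OF RT[OF that(2)] x[OF that(2,3)]] by metis
  obtain a where a: "a \<in> carrier (rg A S)" "\<And>R. R \<preceq> S \<Longrightarrow> finite R \<Longrightarrow> res A S R a = ?y R"
    and uniq: "\<And>a'. a' \<in> carrier (rg A S) \<Longrightarrow>
      \<forall>R. R \<preceq> S \<and> finite R \<longrightarrow> res A S R a' = ?y R \<Longrightarrow> a' = a"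
    using A.continuous[of S ?y, OF S y yy] by blast
  show "\<exists>!b. b \<in> carrier (rg B S) \<and> (\<forall>R. R \<preceq> S \<and> finite R \<longrightarrow> res B S R b = x R)"
  proof (rule ex1I[of _ "\<alpha> S a"])
    show "\<alpha> S a \<in> carrier (rg B S) \<and> (\<forall>R. R \<preceq> S \<and> finite R \<longrightarrow> res B S R (\<alpha> S a) = x R)"
      using a iff closed[OF S] by blast
  next
    fix b assume b: "b \<in> carrier (rg B S) \<and> (\<forall>R. R \<preceq> S \<and> finite R \<longrightarrow> res B S R b = x R)"
    then obtain a' where "a' \<in> carrier (rg A S)" "b = \<alpha> S a'" using obtain_preimage S by blast
    then show "b = \<alpha> S a" using b iff uniq by blast
  qed
next
  fix S p assume *: "S \<preceq> T" "prime p" "p \<in> S"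
  let ?q = "quot S p"
  have q: "?q \<preceq> T" using * by (simp add: quot_stable)
  interpret Hq: rng_homo "rg A ?q" "rg B ?q" "\<alpha> ?q" by (rule homo[OF q])
  interpret H: rng_homo "rg A S" "rg B S" "\<alpha> S" by (rule homo[OF *(1)])
  have "ver B p S (b \<oplus>\<^bsub>rg B ?q\<^esub> b') = ver B p S b \<oplus>\<^bsub>rg B S\<^esub> ver B p S b'"
    if bb: "b \<in> carrier (rg B ?q)" "b' \<in> carrier (rg B ?q)" for b b'
  proof -
    obtain a where a: "a \<in> carrier (rg A ?q)" "b = \<alpha> ?q a"
      by (rule obtain_preimage[OF q bb(1)])
    obtain a' where a': "a' \<in> carrier (rg A ?q)" "b' = \<alpha> ?q a'"
      by (rule obtain_preimage[OF q bb(2)])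
    have "ver B p S (b \<oplus>\<^bsub>rg B ?q\<^esub> b') = \<alpha> S (ver A p S (a \<oplus>\<^bsub>rg A ?q\<^esub> a'))"
      using a a' ver[OF *, of "a \<oplus>\<^bsub>rg A ?q\<^esub> a'"] by (simp add: Hq.hom_add)
    also have "ver A p S (a \<oplus>\<^bsub>rg A ?q\<^esub> a') = ver A p S a \<oplus>\<^bsub>rg A S\<^esub> ver A p S a'"
      using A.ver_hom[OF *] a a' by (simp add: hom_def)
    also have "\<alpha> S \<dots> = ver B p S b \<oplus>\<^bsub>rg B S\<^esub> ver B p S b'"
      using a a' ver[OF *] A.ver_closed[OF *] by (simp add: H.hom_add)
    finally show ?thesis .
  qed
  then show "ver B p S \<in> hom (add_monoid (rg B ?q)) (add_monoid (rg B S))"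
    using ver_B_closed[OF *] by (simp add: hom_def)
  show "inj_on (ver B p S) (carrier (rg B ?q))"
  proof (rule inj_onI)
    fix b b' assume b: "b \<in> carrier (rg B ?q)" "b' \<in> carrier (rg B ?q)" "ver B p S b = ver B p S b'"
    obtain a where a: "a \<in> carrier (rg A ?q)" "b = \<alpha> ?q a"
      by (rule obtain_preimage[OF q b(1)])
    obtain a' where a': "a' \<in> carrier (rg A ?q)" "b' = \<alpha> ?q a'"
      by (rule obtain_preimage[OF q b(2)])
    have "\<alpha> S (ver A p S a) = \<alpha> S (ver A p S a')"
      using b(3) a a' by (simp add: ver[OF *])
    then have "ver A p S a = ver A p S a'"
      using inj[OF *(1) A.ver_closed[OF * a(1)] A.ver_closed[OF * a'(1)]] by simp
    then have "a = a'" using A.ver_inj[OF *] a(1) a'(1) by (auto dest: inj_onD)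
    then show "b = b'" using a(2) a'(2) by simp
  qed
  let ?r = "prime_to S p"
  have r: "?r \<preceq> S" "?r \<preceq> T" using * dstable_prime_to dstable_trans by blast+
  have "\<alpha> S ` (ver A p S ` carrier (rg A ?q)) = ver B p S ` (\<alpha> ?q ` carrier (rg A ?q))"
    using * by (auto simp: ver image_iff)
  also have "\<alpha> ?q ` carrier (rg A ?q) = carrier (rg B ?q)" using bij[OF q] by (simp add: bij_betw_def)
  finally have 1: "ver B p S ` carrier (rg B ?q) = \<alpha> S ` (ver A p S ` carrier (rg A ?q))" ..
  have 2: "a_kernel (rg B S) (rg B ?r) (res B S ?r)
      = \<alpha> S ` a_kernel (rg A S) (rg A ?r) (res A S ?r)"
  proof -
    have *: "res B S ?r (\<alpha> S a) = \<zero>\<^bsub>rg B ?r\<^esub> \<longleftrightarrow> res A S ?r a = \<zero>\<^bsub>rg A ?r\<^esub>"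
      if "a \<in> carrier (rg A S)" for a
    proof -
      have "\<zero>\<^bsub>rg A ?r\<^esub> \<in> carrier (rg A ?r)"
        using A.comm_rng_rg[OF r(2)] by (simp add: comm_rng_def abelian_group_def abelian_monoid.zero_closed)
      then show ?thesis
        using that res[OF r(1) *(1) that] inj[OF r(2)] zero[OF r(2)] A.res_closed[OF r(1) *(1) that] by metis
    qed
    have "carrier (rg B S) = \<alpha> S ` carrier (rg A S)" using bij[OF \<open>S \<preceq> T\<close>] by (simp add: bij_betw_def)
    then show ?thesis using * by (auto simp: a_kernel_def')
  qed
  show "ver B p S ` carrier (rg B ?q) = a_kernel (rg B S) (rg B ?r) (res B S ?r)"
    using 1 2 A.ver_exact[OF *] by simp
  have "res B S ?r ` (\<alpha> S ` carrier (rg A S)) = \<alpha> ?r ` (res A S ?r ` carrier (rg A S))"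
    using * r by (auto simp: res image_iff)
  then show "res B S ?r ` carrier (rg B S) = carrier (rg B ?r)"
    using A.res_surj[OF *] bij[OF *(1)] bij[OF r(2)] by (simp add: bij_betw_def)
next
  fix R S p b assume *: "R \<preceq> S" "S \<preceq> T" "prime p" "p \<in> R" "b \<in> carrier (rg B (quot S p))"
  have p: "p \<in> S" using * by (auto simp: dstable_subset_def)
  obtain a where a: "a \<in> carrier (rg A (quot S p))" "b = \<alpha> (quot S p) a"
    using * p obtain_preimage quot_stable by blast
  have "R \<preceq> T" using * dstable_trans by blast
  moreover have "quot R p \<preceq> quot S p" using * dstable_quot_mono by blast
  ultimately show "res B S R (ver B p S b) = ver B p R (res B (quot S p) (quot R p) b)"
    using * a p A.res_ver[of R S p a]
    by (simp flip: res ver add: A.res_closed A.ver_closed quot_stable)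
next
  fix S p l b
  assume *: "S \<preceq> T" "prime p" "prime l" "p * l \<in> S" "b \<in> carrier (rg B (quot S (p * l)))"
  have pl: "p \<in> S" "l \<in> S" using * dstable_dvd by auto
  have qq: "quot (quot S p) l = quot S (p * l)" "quot (quot S l) p = quot S (p * l)"
    using *(1) by (simp_all add: quot_quot mult.commute)
  have lp: "l \<in> quot S p" "p \<in> quot S l" using * by (simp_all add: mem_quot mult.commute)
  have q: "quot S p \<preceq> T" "quot S l \<preceq> T" using * pl by (simp_all add: quot_stable)
  obtain a where a: "a \<in> carrier (rg A (quot S (p * l)))" "b = \<alpha> (quot S (p * l)) a"
    using * obtain_preimage quot_stable by blast
  have a': "a \<in> carrier (rg A (quot (quot S p) l))" "a \<in> carrier (rg A (quot (quot S l) p))"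
    using a(1) qq by simp_all
  have "ver B p S (ver B l (quot S p) b) = \<alpha> S (ver A p S (ver A l (quot S p) a))"
    unfolding a(2) qq(1)[symmetric] ver[OF q(1) *(3) lp(1) a'(1), symmetric]
    using ver[OF *(1,2) pl(1)] A.ver_closed[OF q(1) *(3) lp(1) a'(1)] by simp
  also have "\<dots> = \<alpha> S (ver A l S (ver A p (quot S l) a))"
    using A.ver_ver[OF *(1-4) a(1)] by simp
  also have "\<dots> = ver B l S (ver B p (quot S l) b)"
    unfolding a(2) qq(2)[symmetric] ver[OF q(2) *(2) lp(2) a'(2), symmetric]
    using ver[OF *(1,3) pl(2)] A.ver_closed[OF q(2) *(2) lp(2) a'(2)] by simp
  finally show "ver B p S (ver B l (quot S p) b) = ver B l S (ver B p (quot S l) b)" .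
next
  fix S p b assume *: "S \<preceq> T" "prime p" "p \<in> S" "b \<in> carrier (rg B (quot S p))"
  have q: "quot S p \<preceq> T" using * by (simp add: quot_stable)
  interpret H: rng_homo "rg A (quot S p)" "rg B (quot S p)" "\<alpha> (quot S p)" by (rule homo[OF q])
  obtain a where a: "a \<in> carrier (rg A (quot S p))" "b = \<alpha> (quot S p) a"
    using * q obtain_preimage by blast
  then show "frob B p S (ver B p S b) = [p] \<cdot>\<^bsub>rg B (quot S p)\<^esub> b"
    using * A.frob_ver_same[of S p a]
    by (simp flip: frob ver H.hom_add_pow add: A.ver_closed)
next
  fix S p l b
  assume *: "S \<preceq> T" "prime p" "prime l" "l \<noteq> p" "p * l \<in> S" "b \<in> carrier (rg B (quot S p))"
  have pl: "p \<in> S" "l \<in> S" using * dstable_dvd by auto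
  have qq: "quot (quot S p) l = quot (quot S l) p"
    using *(1) by (simp add: quot_quot mult.commute)
  have lp: "l \<in> quot S p" "p \<in> quot S l" using * by (simp_all add: mem_quot mult.commute)
  have q: "quot S p \<preceq> T" "quot S l \<preceq> T" using * pl by (simp_all add: quot_stable)
  obtain a where a: "a \<in> carrier (rg A (quot S p))" "b = \<alpha> (quot S p) a"
    using * q obtain_preimage by blast
  have fa: "frob A l (quot S p) a \<in> carrier (rg A (quot (quot S l) p))"
    using A.frob_closed[OF q(1) *(3) lp(1) a(1)] qq by simp
  have "frob B l S (ver B p S b) = \<alpha> (quot S l) (frob A l S (ver A p S a))"
    unfolding a(2) ver[OF *(1,2) pl(1) a(1), symmetric]
    using frob[OF *(1,3) pl(2)] A.ver_closed[OF *(1,2) pl(1) a(1)] by simp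
  also have "\<dots> = \<alpha> (quot S l) (ver A p (quot S l) (frob A l (quot S p) a))"
    using A.frob_ver_diff[OF *(1-5) a(1)] by simp
  also have "\<dots> = ver B p (quot S l) (frob B l (quot S p) b)"
    unfolding a(2) frob[OF q(1) *(3) lp(1) a(1), symmetric] qq
    by (rule ver[OF q(2) *(2) lp(2) fa])
  finally show "frob B l S (ver B p S b) = ver B p (quot S l) (frob B l (quot S p) b)" .
qed

theorem rfv_mor: "rfv_mor unital T A B \<alpha>"
  using A.rfv_object_axioms A.rf_object_axioms rfv_object rf_object hom res frob ver
  by (simp add: rfv_mor_def rf_mor_def)

theorem rfv_mor_inverse: "rfv_mor unital T B A inv_map"
  unfolding rfv_mor_def rf_mor_def
proof (intro conjI allI ballI impI)
  show "rfv_object unital T B" "rfv_object unital T A" "rf_object unital T B" "rf_object unital T A"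
    by (rule rfv_object A.rfv_object_axioms rf_object A.rf_object_axioms)+
  show "inv_map S \<in> rng_homs unital (rg B S) (rg A S)" if "S \<preceq> T" for S
    using that by (rule inv_hom)
next
  fix R S b assume b: "b \<in> carrier (rg B S)" and "R \<preceq> S \<and> S \<preceq> T"
  then have *: "R \<preceq> S" "S \<preceq> T" by auto
  note a = inv_closed[OF *(2) b]
  show "inv_map R (res B S R b) = res A S R (inv_map S b)"
    using res[OF * a] inv_left[OF dstable_trans[OF *] A.res_closed[OF * a]]
      inv_right[OF *(2) b] by simp
next
  fix S p b assume b: "b \<in> carrier (rg B S)" and "S \<preceq> T \<and> prime p \<and> p \<in> S"
  then have *: "S \<preceq> T" "prime p" "p \<in> S" by auto
  note a = inv_closed[OF *(1) b]
  show "inv_map (quot S p) (frob B p S b) = frob A p S (inv_map S b)"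
    using frob[OF * a] inv_left[OF quot_stable[OF *(1,3)] A.frob_closed[OF * a]]
      inv_right[OF *(1) b] by simp
next
  fix S p b assume b: "b \<in> carrier (rg B (quot S p))" and "S \<preceq> T \<and> prime p \<and> p \<in> S"
  then have *: "S \<preceq> T" "prime p" "p \<in> S" by auto
  note a = inv_closed[OF quot_stable[OF *(1,3)] b]
  show "inv_map S (ver B p S b) = ver A p S (inv_map (quot S p) b)"
    using ver[OF * a] inv_left[OF *(1) A.ver_closed[OF * a]]
      inv_right[OF quot_stable[OF *(1,3)] b] by simp
qed

theorem rfv_iso: "rfv_iso unital T A B \<alpha>" and rf_iso: "rf_iso unital T A B \<alpha>"
proof -
  have "mutually_inverse T A B \<alpha> inv_map"
    by (simp add: mutually_inverse_def inv_left inv_right)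
  then show "rfv_iso unital T A B \<alpha>" "rf_iso unital T A B \<alpha>"
    using rfv_mor rfv_mor_inverse unfolding rfv_iso_def rf_iso_def rfv_mor_def by blast+
qed

end


section \<open>The ghost map of an object\<close>

context rf_object
begin

lemma frob_list_hom:
  "\<lbrakk>S \<preceq> T; \<forall>p\<in>set ps. prime p; prod_list ps \<in> S\<rbrakk>
    \<Longrightarrow> frob_list A ps S \<in> rng_homs unital (rg A S) (rg A (quot S (prod_list ps)))"
proof (induction ps arbitrary: S)
  case Nil
  have "(\<lambda>a. a) \<in> rng_homs unital (rg A S) (rg A S)"
    by (auto simp: rng_homs_def rng_hom_def ring_hom_def)
  then show ?case by (simp add: quot_def)
next
  case (Cons p ps)
  have p: "prime p" "p \<in> S" using Cons.prems dstable_dvd[OF Cons.prems(1,3)] by auto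
  have ps: "prod_list ps \<in> quot S p"
    using Cons.prems by (simp add: mem_quot mult.commute)
  have "(\<lambda>a. frob_list A ps (quot S p) (frob A p S a))
      \<in> rng_homs unital (rg A S) (rg A (quot (quot S p) (prod_list ps)))"
    using Cons.prems p ps
    by (intro rng_homs_comp[OF frob_hom] Cons.IH) (auto simp: quot_stable)
  then show ?case using Cons.prems(1) by (simp add: quot_quot)
qed

lemma res_frob_list:
  "\<lbrakk>R \<preceq> S; S \<preceq> T; \<forall>p\<in>set ps. prime p; prod_list ps \<in> R; a \<in> carrier (rg A S)\<rbrakk>
    \<Longrightarrow> res A (quot S (prod_list ps)) (quot R (prod_list ps)) (frob_list A ps S a)
      = frob_list A ps R (res A S R a)"
proof (induction ps arbitrary: R S a)
  case Nil
  then show ?case by (simp add: quot_def)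
next
  case (Cons p ps)
  have p: "prime p" "p \<in> R" using Cons.prems dstable_dvd[OF Cons.prems(1,4)] by auto
  then have pS: "p \<in> S" using Cons.prems(1) by (auto simp: dstable_subset_def)
  have ps: "prod_list ps \<in> quot R p"
    using Cons.prems by (simp add: mem_quot mult.commute)
  have q: "quot R p \<preceq> quot S p" "quot S p \<preceq> T"
    using Cons.prems p pS by (auto intro: dstable_quot_mono quot_stable)
  have "res A (quot (quot S p) (prod_list ps)) (quot (quot R p) (prod_list ps))
        (frob_list A ps (quot S p) (frob A p S a))
      = frob_list A ps (quot R p) (res A (quot S p) (quot R p) (frob A p S a))"
    using Cons.prems p pS ps q by (intro Cons.IH) (auto intro: frob_closed)
  also have "\<dots> = frob_list A (p # ps) R (res A S R a)"
    using Cons.prems p by (simp add: res_frob)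
  finally show ?case using Cons.prems(1,2) by (simp add: quot_quot)
qed

lemma frob_frob_list:
  "\<lbrakk>S \<preceq> T; prime p; \<forall>q\<in>set ps. prime q; p * prod_list ps \<in> S; a \<in> carrier (rg A S)\<rbrakk>
    \<Longrightarrow> frob A p (quot S (prod_list ps)) (frob_list A ps S a)
      = frob_list A ps (quot S p) (frob A p S a)"
proof (induction ps arbitrary: S a)
  case Nil
  then show ?case by (simp add: quot_def)
next
  case (Cons q ps)
  have q: "prime q" using Cons.prems by simp
  have S: "q \<in> S" "p \<in> S" "p * q \<in> S"
    using Cons.prems(4) by (auto intro!: dstable_dvd[OF Cons.prems(1,4)])
  have ps: "p * prod_list ps \<in> quot S q"
    using Cons.prems by (simp add: mem_quot mult_ac)
  have "frob A p (quot (quot S q) (prod_list ps)) (frob_list A ps (quot S q) (frob A q S a))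
      = frob_list A ps (quot (quot S q) p) (frob A p (quot S q) (frob A q S a))"
    using Cons.prems q S ps
    by (intro Cons.IH) (auto intro: frob_closed quot_stable)
  also have "frob A p (quot S q) (frob A q S a) = frob A q (quot S p) (frob A p S a)"
    using frob_frob[of S p q a] Cons.prems q S by simp
  also have "quot (quot S q) p = quot (quot S p) q"
    using Cons.prems(1) by (simp add: quot_quot mult.commute)
  finally show ?case using Cons.prems(1) by (simp add: quot_quot)
qed

text \<open>
  The operator $F_n$ is the composite of the $F_p$ in the order of the sorted list of prime factors
  of \<open>n\<close>. Commutation moves a new prime from its place in the list to the front.
\<close>

lemma frob_list_insort:
  "\<lbrakk>S \<preceq> T; prime p; \<forall>q\<in>set ps. prime q; p * prod_list ps \<in> S; a \<in> carrier (rg A S)\<rbrakk>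
    \<Longrightarrow> frob_list A (insort p ps) S a = frob_list A ps (quot S p) (frob A p S a)"
proof (induction ps arbitrary: S a)
  case (Cons q ps)
  show ?case
  proof (cases "p \<le> q")
    case False
    have q: "prime q" using Cons.prems by simp
    have S: "q \<in> S" "p \<in> S" "p * q \<in> S"
      using Cons.prems(4) by (auto intro!: dstable_dvd[OF Cons.prems(1,4)])
    have ps: "p * prod_list ps \<in> quot S q"
      using Cons.prems by (simp add: mem_quot mult_ac)
    have "frob_list A (insort p ps) (quot S q) (frob A q S a)
        = frob_list A ps (quot (quot S q) p) (frob A p (quot S q) (frob A q S a))"
      using Cons.prems q S ps
      by (intro Cons.IH) (auto intro: frob_closed quot_stable)
    also have "frob A p (quot S q) (frob A q S a) = frob A q (quot S p) (frob A p S a)"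
      using frob_frob[of S p q a] Cons.prems q S by simp
    also have "quot (quot S q) p = quot (quot S p) q"
      using Cons.prems(1) by (simp add: quot_quot mult.commute)
    finally show ?thesis using False by simp
  qed simp
qed simp

lemma prime_list:
  fixes n :: nat
  assumes "n > 0"
  shows "\<forall>p\<in>set (sorted_list_of_multiset (prime_factorization n)). prime p"
    and "prod_list (sorted_list_of_multiset (prime_factorization n)) = n"
proof -
  show "\<forall>p\<in>set (sorted_list_of_multiset (prime_factorization n)). prime p"
    by (auto simp flip: set_mset_mset)
  have "prod_list (sorted_list_of_multiset (prime_factorization n))
      = prod_mset (mset (sorted_list_of_multiset (prime_factorization n)))"
    by (rule prod_mset_prod_list[symmetric])
  also have "\<dots> = n" using assms by (simp add: prod_mset_prime_factorization_nat)
  finally show "prod_list (sorted_list_of_multiset (prime_factorization n)) = n" .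
qed

lemma frob_n_hom:
  "\<lbrakk>S \<preceq> T; n \<in> S\<rbrakk> \<Longrightarrow> frob_n A n S \<in> rng_homs unital (rg A S) (rg A (quot S n))"
  using frob_list_hom[of S "sorted_list_of_multiset (prime_factorization n)"]
    prime_list[OF dstable_pos[of S T n]] by (simp add: frob_n_def)

lemma frob_n_closed:
  "\<lbrakk>S \<preceq> T; n \<in> S; a \<in> carrier (rg A S)\<rbrakk> \<Longrightarrow> frob_n A n S a \<in> carrier (rg A (quot S n))"
  using frob_n_hom[of S n] by (auto dest!: rng_homs_rng_hom simp: rng_hom_def)

lemma res_frob_n:
  "\<lbrakk>R \<preceq> S; S \<preceq> T; n \<in> R; a \<in> carrier (rg A S)\<rbrakk>
    \<Longrightarrow> res A (quot S n) (quot R n) (frob_n A n S a) = frob_n A n R (res A S R a)"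
  using res_frob_list[of R S "sorted_list_of_multiset (prime_factorization n)" a]
    prime_list[OF dstable_pos[of R S n]] by (simp add: frob_n_def)

text \<open>
  The two ways of peeling off a prime serve different purposes: $F_p$ first relates ghost components
  over $S/p$ and \<open>S\<close>, and $F_p$ last is the Frobenius relation required by Dwork's lemma.
\<close>

lemma frob_n_prime_mult:
  assumes "S \<preceq> T" "prime p" "p * n \<in> S" "a \<in> carrier (rg A S)"
  shows "frob_n A (p * n) S a = frob_n A n (quot S p) (frob A p S a)"
    and "frob_n A (p * n) S a = frob A p (quot S n) (frob_n A n S a)"
proof -
  let ?ps = "sorted_list_of_multiset (prime_factorization n)"
  have n: "n > 0" using dstable_pos[OF assms(1,3)] by simp
  have "prime_factorization (p * n) = add_mset p (prime_factorization n)"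
    using assms(2) n by (simp add: prime_factorization_mult prime_factorization_prime)
  then have "frob_n A (p * n) S a = frob_list A (insort p ?ps) S a"
    by (simp add: frob_n_def)
  also have "\<dots> = frob_list A ?ps (quot S p) (frob A p S a)"
    using assms prime_list[OF n] by (intro frob_list_insort) auto
  finally show 1: "frob_n A (p * n) S a = frob_n A n (quot S p) (frob A p S a)"
    by (simp add: frob_n_def)
  show "frob_n A (p * n) S a = frob A p (quot S n) (frob_n A n S a)"
    using frob_frob_list[of S p ?ps a] assms prime_list[OF n] 1 by (simp add: frob_n_def)
qed

lemma frob_n_1: "frob_n A 1 S a = a"
  by (simp add: frob_n_def)

definition ghost :: "nat set \<Rightarrow> 'a \<Rightarrow> nat \<Rightarrow> 'a" where
  "ghost S a n = res A (quot S n) {1} (frob_n A n S a)"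

lemma ghost_hom:
  assumes "S \<preceq> T" "n \<in> S"
  shows "(\<lambda>a. ghost S a n) \<in> rng_homs unital (rg A S) (rg A {1})"
  unfolding ghost_def
  by (rule rng_homs_comp[OF frob_n_hom[OF assms]
      res_hom[OF dstable_singleton[OF dstable_quot[OF assms]] quot_stable[OF assms]]])

lemma ghost_homo:
  assumes "S \<preceq> T" "n \<in> S"
  shows "rng_homo (rg A S) (rg A {1}) (\<lambda>a. ghost S a n)"
  unfolding rng_homo_def rng_homo_axioms_def
  using assms comm_rng_rg dstable_singleton dstable_trans rng_homs_rng_hom[OF ghost_hom]
  by blast

lemma ghost_res:
  assumes "R \<preceq> S" "S \<preceq> T" "n \<in> R" "a \<in> carrier (rg A S)"
  shows "ghost R (res A S R a) n = ghost S a n"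
proof -
  have n: "n \<in> S" using assms by (auto simp: dstable_subset_def)
  have "quot R n \<preceq> quot S n" "quot S n \<preceq> T" "{1} \<preceq> quot R n"
    by (rule dstable_quot_mono[OF assms(1-3)], rule quot_stable[OF assms(2) n],
      rule dstable_singleton[OF dstable_quot[OF assms(1,3)]])
  then show ?thesis
    unfolding ghost_def
    using assms n res_res[of "{1}" "quot R n" "quot S n" "frob_n A n S a"]
    by (simp add: frob_n_closed flip: res_frob_n)
qed

lemma ghost_frob:
  assumes "S \<preceq> T" "prime p" "n \<in> quot S p" "a \<in> carrier (rg A S)"
  shows "ghost (quot S p) (frob A p S a) n = ghost S a (p * n)"
  unfolding ghost_def
  using assms frob_n_prime_mult(1)[of S p n a]
  by (simp add: mem_quot quot_quot mult.commute)

lemma ghost_singleton: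
  assumes "{1} \<preceq> T" "a \<in> carrier (rg A {1})"
  shows "ghost {1} a 1 = a"
  unfolding ghost_def frob_n_1 quot_1 using assms by (rule res_id)

text \<open>
  Dwork's lemma for the rings $A_{S/n}$ with $g_n = F_n(a)$, where the congruences hold because
  $F_p F_n = F_{pn}$. Its components $s_d \in A_{S/d}$ are projected to $A_{\{1\}}$.
\<close>

lemma ghost_is_ghost_comp:
  assumes S: "S \<preceq> T" and a: "a \<in> carrier (rg A S)"
  shows "\<exists>s\<in>S \<rightarrow>\<^sub>E carrier (rg A {1}). \<forall>n\<in>S. ghost_comp (rg A {1}) s n = ghost S a n"
proof -
  let ?B = "\<lambda>n. rg A (quot S n)"
  have quot_sub: "quot S n \<preceq> quot S d" if "n \<in> S" "d dvd n" for n d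
  proof -
    have "quot S n = quot (quot S d) (n div d)" "n div d \<in> quot S d" "quot S d \<preceq> T"
      using that S dstable_dvd[OF S that]
      by (simp_all add: quot_quot mem_quot quot_stable)
    then show ?thesis using dstable_quot by metis
  qed
  interpret frobenius_system S ?B "\<lambda>d n. res A (quot S d) (quot S n)" "\<lambda>p n. frob A p (quot S n)"
  proof (rule frobenius_system.intro)
    show "divisor_stable S" using S by (simp add: dstable_subset_def)
    show "comm_rng (?B n)" if "n \<in> S" for n
      using comm_rng_rg quot_stable S that by blast
    show "res A (quot S d) (quot S n) \<in> rng_hom (?B d) (?B n)" if "n \<in> S" "d dvd n" for n d
      using rng_homs_rng_hom[OF res_hom[OF quot_sub[OF that] quot_stable[OF S dstable_dvd[OF S that]]]] .
    show "res A (quot S n) (quot S n) x = x" if "n \<in> S" "x \<in> carrier (?B n)" for n x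
      using res_id[OF quot_stable[OF S that(1)] that(2)] .
    show "res A (quot S m) (quot S n) (res A (quot S d) (quot S m) x) = res A (quot S d) (quot S n) x"
      if "n \<in> S" "m dvd n" "d dvd m" "x \<in> carrier (?B d)" for n m d x
    proof (rule res_res)
      have m: "m \<in> S" using dstable_dvd[OF S that(1,2)] .
      show "quot S n \<preceq> quot S m" by (rule quot_sub[OF that(1,2)])
      show "quot S m \<preceq> quot S d" by (rule quot_sub[OF m that(3)])
      show "quot S d \<preceq> T" by (rule quot_stable[OF S dstable_dvd[OF S m that(3)]])
    qed (rule that(4))
  next
    fix p n :: nat and x assume p: "prime p" "n * p \<in> S"
    have n: "n \<in> S" using dstable_dvd[OF S p(2)] by simp
    have q: "quot S n \<preceq> T" "p \<in> quot S n" "quot (quot S n) p = quot S (n * p)"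
      using S n p by (simp_all add: quot_stable mem_quot quot_quot mult.commute)
    show "frob A p (quot S n) \<in> rng_hom (?B n) (?B (n * p))"
      using rng_homs_rng_hom[OF frob_hom[OF q(1) p(1) q(2)]] q(3) by simp
    assume "x \<in> carrier (?B n)"
    then show "icong (?B (n * p)) p (frob A p (quot S n) x)
        (rpow (?B (n * p)) (res A (quot S n) (quot S (n * p)) x) p)"
      using frob_cong[OF q(1) p(1) q(2)] unfolding icong_def q(3) by blast
  qed
  have "\<exists>s. \<forall>n\<in>S. s n \<in> carrier (?B n)
      \<and> ghost_comp (?B n) (\<lambda>d. res A (quot S d) (quot S n) (s d)) n = frob_n A n S a"
  proof (rule dwork)
    show "frob_n A n S a \<in> carrier (?B n)" if "n \<in> S" for n
      using frob_n_closed[OF S that a] .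
    fix p n :: nat assume p: "prime p" "n * p \<in> S"
    have "frob A p (quot S n) (frob_n A n S a) = frob_n A (n * p) S a"
      using frob_n_prime_mult(2)[OF S p(1) _ a, of n] p(2) by (simp add: mult.commute)
    then show "icong (?B (n * p)) (p ^ multiplicity p (n * p))
        (frob A p (quot S n) (frob_n A n S a)) (frob_n A (n * p) S a)"
      using comm_rng.icong_refl[OF rng[OF p(2)]] frob_n_closed[OF S p(2) a] by simp
  qed
  then obtain s where s: "\<And>n. n \<in> S \<Longrightarrow> s n \<in> carrier (?B n)"
    "\<And>n. n \<in> S \<Longrightarrow> ghost_comp (?B n) (\<lambda>d. res A (quot S d) (quot S n) (s d)) n = frob_n A n S a"
    by blast
  let ?t = "\<lambda>d\<in>S. res A (quot S d) {1} (s d)"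
  have one: "{1} \<preceq> quot S n" if "n \<in> S" for n
    using dstable_singleton[OF dstable_quot[OF S that]] .
  have "?t \<in> S \<rightarrow>\<^sub>E carrier (rg A {1})"
    using s(1) one S by (auto intro!: res_closed quot_stable)
  moreover have "ghost_comp (rg A {1}) ?t n = ghost S a n" if n: "n \<in> S" for n
  proof -
    have dS: "d \<in> S" if "d dvd n" for d using dstable_dvd[OF S n that] .
    have n0: "n > 0" using dstable_pos[OF S n] .
    have qn: "quot S n \<preceq> T" using quot_stable[OF S n] .
    interpret H: rng_homo "?B n" "rg A {1}" "res A (quot S n) {1}"
      unfolding rng_homo_def rng_homo_axioms_def
      using comm_rng_rg[OF qn] comm_rng_rg[OF dstable_trans[OF one[OF n] qn]]
        rng_homs_rng_hom[OF res_hom[OF one[OF n] qn]] by blast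
    have c: "res A (quot S d) (quot S n) (s d) \<in> carrier (?B n)" if "d dvd n" for d
      using res_closed[OF quot_sub[OF n that] quot_stable[OF S dS[OF that]] s(1)[OF dS[OF that]]] .
    have "ghost S a n = ghost_comp (rg A {1})
        (\<lambda>d. res A (quot S n) {1} (res A (quot S d) (quot S n) (s d))) n"
      using H.hom_ghost_comp[OF n0, of "\<lambda>d. res A (quot S d) (quot S n) (s d)"] c s(2)[OF n]
      by (simp add: ghost_def)
    also have "\<dots> = ghost_comp (rg A {1}) ?t n"
    proof (rule H.cod.ghost_comp_cong[OF n0])
      fix d assume d: "d dvd n"
      show "res A (quot S n) {1} (res A (quot S d) (quot S n) (s d)) = ?t d"
        using res_res[OF one[OF n] quot_sub[OF n d] quot_stable[OF S dS[OF d]] s(1)[OF dS[OF d]]]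
          dS[OF d] by simp
      then show "?t d \<in> carrier (rg A {1})" using H.hom_closed[OF c[OF d]] by simp
    qed
    finally show ?thesis ..
  qed
  ultimately show ?thesis by blast
qed

end


section \<open>The comparison with Witt vectors\<close>

lemma witt_simps [simp]:
  "rg (witt R) = witt_ring R" "res (witt R) S\<^sub>2 S\<^sub>1 w = restrict w S\<^sub>1"
  "frob (witt R) = witt_frob R" "ver (witt R) = witt_ver R"
  "carrier (witt_ring R S) = S \<rightarrow>\<^sub>E carrier R"
  by (simp_all add: witt_def witt_ring_def)

lemma card_quot_less:
  assumes "S \<preceq> T" "finite S" "p > 1"
  shows "card (quot S p) < card S"
proof (rule psubset_card_mono[OF assms(2)])
  have "S \<noteq> {}" using dstable_one[OF assms(1)] by auto
  then have M: "Max S \<in> S" using assms(2) by simp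
  then have "Max S > 0" using dstable_pos[OF assms(1)] by simp
  then have "Max S * p > Max S" using assms(3) by simp
  then have "Max S * p \<notin> S" using Max_ge[OF assms(2)] leD by blast
  then show "quot S p \<subset> S" using M by (auto simp: quot_def)
qed

lemma card_prime_to_less:
  assumes "finite S" "p \<in> S"
  shows "card (prime_to S p) < card S"
proof (rule psubset_card_mono[OF assms(1)])
  have "p \<notin> prime_to S p" "prime_to S p \<subseteq> S" by (auto simp: prime_to_def)
  then show "prime_to S p \<subset> S" using assms(2) by blast
qed

text \<open>
  Induction over the short exact sequences
  $0 \<rightarrow> A_{S/p} \<rightarrow> A_S \<rightarrow> A_{S(p)} \<rightarrow> 0$.
\<close>

lemma finite_dstable_induct [consumes 2, case_names singleton step]:
  assumes "finite S" "S \<preceq> T"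
    and "P {1}"
    and "\<And>S p. \<lbrakk>finite S; S \<preceq> T; prime p; p \<in> S; P (quot S p); P (prime_to S p)\<rbrakk> \<Longrightarrow> P S"
  shows "P S"
  using assms(1,2)
proof (induction "card S" arbitrary: S rule: less_induct)
  case less
  show ?case
  proof (cases "S = {1}")
    case False
    then obtain n where n: "n \<in> S" "n \<noteq> 1" using dstable_one[OF less.prems(2)] by blast
    then obtain p where p: "prime p" "p dvd n" using prime_factor_nat by blast
    have pS: "p \<in> S" using dstable_dvd[OF less.prems(2) n(1) p(2)] .
    have sub: "quot S p \<preceq> S" "prime_to S p \<preceq> S"
      using dstable_quot[OF less.prems(2) pS] dstable_prime_to[OF less.prems(2) p(1)] by auto
    have fin: "finite (quot S p)" "finite (prime_to S p)"
      using less.prems(1) by (auto simp: quot_def prime_to_def)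
    have "P (quot S p)"
      using less.hyps[OF card_quot_less[OF less.prems(2,1) prime_gt_1_nat[OF p(1)]] fin(1)]
        dstable_trans[OF sub(1) less.prems(2)] by blast
    moreover have "P (prime_to S p)"
      using less.hyps[OF card_prime_to_less[OF less.prems(1) pS] fin(2)]
        dstable_trans[OF sub(2) less.prems(2)] by blast
    ultimately show ?thesis using assms(4) less.prems p(1) pS by blast
  qed (use assms(3) in simp)
qed

locale torsion_free_rfv = rfv_object +
  assumes no_torsion: "no_torsion T (rg A {1})"
begin

abbreviation "R \<equiv> rg A {1}"

(* Keeps {1} in the form in which it occurs in the definition of R. *)
declare One_nat_def [simp del]

lemma R_rng: "S \<preceq> T \<Longrightarrow> comm_rng R"
  using comm_rng_rg dstable_singleton dstable_trans by blast

lemma ghost_closed: "\<lbrakk>S \<preceq> T; n \<in> S; a \<in> carrier (rg A S)\<rbrakk> \<Longrightarrow> ghost S a n \<in> carrier R"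
  using rng_homo.hom_closed[OF ghost_homo] by blast

lemma ver_zero: "\<lbrakk>S \<preceq> T; prime p; p \<in> S\<rbrakk> \<Longrightarrow>
    ver A p S \<zero>\<^bsub>rg A (quot S p)\<^esub> = \<zero>\<^bsub>rg A S\<^esub>"
proof -
  assume *: "S \<preceq> T" "prime p" "p \<in> S"
  interpret Q: comm_rng "rg A (quot S p)" using comm_rng_rg quot_stable * by blast
  interpret S: comm_rng "rg A S" using comm_rng_rg * by blast
  let ?v = "ver A p S \<zero>\<^bsub>rg A (quot S p)\<^esub>"
  have "?v = ?v \<oplus>\<^bsub>rg A S\<^esub> ?v"
    using ver_hom[OF *] unfolding hom_def by (auto dest!: bspec[of _ _ "\<zero>\<^bsub>rg A (quot S p)\<^esub>"])
  moreover have "?v \<in> carrier (rg A S)" using ver_closed * by simp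
  ultimately show ?thesis by (metis S.add.r_cancel_one')
qed

text \<open>
  For $p \<nmid> n$ the map $F_n$ factors through $A_{S(p)}$ up to projections, where
  the image of $V_p$ vanishes.
\<close>

lemma ghost_ver:
  assumes S: "S \<preceq> T" "prime p" "p \<in> S" and a: "a \<in> carrier (rg A (quot S p))" and n: "n \<in> S"
  shows "ghost S (ver A p S a) n
    = (if p dvd n then [p] \<cdot>\<^bsub>R\<^esub> ghost (quot S p) a (n div p) else \<zero>\<^bsub>R\<^esub>)"
proof (cases "p dvd n")
  case True
  then obtain m where m: "n = p * m" by auto
  have mq: "m \<in> quot S p" using n m S(1) by (simp add: mem_quot mult.commute)
  have q: "quot S p \<preceq> T" using quot_stable[OF S(1,3)] .
  interpret H: rng_homo "rg A (quot S p)" R "\<lambda>a. ghost (quot S p) a m" by (rule ghost_homo[OF q mq])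
  have "ghost S (ver A p S a) n = ghost (quot S p) (frob A p S (ver A p S a)) m"
    using ghost_frob[OF S(1,2) mq ver_closed[OF S a]] m by simp
  also have "\<dots> = [p] \<cdot>\<^bsub>R\<^esub> ghost (quot S p) a m"
    using frob_ver_same[OF S a] H.hom_add_pow[OF a, of p] by simp
  finally show ?thesis using True m S(2) prime_gt_0_nat by simp
next
  case False
  let ?r = "prime_to S p"
  have r: "?r \<preceq> S" "n \<in> ?r" using dstable_prime_to[OF S(1,2)] n False by (auto simp: prime_to_def)
  have "ver A p S a \<in> a_kernel (rg A S) (rg A ?r) (res A S ?r)"
    using ver_exact[OF S] a by blast
  then have "res A S ?r (ver A p S a) = \<zero>\<^bsub>rg A ?r\<^esub>" by (simp add: a_kernel_def')
  then have "ghost S (ver A p S a) n = ghost ?r \<zero>\<^bsub>rg A ?r\<^esub> n"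
    using ghost_res[OF r(1) S(1) r(2) ver_closed[OF S a]] by simp
  also have "\<dots> = \<zero>\<^bsub>R\<^esub>"
    using rng_homo.hom_zero[OF ghost_homo[OF dstable_trans[OF r(1) S(1)] r(2)]] .
  finally show ?thesis using False by simp
qed

lemma torsion_free: "\<lbrakk>n \<in> T; x \<in> carrier R; y \<in> carrier R; [n] \<cdot>\<^bsub>R\<^esub> x = [n] \<cdot>\<^bsub>R\<^esub> y\<rbrakk> \<Longrightarrow> x = y"
  using no_torsion unfolding no_torsion_def inj_on_def by blast

lemma witt_eqI:
  assumes S: "S \<preceq> T" and "v \<in> S \<rightarrow>\<^sub>E carrier R" "w \<in> S \<rightarrow>\<^sub>E carrier R"
    and "\<And>n. n \<in> S \<Longrightarrow> ghost_comp R v n = ghost_comp R w n"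
  shows "v = w"
proof (rule PiE_ext)
  interpret comm_rng R by (rule R_rng[OF S])
  have "no_torsion S R" using no_torsion S by (auto simp: no_torsion_def dstable_subset_def)
  then show "v n = w n" if "n \<in> S" for n
    using S assms that by (intro ghost_comp_inj[of S v w]) (auto simp: dstable_subset_def)
qed (use assms in auto)

text \<open>
  If the ghost components of \<open>a\<close> vanish, the image of \<open>a\<close> over $S(p)$ is zero by induction, hence
  $a = V_p(c)$. Those of \<open>c\<close> then vanish after multiplication by \<open>p\<close>, hence vanish.
\<close>

lemma ghost_kernel_finite:
  assumes "finite S" "S \<preceq> T" "a \<in> carrier (rg A S)" "\<And>n. n \<in> S \<Longrightarrow> ghost S a n = \<zero>\<^bsub>R\<^esub>"
  shows "a = \<zero>\<^bsub>rg A S\<^esub>"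
  using assms
proof (induction arbitrary: a rule: finite_dstable_induct)
  case singleton
  then show ?case using ghost_singleton dstable_trans dstable_singleton assms(2) by (metis singletonI)
next
  case (step S p)
  let ?r = "prime_to S p" and ?q = "quot S p"
  have r: "?r \<preceq> S" "?r \<preceq> T" using step.hyps dstable_prime_to dstable_trans by blast+
  have q: "?q \<preceq> T" using step.hyps quot_stable by blast
  have sub: "?r \<subseteq> S" using r by (simp add: dstable_subset_def)
  have "ghost ?r (res A S ?r a) n = \<zero>\<^bsub>R\<^esub>" if "n \<in> ?r" for n
    using ghost_res[OF r(1) step.hyps(2) that step.prems(1)] step.prems(2) that sub by auto
  then have "res A S ?r a = \<zero>\<^bsub>rg A ?r\<^esub>"
    using step.IH(2) res_closed[OF r(1) step.hyps(2) step.prems(1)] by blast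
  then have "a \<in> ver A p S ` carrier (rg A ?q)"
    using ver_exact[OF step.hyps(2-4)] step.prems(1) by (simp add: a_kernel_def')
  then obtain c where c: "c \<in> carrier (rg A ?q)" "a = ver A p S c" by blast
  have "ghost ?q c m = \<zero>\<^bsub>R\<^esub>" if m: "m \<in> ?q" for m
  proof -
    interpret R: comm_rng R by (rule R_rng[OF step.hyps(2)])
    have pm: "p * m \<in> S" using m step.hyps(2) by (simp add: mem_quot mult.commute)
    have "p \<in> T" using step.hyps by (auto simp: dstable_subset_def)
    moreover have "[p] \<cdot>\<^bsub>R\<^esub> ghost ?q c m = [p] \<cdot>\<^bsub>R\<^esub> \<zero>\<^bsub>R\<^esub>"
      using ghost_ver[OF step.hyps(2-4) c(1) pm] step.prems(2)[OF pm] c(2)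
        prime_gt_0_nat[OF step.hyps(3)] by simp
    ultimately show ?thesis using torsion_free ghost_closed[OF q m c(1)] R.zero_closed by blast
  qed
  then have "c = \<zero>\<^bsub>rg A ?q\<^esub>" using step.IH(1) c(1) by blast
  then show ?case using c(2) ver_zero step.hyps by simp
qed

lemma ghost_inj_finite:
  assumes "finite S" and S: "S \<preceq> T" and a: "a \<in> carrier (rg A S)" and b: "b \<in> carrier (rg A S)"
    and eq: "\<And>n. n \<in> S \<Longrightarrow> ghost S a n = ghost S b n"
  shows "a = b"
proof -
  interpret S: comm_rng "rg A S" by (rule comm_rng_rg[OF S])
  interpret R: comm_rng R by (rule R_rng[OF S])
  have "a \<ominus>\<^bsub>rg A S\<^esub> b = \<zero>\<^bsub>rg A S\<^esub>"
  proof (rule ghost_kernel_finite[OF assms(1) S])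
    fix n assume n: "n \<in> S"
    interpret H: rng_homo "rg A S" R "\<lambda>a. ghost S a n" by (rule ghost_homo[OF S n])
    show "ghost S (a \<ominus>\<^bsub>rg A S\<^esub> b) n = \<zero>\<^bsub>R\<^esub>"
      using a b eq[OF n] H.hom_closed[OF b]
      by (simp add: a_minus_def H.hom_add H.hom_neg R.r_neg)
  qed (use a b in simp)
  then show ?thesis using a b by (metis S.add.inv_solve_right S.l_zero S.zero_closed a_minus_def)
qed

text \<open>
  The surjectivity half of the five lemma: a preimage over $S(p)$ is lifted to $A_S$ and
  corrected by an element of $V_p(A_{S/p})$.
\<close>

lemma ghost_surj_finite:
  assumes "finite S" "S \<preceq> T" "w \<in> S \<rightarrow>\<^sub>E carrier R"
  shows "\<exists>a\<in>carrier (rg A S). \<forall>n\<in>S. ghost S a n = ghost_comp R w n"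
  using assms
proof (induction arbitrary: w rule: finite_dstable_induct)
  case singleton
  have one: "{1} \<preceq> T" using dstable_trans[OF dstable_singleton assms(2)] assms(2) by blast
  interpret R: comm_rng R by (rule R_rng[OF one])
  have "w 1 \<in> carrier R" using singleton by auto
  then show ?case
    using ghost_singleton[OF one] R.ghost_comp_1[of w] by (intro bexI[of _ "w 1"]) auto
next
  case (step S p)
  let ?r = "prime_to S p" and ?q = "quot S p"
  note S = step.hyps(2-4)
  interpret R: comm_rng R by (rule R_rng[OF S(1)])
  interpret AS: comm_rng "rg A S" by (rule comm_rng_rg[OF S(1)])
  have r: "?r \<preceq> S" "?r \<preceq> T" using S dstable_prime_to dstable_trans by blast+
  have q: "?q \<preceq> T" using S quot_stable by blast
  have sub: "?r \<subseteq> S" using r by (simp add: dstable_subset_def)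
  have dS: "divisor_stable S" "divisor_stable ?r" using S r by (auto simp: dstable_subset_def)
  have p0: "p > 0" using S prime_gt_0_nat by blast
  have wc: "w n \<in> carrier R" if "n \<in> S" for n using that step.prems by auto
  have "restrict w ?r \<in> ?r \<rightarrow>\<^sub>E carrier R" using wc sub by auto
  from step.IH(2)[OF this] obtain b where b: "b \<in> carrier (rg A ?r)"
    "\<And>n. n \<in> ?r \<Longrightarrow> ghost ?r b n = ghost_comp R (restrict w ?r) n" by blast
  obtain a0 where a0: "a0 \<in> carrier (rg A S)" "res A S ?r a0 = b"
    using res_surj[OF S] b(1) by (metis imageE)
  obtain s where s: "s \<in> S \<rightarrow>\<^sub>E carrier R" "\<And>n. n \<in> S \<Longrightarrow> ghost_comp R s n = ghost S a0 n"
    using ghost_is_ghost_comp[OF S(1) a0(1)] by blast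
  obtain c where c: "c \<in> S \<rightarrow>\<^sub>E carrier R"
    "\<And>n. n \<in> S \<Longrightarrow> ghost_comp R c n = ghost_comp R w n \<ominus>\<^bsub>R\<^esub> ghost_comp R s n"
    using R.witt_diff_exists[OF dS(1) step.prems s(1)] by blast
  have cc: "c n \<in> carrier R" if "n \<in> S" for n using that c(1) by auto
  have "restrict c ?r = \<zero>\<^bsub>witt_ring R ?r\<^esub>"
  proof (rule witt_eqI[OF r(2)])
    fix n assume n: "n \<in> ?r"
    then have nS: "n \<in> S" using sub by auto
    have n0: "n > 0" using dstable_pos[OF S(1) nS] .
    have dr: "d \<in> ?r" if "d dvd n" for d using dstable_dvd[OF r(1) n that] .
    have restr: "ghost_comp R (restrict x ?r) n = ghost_comp R x n" if "\<And>n. n \<in> S \<Longrightarrow> x n \<in> carrier R" for x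
      by (rule R.ghost_comp_cong[OF n0]) (use dr sub that in auto)
    have "ghost_comp R s n = ghost_comp R w n"
      using s(2)[OF nS] ghost_res[OF r(1) S(1) n a0(1)] a0(2) b(2)[OF n] restr[OF wc] by simp
    then have "ghost_comp R c n = \<zero>\<^bsub>R\<^esub>"
      using c(2)[OF nS] R.ghost_comp_witt_closed[OF dS(1) s(1) nS] by (simp add: a_minus_def R.r_neg)
    then show "ghost_comp R (restrict c ?r) n = ghost_comp R \<zero>\<^bsub>witt_ring R ?r\<^esub> n"
      using restr[OF cc] R.ghost_comp_witt_zero[OF dS(2) n] by simp
  qed (use cc sub in \<open>auto simp: witt_ring_def\<close>)
  then have c0: "c n = \<zero>\<^bsub>R\<^esub>" if "n \<in> ?r" for n
    using that by (auto simp: witt_ring_def dest!: fun_cong[of _ _ n])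
  let ?c = "\<lambda>m\<in>?q. c (m * p)"
  have c': "?c \<in> ?q \<rightarrow>\<^sub>E carrier R"
    using cc S(1) by (auto simp: mem_quot)
  have cv: "c = witt_ver R p S ?c"
  proof (rule PiE_ext[OF c(1) R.witt_ver_closed[OF c' dS(1)]])
    fix n assume n: "n \<in> S"
    show "c n = witt_ver R p S ?c n"
    proof (cases "p dvd n")
      case True
      then have "n div p \<in> ?q" using n S(1) by (simp add: mem_quot)
      then show ?thesis using n True by (simp add: witt_ver_def)
    next
      case False
      then show ?thesis using n c0 by (simp add: witt_ver_def prime_to_def)
    qed
  qed
  obtain a1 where a1: "a1 \<in> carrier (rg A ?q)" "\<And>n. n \<in> ?q \<Longrightarrow> ghost ?q a1 n = ghost_comp R ?c n"
    using step.IH(1)[OF c'] by blast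
  show ?case
  proof (intro bexI ballI)
    show "a0 \<oplus>\<^bsub>rg A S\<^esub> ver A p S a1 \<in> carrier (rg A S)"
      using a0(1) ver_closed[OF S a1(1)] by simp
    fix n assume n: "n \<in> S"
    interpret H: rng_homo "rg A S" R "\<lambda>a. ghost S a n" by (rule ghost_homo[OF S(1) n])
    have "ghost S (ver A p S a1) n = ghost_comp R c n"
    proof (cases "p dvd n")
      case True
      then have "n div p \<in> ?q" using n S(1) by (simp add: mem_quot)
      then show ?thesis
        using ghost_ver[OF S a1(1) n] R.ghost_comp_witt_ver[OF dS(1) c' p0 n] True a1(2) cv by simp
    next
      case False
      then show ?thesis
        using ghost_ver[OF S a1(1) n] R.ghost_comp_witt_ver[OF dS(1) c' p0 n] cv by simp
    qed
    moreover have "ghost_comp R w n \<in> carrier R" "ghost_comp R s n \<in> carrier R"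
      using R.ghost_comp_witt_closed[OF dS(1) _ n] step.prems s(1) by blast+
    ultimately show "ghost S (a0 \<oplus>\<^bsub>rg A S\<^esub> ver A p S a1) n = ghost_comp R w n"
      using H.hom_add[OF a0(1) ver_closed[OF S a1(1)]] s(2)[OF n] c(2)[OF n]
      by (simp add: a_minus_def R.a_lcomm[of "ghost S a0 n" "ghost_comp R w n"] R.r_neg)
  qed
qed

text \<open>
  An element of $A_S$ is determined by its images over the finite divisor stable subsets of \<open>S\<close>.
\<close>

lemma ghost_eqI:
  assumes S: "S \<preceq> T" and a: "a \<in> carrier (rg A S)" and b: "b \<in> carrier (rg A S)"
    and eq: "\<And>n. n \<in> S \<Longrightarrow> ghost S a n = ghost S b n"
  shows "a = b"
proof -
  have res_eq: "res A S Q a = res A S Q b" if "Q \<preceq> S" "finite Q" for Q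
  proof (rule ghost_inj_finite[OF that(2)])
    show "Q \<preceq> T" using that S dstable_trans by blast
    show "res A S Q a \<in> carrier (rg A Q)" "res A S Q b \<in> carrier (rg A Q)"
      using res_closed that S a b by blast+
    fix n assume n: "n \<in> Q"
    then have "n \<in> S" using that by (auto simp: dstable_subset_def)
    then show "ghost Q (res A S Q a) n = ghost Q (res A S Q b) n"
      using ghost_res[OF that(1) S n] a b eq by simp
  qed
  have "\<exists>!x. x \<in> carrier (rg A S) \<and> (\<forall>Q. Q \<preceq> S \<and> finite Q \<longrightarrow> res A S Q x = res A S Q b)"
  proof (rule continuous[OF S])
    show "res A S Q b \<in> carrier (rg A Q)" if "Q \<preceq> S" for Q using res_closed that S b by blast
    show "res A Q Q' (res A S Q b) = res A S Q' b" if "Q' \<preceq> Q" "Q \<preceq> S" for Q Q'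
      using res_res[OF that S b] .
  qed
  then show ?thesis using a b res_eq by blast
qed

text \<open>
  The preimages over finite divisor stable subsets are unique, hence compatible, and define an
  element of the projective limit.
\<close>

lemma ghost_surj:
  assumes S: "S \<preceq> T" and w: "w \<in> S \<rightarrow>\<^sub>E carrier R"
  shows "\<exists>a\<in>carrier (rg A S). \<forall>n\<in>S. ghost S a n = ghost_comp R w n"
proof -
  interpret R: comm_rng R by (rule R_rng[OF S])
  have "\<exists>a. a \<in> carrier (rg A Q) \<and> (\<forall>n\<in>Q. ghost Q a n = ghost_comp R w n)"
    if Q: "Q \<preceq> S" "finite Q" for Q
  proof -
    have sub: "Q \<subseteq> S" using Q by (simp add: dstable_subset_def)
    have wc: "w n \<in> carrier R" if "n \<in> Q" for n using that sub w by auto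
    then have "restrict w Q \<in> Q \<rightarrow>\<^sub>E carrier R" by auto
    then obtain a where a: "a \<in> carrier (rg A Q)"
      "\<And>n. n \<in> Q \<Longrightarrow> ghost Q a n = ghost_comp R (restrict w Q) n"
      using ghost_surj_finite[OF Q(2) dstable_trans[OF Q(1) S]] by blast
    moreover have "ghost_comp R (restrict w Q) n = ghost_comp R w n" if n: "n \<in> Q" for n
      by (rule R.ghost_comp_cong) (use n dstable_pos[OF Q(1) n] dstable_dvd[OF Q(1) n] wc in auto)
    ultimately show ?thesis by auto
  qed
  then obtain x where x: "\<And>Q. Q \<preceq> S \<Longrightarrow> finite Q \<Longrightarrow> x Q \<in> carrier (rg A Q)"
    "\<And>Q n. Q \<preceq> S \<Longrightarrow> finite Q \<Longrightarrow> n \<in> Q \<Longrightarrow> ghost Q (x Q) n = ghost_comp R w n"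
    by metis
  have "\<exists>!a. a \<in> carrier (rg A S) \<and> (\<forall>Q. Q \<preceq> S \<and> finite Q \<longrightarrow> res A S Q a = x Q)"
  proof (rule continuous[OF S x(1)])
    fix Q Q' assume Q: "Q \<preceq> Q'" "Q' \<preceq> S" "finite Q'"
    have QS: "Q \<preceq> S" "Q' \<preceq> T" "finite Q"
      using Q S dstable_trans finite_subset unfolding dstable_subset_def by blast+
    show "res A Q' Q (x Q') = x Q"
    proof (rule ghost_inj_finite[OF QS(3)])
      show "Q \<preceq> T" using QS(1) S by (rule dstable_trans)
      show "res A Q' Q (x Q') \<in> carrier (rg A Q)" using res_closed Q QS x(1) by blast
      show "x Q \<in> carrier (rg A Q)" using x(1) QS by blast
      fix n assume n: "n \<in> Q"
      then have "n \<in> Q'" using Q by (auto simp: dstable_subset_def)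
      then show "ghost Q (res A Q' Q (x Q')) n = ghost Q (x Q) n"
        using ghost_res[OF Q(1) QS(2) n x(1)[OF Q(2,3)]] x(2) Q QS n by simp
    qed
  qed
  then obtain a where a: "a \<in> carrier (rg A S)" "\<And>Q. Q \<preceq> S \<Longrightarrow> finite Q \<Longrightarrow> res A S Q a = x Q"
    by blast
  have "ghost S a n = ghost_comp R w n" if n: "n \<in> S" for n
  proof -
    let ?D = "{d. d dvd n}"
    have D: "?D \<preceq> S" "finite ?D" using dstable_divisors[OF S n] dstable_pos[OF S n] by simp_all
    have "ghost S a n = ghost ?D (res A S ?D a) n" using ghost_res[OF D(1) S _ a(1)] by simp
    then show ?thesis using a(2)[OF D] x(2)[OF D] by simp
  qed
  then show ?thesis using a(1) by blast
qed

definition to_witt :: "nat set \<Rightarrow> 'a \<Rightarrow> nat \<Rightarrow> 'a" where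
  "to_witt S a = (SOME w. w \<in> S \<rightarrow>\<^sub>E carrier R \<and> (\<forall>n\<in>S. ghost_comp R w n = ghost S a n))"

lemma to_witt:
  assumes "S \<preceq> T" "a \<in> carrier (rg A S)"
  shows to_witt_closed: "to_witt S a \<in> S \<rightarrow>\<^sub>E carrier R"
    and ghost_to_witt: "n \<in> S \<Longrightarrow> ghost_comp R (to_witt S a) n = ghost S a n"
proof -
  have "\<exists>w. w \<in> S \<rightarrow>\<^sub>E carrier R \<and> (\<forall>n\<in>S. ghost_comp R w n = ghost S a n)"
    using ghost_is_ghost_comp[OF assms] by blast
  from someI_ex[OF this] show "to_witt S a \<in> S \<rightarrow>\<^sub>E carrier R"
    "n \<in> S \<Longrightarrow> ghost_comp R (to_witt S a) n = ghost S a n"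
    unfolding to_witt_def by blast+
qed

lemma to_witt_eqI:
  assumes "S \<preceq> T" "a \<in> carrier (rg A S)" "w \<in> S \<rightarrow>\<^sub>E carrier R"
    and "\<And>n. n \<in> S \<Longrightarrow> ghost_comp R w n = ghost S a n"
  shows "to_witt S a = w"
  using assms to_witt by (intro witt_eqI[of S]) auto

lemma to_witt_bij:
  assumes S: "S \<preceq> T"
  shows "bij_betw (to_witt S) (carrier (rg A S)) (S \<rightarrow>\<^sub>E carrier R)"
  unfolding bij_betw_def
proof
  show "inj_on (to_witt S) (carrier (rg A S))"
  proof (rule inj_onI)
    fix a b assume "a \<in> carrier (rg A S)" "b \<in> carrier (rg A S)" "to_witt S a = to_witt S b"
    then show "a = b" using ghost_eqI[OF S] ghost_to_witt[OF S] by metis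
  qed
  show "to_witt S ` carrier (rg A S) = S \<rightarrow>\<^sub>E carrier R"
  proof
    show "to_witt S ` carrier (rg A S) \<subseteq> S \<rightarrow>\<^sub>E carrier R" using to_witt_closed[OF S] by blast
    show "S \<rightarrow>\<^sub>E carrier R \<subseteq> to_witt S ` carrier (rg A S)"
    proof
      fix w assume w: "w \<in> S \<rightarrow>\<^sub>E carrier R"
      from ghost_surj[OF S w] obtain a where a: "a \<in> carrier (rg A S)" "\<forall>n\<in>S. ghost S a n = ghost_comp R w n"
        by blast
      then have "to_witt S a = w" using w by (intro to_witt_eqI[OF S]) auto
      then show "w \<in> to_witt S ` carrier (rg A S)" using a(1) by blast
    qed
  qed
qed

lemma to_witt_hom:
  assumes S: "S \<preceq> T"
  shows "to_witt S \<in> rng_homs unital (rg A S) (witt_ring R S)"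
proof (rule rng_homsI)
  interpret R: comm_rng R by (rule R_rng[OF S])
  interpret AS: comm_rng "rg A S" by (rule comm_rng_rg[OF S])
  have dS: "divisor_stable S" using S by (simp add: dstable_subset_def)
  show "to_witt S \<in> rng_hom (rg A S) (witt_ring R S)"
    unfolding rng_hom_def
  proof (intro CollectI conjI ballI)
    show "to_witt S \<in> carrier (rg A S) \<rightarrow> carrier (witt_ring R S)" using to_witt_closed[OF S] by simp
    fix a b assume ab: "a \<in> carrier (rg A S)" "b \<in> carrier (rg A S)"
    note cl = dS to_witt_closed[OF S ab(1)] to_witt_closed[OF S ab(2)]
    show "to_witt S (a \<otimes>\<^bsub>rg A S\<^esub> b) = to_witt S a \<otimes>\<^bsub>witt_ring R S\<^esub> to_witt S b"
    proof (rule to_witt_eqI[OF S])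
      fix n assume n: "n \<in> S"
      show "ghost_comp R (to_witt S a \<otimes>\<^bsub>witt_ring R S\<^esub> to_witt S b) n = ghost S (a \<otimes>\<^bsub>rg A S\<^esub> b) n"
        using R.witt_mult(2)[OF cl n] ghost_to_witt[OF S _ n] ab
          rng_homo.hom_mult[OF ghost_homo[OF S n] ab] by simp
    qed (use R.witt_mult(1)[OF cl] ab AS.m_closed in auto)
    show "to_witt S (a \<oplus>\<^bsub>rg A S\<^esub> b) = to_witt S a \<oplus>\<^bsub>witt_ring R S\<^esub> to_witt S b"
    proof (rule to_witt_eqI[OF S])
      fix n assume n: "n \<in> S"
      show "ghost_comp R (to_witt S a \<oplus>\<^bsub>witt_ring R S\<^esub> to_witt S b) n = ghost S (a \<oplus>\<^bsub>rg A S\<^esub> b) n"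
        using R.witt_add(2)[OF cl n] ghost_to_witt[OF S _ n] ab
          rng_homo.hom_add[OF ghost_homo[OF S n] ab] by simp
    qed (use R.witt_add(1)[OF cl] ab in auto)
  qed
  assume u: unital
  interpret R: cring R using rng[OF dstable_trans[OF dstable_singleton[OF S] S]] u by (simp add: is_rng_def)
  interpret AS: cring "rg A S" using rng[OF S] u by (simp add: is_rng_def)
  show "to_witt S \<one>\<^bsub>rg A S\<^esub> = \<one>\<^bsub>witt_ring R S\<^esub>"
  proof (rule to_witt_eqI[OF S])
    show "\<one>\<^bsub>witt_ring R S\<^esub> \<in> S \<rightarrow>\<^sub>E carrier R" by (auto simp: witt_ring_def)
    fix n assume n: "n \<in> S"
    show "ghost_comp R \<one>\<^bsub>witt_ring R S\<^esub> n = ghost S \<one>\<^bsub>rg A S\<^esub> n"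
      using R.ghost_comp_witt_one[OF dS n] ghost_hom[OF S n] u rng_homs_one by fastforce
  qed simp
qed

text \<open>
  Each compatibility is an equality of Witt vectors, which follows from the equality of their ghost
  components.
\<close>

lemma to_witt_transport: "rfv_transport unital T A (witt R) to_witt"
proof (intro rfv_transport.intro rfv_transport_axioms.intro rfv_object_axioms)
  fix S assume S: "S \<preceq> T"
  interpret R: comm_rng R by (rule R_rng[OF S])
  interpret AS: comm_rng "rg A S" by (rule comm_rng_rg[OF S])
  have dS: "divisor_stable S" using S by (simp add: dstable_subset_def)
  show "bij_betw (to_witt S) (carrier (rg A S)) (carrier (rg (witt R) S))"
    using to_witt_bij[OF S] by simp
  show "to_witt S \<in> rng_homs unital (rg A S) (rg (witt R) S)"
    using to_witt_hom[OF S] by simp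
  have "to_witt S \<zero>\<^bsub>rg A S\<^esub> = \<zero>\<^bsub>witt_ring R S\<^esub>"
  proof (rule to_witt_eqI[OF S])
    show "\<zero>\<^bsub>witt_ring R S\<^esub> \<in> S \<rightarrow>\<^sub>E carrier R" by (auto simp: witt_ring_def)
    show "ghost_comp R \<zero>\<^bsub>witt_ring R S\<^esub> n = ghost S \<zero>\<^bsub>rg A S\<^esub> n" if "n \<in> S" for n
      using R.ghost_comp_witt_zero[OF dS that] rng_homo.hom_zero[OF ghost_homo[OF S that]] by simp
  qed simp
  then show "to_witt S \<zero>\<^bsub>rg A S\<^esub> = \<zero>\<^bsub>rg (witt R) S\<^esub>" by simp
  {
    fix Q a assume Q: "Q \<preceq> S" and a: "a \<in> carrier (rg A S)"
    have "to_witt Q (res A S Q a) = restrict (to_witt S a) Q"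
    proof (rule to_witt_eqI)
      show "Q \<preceq> T" using Q S by (rule dstable_trans)
      show "res A S Q a \<in> carrier (rg A Q)" using res_closed Q S a by blast
      have sub: "Q \<subseteq> S" using Q by (simp add: dstable_subset_def)
      then show "restrict (to_witt S a) Q \<in> Q \<rightarrow>\<^sub>E carrier R"
        using to_witt_closed[OF S a] by auto
      fix n assume n: "n \<in> Q"
      have dQ: "d \<in> Q" if "d dvd n" for d using dstable_dvd[OF Q n that] .
      have "ghost_comp R (restrict (to_witt S a) Q) n = ghost_comp R (to_witt S a) n"
        by (rule R.ghost_comp_cong[OF dstable_pos[OF Q n]])
          (use dQ sub to_witt_closed[OF S a] in auto)
      then show "ghost_comp R (restrict (to_witt S a) Q) n = ghost Q (res A S Q a) n"
        using ghost_to_witt[OF S a] ghost_res[OF Q S n a] n sub by auto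
    qed
    then show "to_witt Q (res A S Q a) = res (witt R) S Q (to_witt S a)" by simp
  next
    fix p a assume p: "prime p" "p \<in> S" and a: "a \<in> carrier (rg A S)"
    have p0: "p > 0" using dstable_pos[OF S p(2)] .
    note W = R.witt_frob_closed_ghost[OF dS to_witt_closed[OF S a] p0]
    have "to_witt (quot S p) (frob A p S a) = witt_frob R p S (to_witt S a)"
    proof (rule to_witt_eqI[OF quot_stable[OF S p(2)] frob_closed[OF S p a] W(1)])
      fix n assume n: "n \<in> quot S p"
      then have "p * n \<in> S" using S by (simp add: mem_quot mult.commute)
      then show "ghost_comp R (witt_frob R p S (to_witt S a)) n = ghost (quot S p) (frob A p S a) n"
        using W(2)[OF n] ghost_to_witt[OF S a] ghost_frob[OF S p(1) n a] by simp
    qed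
    then show "to_witt (quot S p) (frob A p S a) = frob (witt R) p S (to_witt S a)" by simp
  next
    fix p a assume p: "prime p" "p \<in> S" and a: "a \<in> carrier (rg A (quot S p))"
    have p0: "p > 0" using dstable_pos[OF S p(2)] .
    have q: "quot S p \<preceq> T" using quot_stable[OF S p(2)] .
    note w = to_witt_closed[OF q a]
    have "to_witt S (ver A p S a) = witt_ver R p S (to_witt (quot S p) a)"
    proof (rule to_witt_eqI[OF S ver_closed[OF S p a] R.witt_ver_closed[OF w dS]])
      fix n assume n: "n \<in> S"
      have "ghost_comp R (to_witt (quot S p) a) (n div p) = ghost (quot S p) a (n div p)" if "p dvd n"
        using that n S by (intro ghost_to_witt[OF q a]) (simp add: mem_quot)
      then show "ghost_comp R (witt_ver R p S (to_witt (quot S p) a)) n = ghost S (ver A p S a) n"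
        using R.ghost_comp_witt_ver[OF dS w p0 n] ghost_ver[OF S p a n] by simp
    qed
    then show "to_witt S (ver A p S a) = ver (witt R) p S (to_witt (quot S p) a)" by simp
  }
qed

lemma ghost_condition_iff:
  "ghost_condition T A \<beta> \<longleftrightarrow>
    (\<forall>S. S \<preceq> T \<longrightarrow> (\<forall>a\<in>carrier (rg A S). \<forall>n\<in>S. ghost_comp R (\<beta> S a) n = ghost S a n))"
  by (auto simp: ghost_condition_def ghost_map_eq_ghost_comp ghost_def fun_eq_iff restrict_def)

lemma ghost_condition_to_witt: "ghost_condition T A to_witt"
  unfolding ghost_condition_iff using ghost_to_witt by blast

lemma ghost_condition_unique:
  assumes "\<And>S. S \<preceq> T \<Longrightarrow> \<beta> S \<in> carrier (rg A S) \<rightarrow> carrier (witt_ring R S)"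
    and "ghost_condition T A \<beta>"
  shows "agree T A to_witt \<beta>"
  unfolding agree_def
proof (intro allI impI ballI)
  fix S a assume "S \<preceq> T" "a \<in> carrier (rg A S)"
  then show "to_witt S a = \<beta> S a"
    using assms unfolding ghost_condition_iff by (intro to_witt_eqI) (auto simp: Pi_iff)
qed

lemma rf_mor_witt_closed:
  assumes "rf_mor unital T A (witt R) \<beta>" "S \<preceq> T"
  shows "\<beta> S \<in> carrier (rg A S) \<rightarrow> carrier (witt_ring R S)"
proof -
  have "\<beta> S \<in> rng_homs unital (rg A S) (witt_ring R S)"
    using assms by (simp add: rf_mor_def)
  from rng_homs_rng_hom[OF this] show ?thesis unfolding rng_hom_def by simp
qed

text \<open>
  The \<open>n\<close>-th ghost component of a Witt vector \<open>w\<close> is the component at index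
  \<open>1\<close> of $F_n(w)$. So a morphism that is the identity at $\{1\}$ has the prescribed ghost components.
\<close>

lemma rf_mor_ghost_condition:
  assumes mor: "rf_mor unital T A (witt R) \<beta>" and id: "identity_at_1 A \<beta>"
  shows "ghost_condition T A \<beta>"
  unfolding ghost_condition_iff
proof (intro allI impI ballI)
  have closed: "\<beta> S a \<in> S \<rightarrow>\<^sub>E carrier R" if "S \<preceq> T" "a \<in> carrier (rg A S)" for S a
    using rf_mor_witt_closed[OF mor that(1)] that(2) by auto
  have res: "\<beta> Q (res A S Q a) = restrict (\<beta> S a) Q"
    if "Q \<preceq> S" "S \<preceq> T" "a \<in> carrier (rg A S)" for Q S a
    using mor that by (simp add: rf_mor_def)
  have frob: "\<beta> (quot S p) (frob A p S a) = witt_frob R p S (\<beta> S a)"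
    if "S \<preceq> T" "prime p" "p \<in> S" "a \<in> carrier (rg A S)" for S p a
    using mor that by (simp add: rf_mor_def)
  have list: "ghost_comp R (\<beta> (quot S (prod_list ps)) (frob_list A ps S a)) 1
      = ghost_comp R (\<beta> S a) (prod_list ps)"
    if "S \<preceq> T" "\<forall>p\<in>set ps. prime p" "prod_list ps \<in> S" "a \<in> carrier (rg A S)" for S a ps
    using that
  proof (induction ps arbitrary: S a)
    case Nil
    then show ?case by (simp add: quot_def)
  next
    case (Cons p ps)
    have p: "prime p" "p \<in> S" using Cons.prems dstable_dvd[OF Cons.prems(1,3)] by auto
    have ps: "prod_list ps \<in> quot S p"
      using Cons.prems by (simp add: mem_quot mult.commute)
    interpret R: comm_rng R by (rule R_rng[OF Cons.prems(1)])
    have "ghost_comp R (\<beta> (quot (quot S p) (prod_list ps)) (frob_list A ps (quot S p) (frob A p S a))) 1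
        = ghost_comp R (\<beta> (quot S p) (frob A p S a)) (prod_list ps)"
      using Cons.prems p ps by (intro Cons.IH) (auto intro: frob_closed quot_stable)
    also have "\<dots> = ghost_comp R (witt_frob R p S (\<beta> S a)) (prod_list ps)"
      using frob Cons.prems p by simp
    also have "\<dots> = ghost_comp R (\<beta> S a) (p * prod_list ps)"
      using Cons.prems closed ps dstable_pos[OF Cons.prems(1) p(2)]
      by (intro R.witt_frob_closed_ghost(2)) (auto simp: dstable_subset_def)
    finally show ?case using Cons.prems(1) by (simp add: quot_quot)
  qed
  fix S a n assume S: "S \<preceq> T" and a: "a \<in> carrier (rg A S)" and n: "n \<in> S"
  interpret R: comm_rng R by (rule R_rng[OF S])
  let ?ps = "sorted_list_of_multiset (prime_factorization n)"
  have q: "quot S n \<preceq> T" "{1} \<preceq> quot S n" "1 \<in> quot S n"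
    using quot_stable[OF S n] dstable_singleton dstable_one by blast+
  let ?b = "frob_n A n S a"
  have b: "?b \<in> carrier (rg A (quot S n))" by (rule frob_n_closed[OF S n a])
  have "ghost_comp R (\<beta> S a) n = ghost_comp R (\<beta> (quot S n) ?b) 1"
    using list[OF S, of ?ps a] prime_list[OF dstable_pos[OF S n]] n a by (simp add: frob_n_def)
  also have "\<dots> = \<beta> (quot S n) ?b 1"
    by (rule R.ghost_comp_1) (use closed[OF q(1) b] q(3) in auto)
  also have "\<dots> = \<beta> {1} (res A (quot S n) {1} ?b) 1"
    using res[OF q(2,1) b] by simp
  also have "\<dots> = ghost S a n"
    using id res_closed[OF q(2,1) b] by (simp add: identity_at_1_def ghost_def)
  finally show "ghost_comp R (\<beta> S a) n = ghost S a n" .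
qed

lemma identity_at_1_to_witt: "S \<preceq> T \<Longrightarrow> identity_at_1 A to_witt"
  unfolding identity_at_1_def
proof
  fix a assume S: "S \<preceq> T" and a: "a \<in> carrier (rg A {1})"
  have one: "{1} \<preceq> T" using dstable_trans[OF dstable_singleton[OF S] S] .
  interpret R: comm_rng R by (rule R_rng[OF S])
  show "to_witt {1} a = (\<lambda>n\<in>{1}. a)"
    using a ghost_singleton[OF one a] R.ghost_comp_1[of "\<lambda>n\<in>{1}. a"]
    by (intro to_witt_eqI[OF one]) auto
qed

end

theorem proposition2:
  fixes unital :: bool and T :: "nat set" and A :: "'a rfv"
  assumes "divisor_stable T"
    and "rfv_object unital T A"
    and "no_torsion T (rg A {1})"
  shows "\<exists>\<alpha>.
    rf_mor unital T A (witt (rg A {1})) \<alpha> \<and> identity_at_1 A \<alpha> \<and>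
    (\<forall>\<beta>. rf_mor unital T A (witt (rg A {1})) \<beta> \<and> identity_at_1 A \<beta> \<longrightarrow> agree T A \<alpha> \<beta>) \<and>
    ghost_condition T A \<alpha> \<and>
    (\<forall>\<beta>. (\<forall>S. S \<preceq> T \<longrightarrow> \<beta> S \<in> carrier (rg A S) \<rightarrow> carrier (witt_ring (rg A {1}) S)) \<and>
         ghost_condition T A \<beta> \<longrightarrow> agree T A \<alpha> \<beta>) \<and>
    rfv_iso unital T A (witt (rg A {1})) \<alpha> \<and>
    rf_iso unital T A (witt (rg A {1})) \<alpha>"
proof -
  interpret torsion_free_rfv unital T A
    using assms(2,3) by (intro torsion_free_rfv.intro torsion_free_rfv_axioms.intro)
  interpret W: rfv_transport unital T A "witt (rg A {1})" to_witt
    by (rule to_witt_transport)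
  have T: "T \<preceq> T" using assms(1) by (simp add: dstable_subset_def)
  have mor_unique: "agree T A to_witt \<beta>"
    if "rf_mor unital T A (witt (rg A {1})) \<beta>" "identity_at_1 A \<beta>" for \<beta>
    by (rule ghost_condition_unique[OF rf_mor_witt_closed[OF that(1)] rf_mor_ghost_condition[OF that]])
  show ?thesis
    using W.rfv_mor identity_at_1_to_witt[OF T] mor_unique ghost_condition_to_witt
      ghost_condition_unique W.rfv_iso W.rf_iso
    by (intro exI[of _ to_witt]) (auto simp: rfv_mor_def)
qed

end
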